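(* In the setting of the context, assume that $(V_n)$ has a finite moment of order $4$. Then we have the joint asymptotic normality $$\sqrt{n}\begin{pmatrix}\widehat{\theta}_n-\theta^{*}\\ \widehat{\rho}_n-\rho^{*}\end{pmatrix}\xrightarrow{\ \mathcal{L}\ }\mathcal{N}(0,\Gamma)$$ (convergence in distribution), where $\Gamma=P\,\Delta_{p+1}P'$. In particular, $$\sqrt{n}\,(\widehat{\rho}_n-\rho^{*})\xrightarrow{\ \mathcal{L}\ }\mathcal{N}(0,\sigma_\rho^2),$$ where $\sigma_\rho^2=\Gamma_{p+1,\,p+1}$ is the last diagonal element of $\Gamma$. (Normal laws may be degenerate.)
   Context: Let $p\ge 1$ be an integer, $\theta=(\theta_1,\dots,\theta_p)'\in\mathbb{R}^p$ a nonzero vector with $\|\theta\|_1=\sum_i|\theta_i|<1$ and $\rho\in\mathbb{R}$ with $|\rho|<1$. A prime denotes transposition. The process is given, for all $n\ge1$, by $$X_n=\theta_1X_{n-1}+\cdots+\theta_pX_{n-p}+\varepsilon_n,\qquad \varepsilon_n=\rho\,\varepsilon_{n-1}+V_n,$$ with square-integrable initial value $X_0=\varepsilon_0$ and $X_{-1}=\cdots=X_{-p}=0$, where $(V_n)$ is a sequence of square-integrable, independent and identically distributed random variables with zero mean and variance $\sigma^2>0$. Let $\Phi_n^p=(X_n,X_{n-1},\dots,X_{n-p+1})'$ and $S_n=\sum_{k=0}^n\Phi_k^p(\Phi_k^p)'+S$, where $S$ is a fixed symmetric positive definite $p\times p$ matrix. The least squares estimator of $\theta$ is $\widehat{\theta}_n=(S_{n-1})^{-1}\sum_{k=1}^n\Phi_{k-1}^pX_k$,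 $n\ge1$. At stage $n$ the residuals are $\widehat{\varepsilon}_0=X_0$ and $\widehat{\varepsilon}_k=X_k-\widehat{\theta}_n'\Phi_{k-1}^p$ for $1\le k\le n$ (they depend on $n$), and $\widehat{\rho}_n=\bigl(\sum_{k=1}^n\widehat{\varepsilon}_{k-1}^{\,2}\bigr)^{-1}\sum_{k=1}^n\widehat{\varepsilon}_k\widehat{\varepsilon}_{k-1}$. $I_p$ is the identity matrix, $J_p$ the exchange matrix of order $p$ (ones on the antidiagonal, zeros elsewhere), and $e=(1,0,\dots,0)'\in\mathbb{R}^p$. Put $$\alpha=\frac{1}{(1-\theta_p\rho)(1+\theta_p\rho)},\qquad \beta=(\beta_1,\dots,\beta_p)'=(\theta_1+\rho,\ \theta_2-\theta_1\rho,\ \dots,\ \theta_p-\theta_{p-1}\rho)',$$ $\theta^{*}=\alpha(I_p-\theta_p\rho J_p)\beta$, with $p$-th component $\theta_p^{*}$, and $\rho^{*}=\theta_p\rho\,\theta_p^{*}$. Set $a_0=1$, $a_i=-\beta_i$ for $1\le i\le p$, $a_{p+1}=\theta_p\rho$, and $a_i=0$ for all other integers $i$. Let $B$ be the square matrix of order $p+2$ with rows and columns indexed by $0,\dots,p+1$ and entries $B_{d,0}=a_d$ and $B_{d,j}=a_{d-j}+a_{d+j}$ for $1\le j\le p+1$. Under the stability conditions $\|\theta\|_1<1$ and $|\rho|<1$, $B$ is invertible; let $\Lambda=(\lambda_0,\dots,\lambda_{p+1})'$ be the unique solution of $B\Lambda=(1,0,\dots,0)'$. Let $\Delta_p=(\lambda_{|i-j|})_{1\le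 i,j\le p}$ (it is positive definite) and $\Delta_{p+1}=(\lambda_{|i-j|})_{1\le i,j\le p+1}$. Finally $$P=\begin{pmatrix}P_B&0\\ P_L'&\varphi\end{pmatrix}$$ is the square matrix of order $p+1$ with $$P_B=\alpha(I_p-\theta_p\rho J_p)\Delta_p^{-1},\quad P_L=J_p(I_p-\theta_p\rho J_p)\bigl(\alpha\theta_p\rho\,\Delta_p^{-1}e+\theta_p^{*}\beta\bigr),\quad \varphi=-\alpha^{-1}\theta_p^{*}.$$ *)

theory Defs
  imports
    "HOL-Probability.Probability"
    "Jordan_Normal_Form.Gauss_Jordan_Elimination"
begin

(* The notations for vectors and scalar products are those of Jordan_Normal_Form.Matrix.
   Vectors and matrices are therefore indexed from 0: theta_i is component i - 1, and the
   last component theta_p is component p - 1. Only Lambda and B are indexed from 0 anyway. *)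
unbundle no vec_syntax
unbundle no inner_syntax

(* The inverse of an invertible matrix; unspecified on singular matrices. *)
definition mat_inv :: "real mat \<Rightarrow> real mat" where
  "mat_inv A = the (mat_inverse A)"

definition sym_pos_def :: "nat \<Rightarrow> real mat \<Rightarrow> bool" where
  "sym_pos_def p A \<longleftrightarrow> A \<in> carrier_mat p p \<and> A\<^sup>T = A \<and>
     (\<forall>x \<in> carrier_vec p. x \<noteq> 0\<^sub>v p \<longrightarrow> 0 < x \<bullet> (A *\<^sub>v x))"

definition exchange_mat :: "nat \<Rightarrow> real mat" where
  "exchange_mat p = mat p p (\<lambda>(i, j). if i + j + 1 = p then 1 else 0)"

(* mu is the law N(m, v) on the real line; v is the variance, v = 0 gives the Dirac mass. *)
definition normal_law :: "real \<Rightarrow> real \<Rightarrow> real measure \<Rightarrow> bool" where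
  "normal_law m v \<mu> \<longleftrightarrow> 0 \<le> v \<and>
     \<mu> = (if v = 0 then return borel m
           else density lborel (\<lambda>x. ennreal (normal_density m (sqrt v) x)))"

(* As in Euclidean_space of HOL-Analysis, R^d is the closed subspace of the functions of type
   nat => real that vanish from d on. It is homeomorphic to the usual R^d, and each continuous
   bounded function on it extends to one on the whole type (truncate the argument). *)
definition coords :: "real vec \<Rightarrow> nat \<Rightarrow> real" where
  "coords v = (\<lambda>i. if i < dim_vec v then v $ i else 0)"

(* nu is the law N(m, C) on R^d, possibly degenerate: every linear combination t'Z of the
   coordinates of a random vector Z with law nu is N(t'm, t'Ct). *)
definition normal_law_vec :: "real vec \<Rightarrow> real mat \<Rightarrow> (nat \<Rightarrow> real) measure \<Rightarrow> bool" where
  "normal_law_vec m C \<nu> \<longleftrightarrow>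
     (let d = dim_vec m in
        C \<in> carrier_mat d d \<and> C\<^sup>T = C \<and>
        prob_space \<nu> \<and> sets \<nu> = sets borel \<and> (AE x in \<nu>. \<forall>i\<ge>d. x i = 0) \<and>
        (\<forall>t \<in> carrier_vec d.
           normal_law (t \<bullet> m) (t \<bullet> (C *\<^sub>v t)) (distr \<nu> borel (\<lambda>x. \<Sum>i<d. t $ i * x i))))"

(* Convergence in distribution on a general topological space; on the real line the library's
   weak_conv_m is used instead. *)
definition weak_conv_top ::
    "(nat \<Rightarrow> 'a::topological_space measure) \<Rightarrow> 'a measure \<Rightarrow> bool" where
  "weak_conv_top \<mu> \<nu> \<longleftrightarrow>
     (\<forall>f :: 'a \<Rightarrow> real. continuous_on UNIV f \<longrightarrow> bounded (range f) \<longrightarrow>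
        (\<lambda>n. integral\<^sup>L (\<mu> n) f) \<longlonglongrightarrow> integral\<^sup>L \<nu> f)"

definition Phi :: "nat \<Rightarrow> (int \<Rightarrow> real) \<Rightarrow> int \<Rightarrow> real vec" where
  "Phi p x n = vec p (\<lambda>i. x (n - int i))"

definition S_mat :: "nat \<Rightarrow> real mat \<Rightarrow> (int \<Rightarrow> real) \<Rightarrow> nat \<Rightarrow> real mat" where
  "S_mat p S x n =
     mat p p (\<lambda>(i, j). \<Sum>k=0..n. Phi p x (int k) $ i * Phi p x (int k) $ j) + S"

(* The estimators are functions of a sample path x. Only n \<ge> 1 is meaningful. *)
definition theta_hat :: "nat \<Rightarrow> real mat \<Rightarrow> (int \<Rightarrow> real) \<Rightarrow> nat \<Rightarrow> real vec" where
  "theta_hat p S x n =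
     mat_inv (S_mat p S x (n - 1)) *\<^sub>v
       vec p (\<lambda>i. \<Sum>k=1..n. Phi p x (int k - 1) $ i * x (int k))"

(* The residual with index k computed at stage n. *)
definition eps_hat :: "nat \<Rightarrow> real mat \<Rightarrow> (int \<Rightarrow> real) \<Rightarrow> nat \<Rightarrow> nat \<Rightarrow> real" where
  "eps_hat p S x n k =
     (if k = 0 then x 0 else x (int k) - theta_hat p S x n \<bullet> Phi p x (int k - 1))"

definition rho_hat :: "nat \<Rightarrow> real mat \<Rightarrow> (int \<Rightarrow> real) \<Rightarrow> nat \<Rightarrow> real" where
  "rho_hat p S x n =
     inverse (\<Sum>k=1..n. (eps_hat p S x n (k - 1))\<^sup>2) *
       (\<Sum>k=1..n. eps_hat p S x n k * eps_hat p S x n (k - 1))"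

definition alpha :: "nat \<Rightarrow> real vec \<Rightarrow> real \<Rightarrow> real" where
  "alpha p \<theta> \<rho> = 1 / ((1 - \<theta> $ (p - 1) * \<rho>) * (1 + \<theta> $ (p - 1) * \<rho>))"

definition beta :: "nat \<Rightarrow> real vec \<Rightarrow> real \<Rightarrow> real vec" where
  "beta p \<theta> \<rho> = vec p (\<lambda>i. if i = 0 then \<theta> $ 0 + \<rho> else \<theta> $ i - \<theta> $ (i - 1) * \<rho>)"

definition IJ_mat :: "nat \<Rightarrow> real vec \<Rightarrow> real \<Rightarrow> real mat" where
  "IJ_mat p \<theta> \<rho> = 1\<^sub>m p - (\<theta> $ (p - 1) * \<rho>) \<cdot>\<^sub>m exchange_mat p"

definition theta_star :: "nat \<Rightarrow> real vec \<Rightarrow> real \<Rightarrow> real vec" where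
  "theta_star p \<theta> \<rho> = (alpha p \<theta> \<rho> \<cdot>\<^sub>m IJ_mat p \<theta> \<rho>) *\<^sub>v beta p \<theta> \<rho>"

definition rho_star :: "nat \<Rightarrow> real vec \<Rightarrow> real \<Rightarrow> real" where
  "rho_star p \<theta> \<rho> = \<theta> $ (p - 1) * \<rho> * theta_star p \<theta> \<rho> $ (p - 1)"

definition a_coeff :: "nat \<Rightarrow> real vec \<Rightarrow> real \<Rightarrow> int \<Rightarrow> real" where
  "a_coeff p \<theta> \<rho> i =
     (if i = 0 then 1
      else if 1 \<le> i \<and> i \<le> int p then - (beta p \<theta> \<rho> $ (nat i - 1))
      else if i = int p + 1 then \<theta> $ (p - 1) * \<rho>
      else 0)"

definition B_mat :: "nat \<Rightarrow> real vec \<Rightarrow> real \<Rightarrow> real mat" where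
  "B_mat p \<theta> \<rho> = mat (p + 2) (p + 2) (\<lambda>(d, j).
     if j = 0 then a_coeff p \<theta> \<rho> (int d)
     else a_coeff p \<theta> \<rho> (int d - int j) + a_coeff p \<theta> \<rho> (int d + int j))"

definition Lambda :: "nat \<Rightarrow> real vec \<Rightarrow> real \<Rightarrow> real vec" where
  "Lambda p \<theta> \<rho> =
     (THE l. l \<in> carrier_vec (p + 2) \<and> B_mat p \<theta> \<rho> *\<^sub>v l = unit_vec (p + 2) 0)"

(* The Toeplitz matrix of order q with the entries of Lambda; it is used for q = p, p + 1. *)
definition Delta_mat :: "nat \<Rightarrow> real vec \<Rightarrow> real \<Rightarrow> nat \<Rightarrow> real mat" where
  "Delta_mat p \<theta> \<rho> q = mat q q (\<lambda>(i, j). Lambda p \<theta> \<rho> $ nat \<bar>int i - int j\<bar>)"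

definition PB_mat :: "nat \<Rightarrow> real vec \<Rightarrow> real \<Rightarrow> real mat" where
  "PB_mat p \<theta> \<rho> = alpha p \<theta> \<rho> \<cdot>\<^sub>m IJ_mat p \<theta> \<rho> * mat_inv (Delta_mat p \<theta> \<rho> p)"

definition PL_vec :: "nat \<Rightarrow> real vec \<Rightarrow> real \<Rightarrow> real vec" where
  "PL_vec p \<theta> \<rho> = (exchange_mat p * IJ_mat p \<theta> \<rho>) *\<^sub>v
     ((alpha p \<theta> \<rho> * (\<theta> $ (p - 1)) * \<rho>) \<cdot>\<^sub>v (mat_inv (Delta_mat p \<theta> \<rho> p) *\<^sub>v unit_vec p 0)
      + (theta_star p \<theta> \<rho> $ (p - 1)) \<cdot>\<^sub>v beta p \<theta> \<rho>)"

definition phi :: "nat \<Rightarrow> real vec \<Rightarrow> real \<Rightarrow> real" where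
  "phi p \<theta> \<rho> = - (inverse (alpha p \<theta> \<rho>) * theta_star p \<theta> \<rho> $ (p - 1))"

definition P_mat :: "nat \<Rightarrow> real vec \<Rightarrow> real \<Rightarrow> real mat" where
  "P_mat p \<theta> \<rho> =
     four_block_mat (PB_mat p \<theta> \<rho>) (0\<^sub>m p 1)
       (mat_of_rows p [PL_vec p \<theta> \<rho>]) (mat 1 1 (\<lambda>_. phi p \<theta> \<rho>))"

definition Gamma_mat :: "nat \<Rightarrow> real vec \<Rightarrow> real \<Rightarrow> real mat" where
  "Gamma_mat p \<theta> \<rho> = P_mat p \<theta> \<rho> * Delta_mat p \<theta> \<rho> (p + 1) * (P_mat p \<theta> \<rho>)\<^sup>T"

end

theory Submission
  imports Defs "Jordan_Normal_Form.Determinant"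
begin

text \<open>
  Eliminating the noise \<epsilon> turns X into an autoregressive process of order p + 1 that is driven by V:
  with a the coefficients of Lambda's equation, a 0 * X n + ... + a (p+1) * X (n-p-1) = V n.
  Multiplying this recursion by X (n-d) and averaging gives B * C = (sample covariances of V n and
  X (n-d)) up to boundary terms, where C is the vector of sample autocovariances. For d > 0 the
  right-hand side is a martingale of order 1 / sqrt n, so C tends to \<sigma>^2 * Lambda, because B is
  invertible: an even bounded sequence in the kernel of the stable recursion vanishes.

  The same equations, together with the normal equations, express the errors of both estimators
  up to o(1 / sqrt n) as P / \<sigma>^2 applied to the vector of the martingales for d = 1, ..., p + 1.
  By the normal equations the residuals are almost orthogonal to the lags 1, ..., p, so that in
  the numerator of the estimator of \<rho> only one term survives.

  A linear combination of the martingales is a quadratic form in the V n, up to the influence of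
  X 0, which may depend on V. Its limit law is found by cutting the form into
  independent identically distributed blocks, whose length then tends to infinity. The multivariate
  statement follows from convergence of characteristic functions: on a large cube a
  bounded continuous function is close to a polynomial in the functions sin (k * x i), which stays
  bounded on the whole space.
\<close>

section \<open>Stochastic order symbols\<close>

text \<open>Write c for \<theta>_p \<rho>, a(z) for the polynomial with coefficients a and b(z) = 1
  - b_1 z - ... - b_p z^p for that of \<open>theta_star\<close>. Then a(z) = b(z) + c z^(p+1)
  b(1/z), which is a Levinson-Durbin step: \<open>theta_star\<close> is the best linear predictor of
  order p of an autoregression of order p + 1, -c is its last partial autocorrelation, and alpha is
  its prediction error in units of the noise variance. The matrix alpha (I - c J) is the inverse of
  I + c J, because J is an involution. The estimator of \<theta> therefore aims at the truncated
  predictor; the residuals keep a correlation only through lag p + 1, whence rho_star = c b_p. X 0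
  is not assumed independent of V. Its share in the noise sums is controlled in L1, since its
  weights, the impulse response, are summable. The fourth moment enters through the mean of the
  squares of V. Each noise sum has variance of order \<sigma>^4, and the expansions divide by
  \<sigma>^2, so that Gamma is free of \<sigma>.\<close>

definition whp :: "'w measure \<Rightarrow> real \<Rightarrow> ('w \<Rightarrow> bool) \<Rightarrow> bool" where
  "whp M e Q \<longleftrightarrow> (\<exists>E\<in>sets M. measure M E \<le> e \<and> (\<forall>\<omega>\<in>space M - E. Q \<omega>))"

(* Exceptional events instead of probabilities, so that no measurability is needed. *)
definition oP :: "'w measure \<Rightarrow> (nat \<Rightarrow> 'w \<Rightarrow> real) \<Rightarrow> bool" where
  "oP M X \<longleftrightarrow> (\<forall>e>0. \<forall>\<^sub>F n in sequentially. whp M e (\<lambda>\<omega>. \<bar>X n \<omega>\<bar> \<le> e))"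

definition OP :: "'w measure \<Rightarrow> (nat \<Rightarrow> 'w \<Rightarrow> real) \<Rightarrow> bool" where
  "OP M X \<longleftrightarrow> (\<forall>e>0. \<exists>K. \<forall>\<^sub>F n in sequentially. whp M e (\<lambda>\<omega>. \<bar>X n \<omega>\<bar> \<le> K))"

lemma whp_mono:
  assumes "whp M e Q" "e \<le> e'" "\<And>\<omega>. \<omega> \<in> space M \<Longrightarrow> Q \<omega> \<Longrightarrow> Q' \<omega>"
  shows "whp M e' Q'"
  using assms unfolding whp_def by (meson DiffE order_trans)

lemma OP_mono:
  assumes "OP M Y" "\<forall>\<^sub>F n in sequentially. \<forall>\<omega>\<in>space M. \<bar>X n \<omega>\<bar> \<le> \<bar>Y n \<omega>\<bar>"
  shows "OP M X"
  unfolding OP_def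
proof (intro allI impI)
  fix e :: real assume "e > 0"
  then obtain K where "\<forall>\<^sub>F n in sequentially. whp M e (\<lambda>\<omega>. \<bar>Y n \<omega>\<bar> \<le> K)"
    using assms(1) unfolding OP_def by blast
  then have "\<forall>\<^sub>F n in sequentially. whp M e (\<lambda>\<omega>. \<bar>X n \<omega>\<bar> \<le> K)"
    using assms(2) by eventually_elim (auto elim!: whp_mono intro: order_trans)
  then show "\<exists>K. \<forall>\<^sub>F n in sequentially. whp M e (\<lambda>\<omega>. \<bar>X n \<omega>\<bar> \<le> K)" ..
qed

lemma oP_mono:
  assumes "oP M Y" "\<forall>\<^sub>F n in sequentially. \<forall>\<omega>\<in>space M. \<bar>X n \<omega>\<bar> \<le> \<bar>Y n \<omega>\<bar>"
  shows "oP M X"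
  unfolding oP_def
proof (intro allI impI)
  fix e :: real assume "e > 0"
  then have "\<forall>\<^sub>F n in sequentially. whp M e (\<lambda>\<omega>. \<bar>Y n \<omega>\<bar> \<le> e)"
    using assms(1) unfolding oP_def by blast
  then show "\<forall>\<^sub>F n in sequentially. whp M e (\<lambda>\<omega>. \<bar>X n \<omega>\<bar> \<le> e)"
    using assms(2) by eventually_elim (auto elim!: whp_mono intro: order_trans)
qed

lemma oP_cong_ev:
  assumes "oP M Y" "\<And>n \<omega>. n \<ge> 1 \<Longrightarrow> \<omega> \<in> space M \<Longrightarrow> X n \<omega> = Y n \<omega>"
  shows "oP M X"
  by (rule oP_mono[OF assms(1)], rule eventually_sequentiallyI[of 1]) (use assms(2) in auto)

lemma oP_imp_OP: "oP M X \<Longrightarrow> OP M X"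
  unfolding oP_def OP_def by blast

lemma oP_minus: "oP M X \<Longrightarrow> oP M (\<lambda>n \<omega>. - X n \<omega>)"
  unfolding oP_def by simp

lemma OP_minus: "OP M X \<Longrightarrow> OP M (\<lambda>n \<omega>. - X n \<omega>)"
  unfolding OP_def by simp

context prob_space
begin

lemma whp_triv: "(\<And>\<omega>. \<omega> \<in> space M \<Longrightarrow> Q \<omega>) \<Longrightarrow> e \<ge> 0 \<Longrightarrow> whp M e Q"
  unfolding whp_def by (rule bexI[of _ "{}"]) auto

lemma whp_conj:
  assumes "whp M (e/2) Q1" "whp M (e/2) Q2"
    and "\<And>\<omega>. \<omega> \<in> space M \<Longrightarrow> Q1 \<omega> \<Longrightarrow> Q2 \<omega> \<Longrightarrow> Q \<omega>"
  shows "whp M e Q"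
proof -
  from assms(1) obtain E1 where E1: "E1 \<in> sets M" "measure M E1 \<le> e/2" "\<forall>\<omega>\<in>space M - E1. Q1 \<omega>"
    unfolding whp_def by blast
  from assms(2) obtain E2 where E2: "E2 \<in> sets M" "measure M E2 \<le> e/2" "\<forall>\<omega>\<in>space M - E2. Q2 \<omega>"
    unfolding whp_def by blast
  have "measure M (E1 \<union> E2) \<le> e"
    using measure_Un_le[OF E1(1) E2(1)] E1(2) E2(2) by simp
  then show ?thesis unfolding whp_def
    using E1 E2 assms(3) by (intro bexI[of _ "E1 \<union> E2"]) auto
qed

lemma oP_add:
  assumes "oP M X" "oP M Y" shows "oP M (\<lambda>n \<omega>. X n \<omega> + Y n \<omega>)"
  unfolding oP_def
proof (intro allI impI)
  fix e :: real assume e: "e > 0"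
  have "\<forall>\<^sub>F n in sequentially. whp M (e/2) (\<lambda>\<omega>. \<bar>X n \<omega>\<bar> \<le> e/2)"
    "\<forall>\<^sub>F n in sequentially. whp M (e/2) (\<lambda>\<omega>. \<bar>Y n \<omega>\<bar> \<le> e/2)"
    using assms e unfolding oP_def by (meson half_gt_zero)+
  then show "\<forall>\<^sub>F n in sequentially. whp M e (\<lambda>\<omega>. \<bar>X n \<omega> + Y n \<omega>\<bar> \<le> e)"
    by eventually_elim (erule (1) whp_conj, linarith)
qed

lemma OP_add:
  assumes "OP M X" "OP M Y" shows "OP M (\<lambda>n \<omega>. X n \<omega> + Y n \<omega>)"
  unfolding OP_def
proof (intro allI impI)
  fix e :: real assume e: "e > 0"
  then have "e/2 > 0" by simp
  then obtain K where "\<forall>\<^sub>F n in sequentially. whp M (e/2) (\<lambda>\<omega>. \<bar>X n \<omega>\<bar> \<le> K)"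
    using assms(1) unfolding OP_def by blast
  moreover from \<open>e/2 > 0\<close> obtain L where "\<forall>\<^sub>F n in sequentially. whp M (e/2) (\<lambda>\<omega>. \<bar>Y n \<omega>\<bar> \<le> L)"
    using assms(2) unfolding OP_def by blast
  ultimately have "\<forall>\<^sub>F n in sequentially. whp M e (\<lambda>\<omega>. \<bar>X n \<omega> + Y n \<omega>\<bar> \<le> K + L)"
    by eventually_elim (erule (1) whp_conj, linarith)
  then show "\<exists>K. \<forall>\<^sub>F n in sequentially. whp M e (\<lambda>\<omega>. \<bar>X n \<omega> + Y n \<omega>\<bar> \<le> K)" ..
qed

lemma OP_mult:
  assumes "OP M X" "OP M Y" shows "OP M (\<lambda>n \<omega>. X n \<omega> * Y n \<omega>)"
  unfolding OP_def
proof (intro allI impI)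
  fix e :: real assume e: "e > 0"
  then have "e/2 > 0" by simp
  then obtain K where "\<forall>\<^sub>F n in sequentially. whp M (e/2) (\<lambda>\<omega>. \<bar>X n \<omega>\<bar> \<le> K)"
    using assms(1) unfolding OP_def by blast
  moreover from \<open>e/2 > 0\<close> obtain L where "\<forall>\<^sub>F n in sequentially. whp M (e/2) (\<lambda>\<omega>. \<bar>Y n \<omega>\<bar> \<le> L)"
    using assms(2) unfolding OP_def by blast
  ultimately have "\<forall>\<^sub>F n in sequentially. whp M e (\<lambda>\<omega>. \<bar>X n \<omega> * Y n \<omega>\<bar> \<le> K * L)"
    by eventually_elim (erule (1) whp_conj, auto simp: abs_mult intro!: mult_mono)
  then show "\<exists>K. \<forall>\<^sub>F n in sequentially. whp M e (\<lambda>\<omega>. \<bar>X n \<omega> * Y n \<omega>\<bar> \<le> K)" ..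
qed

lemma oP_mult_OP:
  assumes "oP M X" "OP M Y" shows "oP M (\<lambda>n \<omega>. X n \<omega> * Y n \<omega>)"
  unfolding oP_def
proof (intro allI impI)
  fix e :: real assume e: "e > 0"
  then obtain L where L: "\<forall>\<^sub>F n in sequentially. whp M (e/2) (\<lambda>\<omega>. \<bar>Y n \<omega>\<bar> \<le> L)"
    using assms(2) unfolding OP_def by (meson half_gt_zero)
  \<comment> \<open>One number plays two roles: as a probability it must not exceed e/2, as a size
    its product with |L| must not exceed e.\<close>
  define d where "d = min (e/2) (e / (\<bar>L\<bar> + 1))"
  have "d > 0" unfolding d_def min_less_iff_conj using e by (intro conjI divide_pos_pos) auto
  moreover have "d \<le> e/2" "d \<le> e / (\<bar>L\<bar> + 1)" unfolding d_def by (rule min.cobounded1 min.cobounded2)+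
  ultimately have d: "d > 0" "d \<le> e/2" "d \<le> e / (\<bar>L\<bar> + 1)" by blast+
  have dL: "d * \<bar>L\<bar> \<le> e"
  proof -
    have "d * \<bar>L\<bar> \<le> e / (\<bar>L\<bar> + 1) * \<bar>L\<bar>" using d by (intro mult_right_mono) auto
    also have "\<dots> = e * (\<bar>L\<bar> / (\<bar>L\<bar> + 1))" by simp
    also have "\<dots> \<le> e * 1" using e by (intro mult_left_mono) (auto simp: divide_le_eq)
    finally show ?thesis by simp
  qed
  have "\<forall>\<^sub>F n in sequentially. whp M d (\<lambda>\<omega>. \<bar>X n \<omega>\<bar> \<le> d)"
    using assms(1) d(1) unfolding oP_def by blast
  then have "\<forall>\<^sub>F n in sequentially. whp M (e/2) (\<lambda>\<omega>. \<bar>X n \<omega>\<bar> \<le> d)"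
    by eventually_elim (erule whp_mono, use d in auto)
  then show "\<forall>\<^sub>F n in sequentially. whp M e (\<lambda>\<omega>. \<bar>X n \<omega> * Y n \<omega>\<bar> \<le> e)"
    using L
  proof eventually_elim
    case (elim n)
    then show ?case
    proof (rule whp_conj)
      fix \<omega> assume "\<bar>X n \<omega>\<bar> \<le> d" "\<bar>Y n \<omega>\<bar> \<le> L"
      then have "\<bar>X n \<omega>\<bar> * \<bar>Y n \<omega>\<bar> \<le> d * \<bar>L\<bar>" by (intro mult_mono) (use d in auto)
      then show "\<bar>X n \<omega> * Y n \<omega>\<bar> \<le> e" using dL by (simp add: abs_mult)
    qed
  qed
qed

lemma OP_mult_oP: "OP M X \<Longrightarrow> oP M Y \<Longrightarrow> oP M (\<lambda>n \<omega>. X n \<omega> * Y n \<omega>)"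
  using oP_mult_OP[of Y X] by (simp add: mult.commute)

lemma oP_diff: "oP M X \<Longrightarrow> oP M Y \<Longrightarrow> oP M (\<lambda>n \<omega>. X n \<omega> - Y n \<omega>)"
  using oP_add[OF _ oP_minus] by fastforce

lemma OP_diff: "OP M X \<Longrightarrow> OP M Y \<Longrightarrow> OP M (\<lambda>n \<omega>. X n \<omega> - Y n \<omega>)"
  using OP_add[OF _ OP_minus] by fastforce

lemma oP_seq: "c \<longlonglongrightarrow> 0 \<Longrightarrow> oP M (\<lambda>n \<omega>. c n)"
  unfolding oP_def
proof (intro allI impI)
  fix e :: real assume "c \<longlonglongrightarrow> 0" "e > 0"
  then have "\<forall>\<^sub>F n in sequentially. \<bar>c n\<bar> < e"
    by (auto dest!: tendstoD simp: dist_real_def)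
  then show "\<forall>\<^sub>F n in sequentially. whp M e (\<lambda>\<omega>. \<bar>c n\<bar> \<le> e)"
    by eventually_elim (use \<open>e > 0\<close> in \<open>auto intro!: whp_triv\<close>)
qed

lemma OP_const: "OP M (\<lambda>n \<omega>. c)"
  unfolding OP_def by (intro allI impI exI[of _ "\<bar>c\<bar>"] always_eventually whp_triv) auto

lemma oP_zero: "oP M (\<lambda>n \<omega>. 0)"
  by (rule oP_seq) simp

lemma oP_cmult: "oP M X \<Longrightarrow> oP M (\<lambda>n \<omega>. c * X n \<omega>)"
  by (rule OP_mult_oP[OF OP_const])

lemma OP_cmult: "OP M X \<Longrightarrow> OP M (\<lambda>n \<omega>. c * X n \<omega>)"
  by (rule OP_mult[OF OP_const])

lemma oP_sum: "(\<And>i. i \<in> I \<Longrightarrow> oP M (X i)) \<Longrightarrow> oP M (\<lambda>n \<omega>. \<Sum>i\<in>I. X i n \<omega>)"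
  by (induction I rule: infinite_finite_induct) (auto intro!: oP_add oP_zero)

lemma OP_sum: "(\<And>i. i \<in> I \<Longrightarrow> OP M (X i)) \<Longrightarrow> OP M (\<lambda>n \<omega>. \<Sum>i\<in>I. X i n \<omega>)"
  by (induction I rule: infinite_finite_induct) (auto intro!: OP_add OP_const)

lemma oP_square: 
  assumes "oP M (\<lambda>n \<omega>. (X n \<omega>)\<^sup>2)" shows "oP M X"
  unfolding oP_def
proof (intro allI impI)
  fix e :: real assume e: "e > 0"
  \<comment> \<open>The minimum serves as a probability (at most e) and as a bound for the square
    (at most e^2).\<close>
  then have "\<forall>\<^sub>F n in sequentially. whp M (min e (e\<^sup>2)) (\<lambda>\<omega>. \<bar>(X n \<omega>)\<^sup>2\<bar> \<le> min e (e\<^sup>2))"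
    using assms unfolding oP_def by (metis min_less_iff_conj zero_less_power)
  then show "\<forall>\<^sub>F n in sequentially. whp M e (\<lambda>\<omega>. \<bar>X n \<omega>\<bar> \<le> e)"
  proof eventually_elim
    case (elim n)
    then show ?case
    proof (rule whp_mono)
      fix \<omega> assume "\<bar>(X n \<omega>)\<^sup>2\<bar> \<le> min e (e\<^sup>2)"
      then have "\<bar>X n \<omega>\<bar>\<^sup>2 \<le> e\<^sup>2" by simp
      then show "\<bar>X n \<omega>\<bar> \<le> e" by (rule power2_le_imp_le) (use e in simp)
    qed simp
  qed
qed

lemma OP_square: 
  assumes "OP M (\<lambda>n \<omega>. (X n \<omega>)\<^sup>2)" shows "OP M X"
proof (rule OP_mono[OF OP_add[OF OP_const[of 1] assms]], intro always_eventually allI ballI)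
  fix n \<omega>
  have "\<bar>X n \<omega>\<bar> \<le> 1 + (X n \<omega>)\<^sup>2"
    using sum_squares_bound[of 1 "\<bar>X n \<omega>\<bar>"] by simp
  then show "\<bar>X n \<omega>\<bar> \<le> \<bar>1 + (X n \<omega>)\<^sup>2\<bar>" by simp
qed

section \<open>Stochastic orders from moments, and inverses\<close>

lemma whp_markov:
  assumes "integrable M X" "\<And>\<omega>. \<omega> \<in> space M \<Longrightarrow> 0 \<le> X \<omega>" "e > 0" "expectation X \<le> d * e"
  shows "whp M d (\<lambda>\<omega>. X \<omega> \<le> e)"
  unfolding whp_def
proof (intro bexI conjI ballI)
  let ?E = "{\<omega>\<in>space M. X \<omega> \<ge> e}"
  show "?E \<in> sets M" using assms(1) by measurable
  have "measure M ?E \<le> expectation X / e"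
    using assms by (intro integral_Markov_inequality_measure[where A="space M - {}"]) auto
  also have "\<dots> \<le> d" using assms by (simp add: divide_le_eq)
  finally show "measure M ?E \<le> d" .
qed auto

lemma oP_L1:
  assumes int: "\<And>n. integrable M (X n)" and le: "\<And>n. expectation (\<lambda>\<omega>. \<bar>X n \<omega>\<bar>) \<le> b n" and b: "b \<longlonglongrightarrow> 0"
  shows "oP M X"
  unfolding oP_def
proof (intro allI impI)
  fix e :: real assume e: "e > 0"
  have "\<forall>\<^sub>F n in sequentially. b n < e * e"
    using order_tendstoD(2)[OF b, of "e * e"] e by simp
  then show "\<forall>\<^sub>F n in sequentially. whp M e (\<lambda>\<omega>. \<bar>X n \<omega>\<bar> \<le> e)"
  proof eventually_elim
    case (elim n)
    then show ?case using le[of n] int e by (intro whp_markov) auto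
  qed
qed

lemma OP_L1:
  assumes int: "\<And>n. integrable M (X n)" and le: "\<And>n. expectation (\<lambda>\<omega>. \<bar>X n \<omega>\<bar>) \<le> b"
  shows "OP M X"
  unfolding OP_def
proof (intro allI impI)
  fix e :: real assume e: "e > 0"
  have "whp M e (\<lambda>\<omega>. \<bar>X n \<omega>\<bar> \<le> (\<bar>b\<bar> + 1) / e)" for n
  proof (rule whp_markov)
    show "expectation (\<lambda>\<omega>. \<bar>X n \<omega>\<bar>) \<le> e * ((\<bar>b\<bar> + 1) / e)" using le[of n] e by simp
  qed (use int e in auto)
  then show "\<exists>K. \<forall>\<^sub>F n in sequentially. whp M e (\<lambda>\<omega>. \<bar>X n \<omega>\<bar> \<le> K)"
    by (intro exI[of _ "(\<bar>b\<bar> + 1) / e"] always_eventually allI)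
qed

lemma oP_inverse:
  assumes D: "oP M (\<lambda>n \<omega>. D n \<omega> - d)" and d: "d \<noteq> 0"
  shows "oP M (\<lambda>n \<omega>. inverse (D n \<omega>) - inverse d)"
  unfolding oP_def
proof (intro allI impI)
  fix e :: real assume e: "e > 0"
  \<comment> \<open>The bound |d|/2 keeps D away from 0; the last one comes from |1/D - 1/d| <= 2 |D
    - d| / d^2.\<close>
  define r where "r = min e (min (\<bar>d\<bar>/2) (e * (\<bar>d\<bar> * \<bar>d\<bar>) / 2))"
  have "\<bar>d\<bar> > 0" using d by simp
  then have r: "r > 0" unfolding r_def min_less_iff_conj using e
    by (intro conjI divide_pos_pos mult_pos_pos) auto
  have r': "r \<le> e" "r \<le> \<bar>d\<bar>/2" "r \<le> e * (\<bar>d\<bar> * \<bar>d\<bar>) / 2"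
    unfolding r_def by (rule min.cobounded1 min.coboundedI2 min.cobounded2)+
  have "\<forall>\<^sub>F n in sequentially. whp M r (\<lambda>\<omega>. \<bar>D n \<omega> - d\<bar> \<le> r)"
    using D r unfolding oP_def by blast
  then show "\<forall>\<^sub>F n in sequentially. whp M e (\<lambda>\<omega>. \<bar>inverse (D n \<omega>) - inverse d\<bar> \<le> e)"
  proof eventually_elim
    case (elim n)
    then show ?case
    proof (rule whp_mono)
      fix \<omega> assume a: "\<bar>D n \<omega> - d\<bar> \<le> r"
      have D: "\<bar>D n \<omega>\<bar> \<ge> \<bar>d\<bar>/2" using a r'(2) by linarith
      then have D0: "D n \<omega> \<noteq> 0" using d by auto
      have "\<bar>inverse (D n \<omega>) - inverse d\<bar> = \<bar>D n \<omega> - d\<bar> / (\<bar>D n \<omega>\<bar> * \<bar>d\<bar>)"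
        using D0 d by (simp add: inverse_eq_divide diff_frac_eq abs_mult abs_minus_commute)
      also have "\<dots> \<le> e"
      proof -
        have "\<bar>D n \<omega> - d\<bar> \<le> e * (\<bar>d\<bar> * \<bar>d\<bar>) / 2" using a r'(3) by linarith
        also have "\<dots> = e * (\<bar>d\<bar> / 2 * \<bar>d\<bar>)" by simp
        also have "\<dots> \<le> e * (\<bar>D n \<omega>\<bar> * \<bar>d\<bar>)" using D e by (intro mult_left_mono mult_right_mono) auto
        finally show ?thesis using D0 d by (simp add: divide_le_eq)
      qed
      finally show "\<bar>inverse (D n \<omega>) - inverse d\<bar> \<le> e" .
    qed (use r' in auto)
  qed
qed

text \<open>Absorption: where h is at most 1/2, half of |Y| moves to the left-hand side and |Y| <= 2
  A remains. This bounds the unknowns of a random linear system about which nothing is known in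
  advance.\<close>

lemma OP_self_bound:
  assumes A: "OP M A" and h: "oP M h"
    and le: "\<And>n \<omega>. n \<ge> 1 \<Longrightarrow> \<omega> \<in> space M \<Longrightarrow> \<bar>Y n \<omega>\<bar> \<le> A n \<omega> + h n \<omega> * \<bar>Y n \<omega>\<bar>"
  shows "OP M Y"
  unfolding OP_def
proof (intro allI impI)
  fix e :: real assume e: "e > 0"
  then obtain K where K: "\<forall>\<^sub>F n in sequentially. whp M (e/2) (\<lambda>\<omega>. \<bar>A n \<omega>\<bar> \<le> K)"
    using A unfolding OP_def by (meson half_gt_zero)
  have "\<forall>\<^sub>F n in sequentially. whp M (min (e/2) (1/2)) (\<lambda>\<omega>. \<bar>h n \<omega>\<bar> \<le> min (e/2) (1/2))"
  proof -
    have "min (e/2) (1/2) > 0" using e by simp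
    then show ?thesis using h unfolding oP_def by blast
  qed
  with K have "\<forall>\<^sub>F n in sequentially. whp M e (\<lambda>\<omega>. \<bar>Y n \<omega>\<bar> \<le> 2 * K)"
    using eventually_ge_at_top[of 1]
  proof eventually_elim
    case (elim n)
    from elim(2) have h2: "whp M (e/2) (\<lambda>\<omega>. \<bar>h n \<omega>\<bar> \<le> 1/2)"
      by (rule whp_mono) auto
    show ?case
    proof (rule whp_conj[OF elim(1) h2])
      fix \<omega> assume \<omega>: "\<omega> \<in> space M" and a: "\<bar>A n \<omega>\<bar> \<le> K" and b: "\<bar>h n \<omega>\<bar> \<le> 1/2"
      have "h n \<omega> * \<bar>Y n \<omega>\<bar> \<le> 1/2 * \<bar>Y n \<omega>\<bar>" using b by (intro mult_right_mono) auto
      then show "\<bar>Y n \<omega>\<bar> \<le> 2 * K" using le[OF elim(3) \<omega>] a by linarith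
    qed
  qed
  then show "\<exists>K. \<forall>\<^sub>F n in sequentially. whp M e (\<lambda>\<omega>. \<bar>Y n \<omega>\<bar> \<le> K)" ..
qed

section \<open>Characteristic functions of asymptotically equal sequences\<close>

lemma norm_iexp_diff_le: "cmod (iexp x - iexp y) \<le> \<bar>x - y\<bar>"
proof -
  have "iexp x - iexp y = iexp y * (iexp (x - y) - 1)"
    by (simp add: algebra_simps flip: exp_add)
  moreover have "cmod (iexp (x - y) - 1) \<le> \<bar>x - y\<bar>"
    using iexp_approx1[of "x - y" 0] by simp
  ultimately show ?thesis by (simp add: norm_mult)
qed

lemma char_distr_eq:
  assumes [measurable]: "X \<in> borel_measurable M"
  shows "char (distr M borel X) t = (CLINT \<omega>|M. iexp (t * X \<omega>))"
  unfolding char_def by (subst integral_distr) auto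

lemma integrable_iexp': "X \<in> borel_measurable M \<Longrightarrow> integrable M (\<lambda>\<omega>. iexp (X \<omega>))"
  by (rule integrable_const_bound[of _ 1]) auto

text \<open>The integrand is at most e off the exceptional event, by the Lipschitz bound, and at
  most 2 on it. Neither sequence has to converge, so an expansion can be replaced by a simpler one
  before any limit law is known.\<close>

lemma oP_char_diff:
  assumes [measurable]: "\<And>n. X n \<in> borel_measurable M" "\<And>n. Y n \<in> borel_measurable M"
    and d: "oP M (\<lambda>n \<omega>. X n \<omega> - Y n \<omega>)"
  shows "(\<lambda>n. char (distr M borel (X n)) t - char (distr M borel (Y n)) t) \<longlonglongrightarrow> 0"
proof (rule LIMSEQ_I)
  fix r :: real assume r: "r > 0"
  define e where "e = r / 4"
  have e: "e > 0" "3 * e < r" using r by (auto simp: e_def)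
  have "oP M (\<lambda>n \<omega>. t * (X n \<omega> - Y n \<omega>))" by (rule oP_cmult[OF d])
  then have "\<forall>\<^sub>F n in sequentially. whp M e (\<lambda>\<omega>. \<bar>t * (X n \<omega> - Y n \<omega>)\<bar> \<le> e)"
    using e(1) unfolding oP_def by blast
  then have "\<forall>\<^sub>F n in sequentially. cmod (char (distr M borel (X n)) t - char (distr M borel (Y n)) t) < r"
  proof eventually_elim
    case (elim n)
    then obtain E where E[measurable]: "E \<in> sets M" and Ee: "measure M E \<le> e"
      and le: "\<And>\<omega>. \<omega>\<in>space M - E \<Longrightarrow> \<bar>t * (X n \<omega> - Y n \<omega>)\<bar> \<le> e"
      unfolding whp_def by blast
    have int: "integrable M (\<lambda>\<omega>. iexp (t * X n \<omega>))"
      by (rule integrable_iexp') measurable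
    have int': "integrable M (\<lambda>\<omega>. iexp (t * Y n \<omega>))"
      by (rule integrable_iexp') measurable
    note int = int int'
    have "char (distr M borel (X n)) t - char (distr M borel (Y n)) t
        = (CLINT \<omega>|M. iexp (t * X n \<omega>) - iexp (t * Y n \<omega>))"
      using int by (simp add: char_distr_eq)
    also have "cmod \<dots> \<le> (LINT \<omega>|M. cmod (iexp (t * X n \<omega>) - iexp (t * Y n \<omega>)))"
      by (rule integral_norm_bound)
    also have "\<dots> \<le> (LINT \<omega>|M. e + 2 * indicator E \<omega>)"
    proof (rule integral_mono)
      show "integrable M (\<lambda>\<omega>. cmod (iexp (t * X n \<omega>) - iexp (t * Y n \<omega>)))"
        using int by (intro integrable_norm Bochner_Integration.integrable_diff)
      show "integrable M (\<lambda>\<omega>. e + 2 * indicator E \<omega>)"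
        by (intro Bochner_Integration.integrable_add integrable_const integrable_mult_right integrable_real_indicator)
           (auto simp: less_top[symmetric])
      fix \<omega> assume \<omega>: "\<omega> \<in> space M"
      show "cmod (iexp (t * X n \<omega>) - iexp (t * Y n \<omega>)) \<le> e + 2 * indicator E \<omega>"
      proof (cases "\<omega> \<in> E")
        case True
        have "cmod (iexp (t * X n \<omega>) - iexp (t * Y n \<omega>)) \<le> cmod (iexp (t * X n \<omega>)) + cmod (iexp (t * Y n \<omega>))"
          by (rule norm_triangle_ineq4)
        then show ?thesis using True e by simp
      next
        case False
        then have "\<bar>t * X n \<omega> - t * Y n \<omega>\<bar> \<le> e" using le[of \<omega>] \<omega> by (simp add: algebra_simps)
        then show ?thesis using norm_iexp_diff_le[of "t * X n \<omega>" "t * Y n \<omega>"] False by simp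
      qed
    qed
    also have "\<dots> = e + 2 * measure M E"
      by (subst Bochner_Integration.integral_add) (auto simp: prob_space less_top[symmetric] intro!: integrable_real_indicator)
    also have "\<dots> \<le> 3 * e" using Ee by simp
    finally show ?case using e by simp
  qed
  then show "\<exists>no. \<forall>n\<ge>no. norm (char (distr M borel (X n)) t - char (distr M borel (Y n)) t - 0) < r"
    unfolding eventually_sequentially by simp
qed

end

section \<open>Weak convergence from characteristic functions\<close>

text \<open>The phase \<open>s\<close> brings in sines as shifted cosines. Each generator is the
  real part of a constant times a character, so convergence of its integrals is convergence of
  characteristic functions.\<close>

inductive_set trig_poly :: "nat \<Rightarrow> ((nat \<Rightarrow> real) \<Rightarrow> real) set" for d where
  base: "(\<lambda>x. cos ((\<Sum>i<d. t i * x i) + s)) \<in> trig_poly d"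
| scale: "f \<in> trig_poly d \<Longrightarrow> (\<lambda>x. c * f x) \<in> trig_poly d"
| add: "f \<in> trig_poly d \<Longrightarrow> g \<in> trig_poly d \<Longrightarrow> (\<lambda>x. f x + g x) \<in> trig_poly d"

lemma trig_poly_mult_base:
  assumes "g \<in> trig_poly d"
  shows "(\<lambda>x. cos ((\<Sum>i<d. t i * x i) + s) * g x) \<in> trig_poly d"
  using assms
proof induction
  case (base u v)
  have "(\<lambda>x. cos ((\<Sum>i<d. t i * x i) + s) * cos ((\<Sum>i<d. u i * x i) + v)) =
    (\<lambda>x. 1/2 * cos ((\<Sum>i<d. (t i - u i) * x i) + (s - v)) + 1/2 * cos ((\<Sum>i<d. (t i + u i) * x i) + (s + v)))"
    by (rule ext) (simp add: cos_times_cos sum.distrib sum_subtractf algebra_simps add_divide_distrib)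
  then show ?case by (simp only:) (intro trig_poly.intros)
next
  case (scale f c)
  show ?case using trig_poly.scale[OF scale.IH, of c] by (simp add: mult_ac)
next
  case (add f g)
  show ?case using trig_poly.add[OF add.IH] by (simp add: algebra_simps)
qed

lemma trig_poly_mult:
  assumes "f \<in> trig_poly d" "g \<in> trig_poly d"
  shows "(\<lambda>x. f x * g x) \<in> trig_poly d"
  using assms(1)
proof induction
  case (base t s)
  show ?case by (rule trig_poly_mult_base[OF assms(2)])
next
  case (scale f c)
  show ?case using trig_poly.scale[OF scale.IH, of c] by (simp add: mult_ac)
next
  case (add f g)
  show ?case using trig_poly.add[OF add.IH] by (simp add: algebra_simps)
qed

lemma trig_poly_const: "(\<lambda>x. c) \<in> trig_poly d"
  using trig_poly.scale[OF trig_poly.base[where t="\<lambda>_. 0" and s=0 and d=d], of c] by simp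

lemma trig_poly_sin:
  assumes "i < d" shows "(\<lambda>x. sin (k * x i)) \<in> trig_poly d"
proof -
  have "(\<lambda>x. sin (k * x i)) = (\<lambda>x. cos ((\<Sum>j<d. (if j = i then k else 0) * x j) + (- pi / 2)))"
  proof (rule ext)
    fix x :: "nat \<Rightarrow> real"
    have "(\<Sum>j<d. (if j = i then k else 0) * x j) = (\<Sum>j<d. if j = i then k * x j else 0)"
      by (intro sum.cong) auto
    also have "\<dots> = k * x i" using assms by simp
    finally show "sin (k * x i) = cos ((\<Sum>j<d. (if j = i then k else 0) * x j) + (- pi / 2))"
      by (simp add: cos_diff)
  qed
  then show ?thesis by (simp only: trig_poly.base)
qed

lemma borel_measurable_coordinate [measurable]:
  "(\<lambda>x :: nat \<Rightarrow> real. x i) \<in> borel_measurable borel"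
  by (intro borel_measurable_continuous_onI continuous_on_product_coordinates)

lemma trig_poly_bounded:
  assumes "f \<in> trig_poly d"
  shows "f \<in> borel_measurable borel" "\<exists>B. \<forall>x. \<bar>f x\<bar> \<le> B"
proof -
  show "f \<in> borel_measurable borel" using assms by induction (simp_all add: borel_measurable_times borel_measurable_add)
  show "\<exists>B. \<forall>x. \<bar>f x\<bar> \<le> B" using assms
  proof induction
    case (base t s)
    then show ?case by (intro exI[of _ 1]) simp
  next
    case (scale f c)
    then obtain B where "\<forall>x. \<bar>f x\<bar> \<le> B" by blast
    then show ?case by (intro exI[of _ "\<bar>c\<bar> * B"]) (auto simp: abs_mult intro!: mult_left_mono)
  next
    case (add f g)
    then obtain B C where "\<forall>x. \<bar>f x\<bar> \<le> B" "\<forall>x. \<bar>g x\<bar> \<le> C" by blast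
    then have "\<forall>x. \<bar>f x + g x\<bar> \<le> B + C"
      by (meson abs_triangle_ineq add_mono order_trans)
    then show ?case by blast
  qed
qed

text \<open>Tychonoff's theorem, with the one-point factor {0} in all coordinates from
  \<open>d\<close> on. The cube is the domain on which Stone-Weierstrass is applied.\<close>

lemma compact_cube:
  "compact {y :: nat \<Rightarrow> real. (\<forall>i<d. \<bar>y i\<bar> \<le> 1) \<and> (\<forall>i\<ge>d. y i = 0)}"
proof -
  have "{y :: nat \<Rightarrow> real. (\<forall>i<d. \<bar>y i\<bar> \<le> 1) \<and> (\<forall>i\<ge>d. y i = 0)}
      = Pi\<^sub>E UNIV (\<lambda>i. if i < d then {-1..1} else {0})" (is "_ = ?P")
    by (auto simp: PiE_UNIV_domain Pi_iff abs_le_iff split: if_splits)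
  moreover have "compactin (product_topology (\<lambda>_. euclidean) UNIV) ?P"
    by (subst compactin_PiE) auto
  ultimately show ?thesis
    by (simp add: euclidean_product_topology)
qed

text \<open>For trigonometric polynomials the hypothesis is all that is needed. Passing to bounded
  continuous functions requires tightness, which the one-dimensional marginals supply through Levy's
  continuity theorem. The approximants see only the coordinates below \<open>d\<close>; the support
  condition on the measures makes this harmless.\<close>

lemma weak_conv_top_char:
  fixes \<mu> :: "nat \<Rightarrow> (nat \<Rightarrow> real) measure" and \<nu> :: "(nat \<Rightarrow> real) measure"
  assumes mu: "\<And>n. prob_space (\<mu> n)" "\<And>n. sets (\<mu> n) = sets borel" "\<And>n. AE x in \<mu> n. \<forall>i\<ge>d. x i = 0"
    and nu: "prob_space \<nu>" "sets \<nu> = sets borel" "AE x in \<nu>. \<forall>i\<ge>d. x i = 0"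
    and conv: "\<And>t. (\<lambda>n. CLINT x|\<mu> n. iexp (\<Sum>i<d. t i * x i)) \<longlonglongrightarrow> (CLINT x|\<nu>. iexp (\<Sum>i<d. t i * x i))"
  shows "weak_conv_top \<mu> \<nu>"
proof -
  note [measurable_cong] = mu(2) nu(2)
  interpret mu: prob_space "\<mu> n" for n by (rule mu)
  interpret nu: prob_space \<nu> by (rule nu)
  have bint_mu: "integrable (\<mu> n) f" if "f \<in> borel_measurable borel" "\<forall>x. \<bar>f x\<bar> \<le> B" for f :: "(nat \<Rightarrow> real) \<Rightarrow> real" and B n
    using that by (intro mu.integrable_const_bound[where B=B]) (auto simp: measurable_cong_sets[OF mu(2) refl])
  have bint_nu: "integrable \<nu> f" if "f \<in> borel_measurable borel" "\<forall>x. \<bar>f x\<bar> \<le> B" for f :: "(nat \<Rightarrow> real) \<Rightarrow> real" and B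
    using that by (intro nu.integrable_const_bound[where B=B]) (auto simp: measurable_cong_sets[OF nu(2) refl])
  have cos_Re: "cos (y + s) = Re (exp (\<i> * s) * iexp y)" for y s :: real
    by (simp add: Re_exp Im_exp cos_add algebra_simps)
  have trig: "(\<lambda>n. integral\<^sup>L (\<mu> n) f) \<longlonglongrightarrow> integral\<^sup>L \<nu> f" if "f \<in> trig_poly d" for f
    using that
  proof induction
    case (base t s)
    have I: "(LINT x|N. cos ((\<Sum>i<d. t i * x i) + s)) = Re (exp (\<i> * s) * (CLINT x|N. iexp (\<Sum>i<d. t i * x i)))"
      if "prob_space N" "sets N = sets borel" for N :: "(nat \<Rightarrow> real) measure"
    proof -
      interpret N: prob_space N by fact
      note [measurable_cong] = that(2)
      have int: "complex_integrable N (\<lambda>x. exp (\<i> * s) * iexp (\<Sum>i<d. t i * x i))"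
        by (intro integrable_mult_right N.integrable_const_bound[where B=1]) auto
      show ?thesis
        unfolding cos_Re by (subst integral_Re[OF int]) (simp only: integral_mult_right_zero)
    qed
    show ?case
      unfolding I[OF mu(1,2)] I[OF nu(1,2)] by (intro tendsto_Re tendsto_mult tendsto_const conv)
  next
    case (scale f c)
    then show ?case by (auto intro: tendsto_mult)
  next
    case (add f g)
    have "integral\<^sup>L (\<mu> n) (\<lambda>x. f x + g x) = integral\<^sup>L (\<mu> n) f + integral\<^sup>L (\<mu> n) g" for n
      using trig_poly_bounded[OF add.hyps(1)] trig_poly_bounded[OF add.hyps(2)] bint_mu
      by (intro Bochner_Integration.integral_add) blast+
    moreover have "integral\<^sup>L \<nu> (\<lambda>x. f x + g x) = integral\<^sup>L \<nu> f + integral\<^sup>L \<nu> g"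
      using trig_poly_bounded[OF add.hyps(1)] trig_poly_bounded[OF add.hyps(2)] bint_nu
      by (intro Bochner_Integration.integral_add) blast+
    ultimately show ?case using add.IH by (auto intro: tendsto_add)
  qed
  have tight: "\<exists>K>0. (\<forall>\<^sub>F n in sequentially. measure (\<mu> n) {x. \<bar>x i\<bar> > K} \<le> e) \<and> measure \<nu> {x. \<bar>x i\<bar> > K} \<le> e"
    if i: "i < d" and e: "e > 0" for i and e :: real
  proof -
    have ci: "(\<Sum>j<d. (if j = i then t else 0) * x j) = t * x i" for t and x :: "nat \<Rightarrow> real"
    proof -
      have "(\<Sum>j<d. (if j = i then t else 0) * x j) = (\<Sum>j<d. if j = i then t * x j else 0)"
        by (intro sum.cong) auto
      then show ?thesis using i by simp
    qed
    have wc: "weak_conv_m (\<lambda>n. distr (\<mu> n) borel (\<lambda>x. x i)) (distr \<nu> borel (\<lambda>x. x i))"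
    proof (rule levy_continuity)
      show "(\<lambda>n. char (distr (\<mu> n) borel (\<lambda>x. x i)) t) \<longlonglongrightarrow> char (distr \<nu> borel (\<lambda>x. x i)) t" for t
        using conv[of "\<lambda>j. if j = i then t else 0"] unfolding ci char_def
        by (simp add: integral_distr)
    qed (auto intro!: mu.real_distribution_distr nu.real_distribution_distr)
    have "(\<lambda>k. measure \<nu> {x. \<bar>x i\<bar> > real k}) \<longlonglongrightarrow> measure \<nu> (\<Inter>k. {x. \<bar>x i\<bar> > real k})"
      by (rule nu.finite_Lim_measure_decseq) (auto simp: decseq_def)
    moreover have "(\<Inter>k. {x :: nat \<Rightarrow> real. \<bar>x i\<bar> > real k}) = {}"
      by auto (meson not_less real_arch_simple)
    ultimately have "(\<lambda>k. measure \<nu> {x. \<bar>x i\<bar> > real k}) \<longlonglongrightarrow> 0" by simp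
    then obtain k where k: "measure \<nu> {x. \<bar>x i\<bar> > real k} < e/2"
      using order_tendstoD(2)[of _ 0 sequentially "e/2"] e
      by (metis (mono_tags, lifting) eventually_happens' half_gt_zero sequentially_bot)
    \<comment> \<open>A continuous function between the indicators of |x| > k + 1 and |x| > k: the
      tail of the limit law controls the tails of the sequence, at the price of one unit.\<close>
    define h where "h x = min 1 (max 0 (\<bar>x\<bar> - real k))" for x :: real
    have hm: "h \<in> borel_measurable borel" unfolding h_def[abs_def] by measurable
    have h1: "\<bar>h x\<bar> \<le> 1" for x by (simp add: h_def min_def max_def)
    have hc: "isCont h x" for x unfolding h_def[abs_def] by (intro continuous_intros)
    note h = hm h1 hc
    have "(\<lambda>n. integral\<^sup>L (distr (\<mu> n) borel (\<lambda>x. x i)) h) \<longlonglongrightarrow> integral\<^sup>L (distr \<nu> borel (\<lambda>x. x i)) h"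
      by (rule weak_conv_imp_integral_bdd_continuous_conv[OF _ _ wc, where B=1])
         (use h in \<open>auto intro!: mu.real_distribution_distr nu.real_distribution_distr\<close>)
    then have lim: "(\<lambda>n. LINT x|\<mu> n. h (x i)) \<longlonglongrightarrow> (LINT x|\<nu>. h (x i))"
      using h(1) by (simp add: integral_distr)
    have hb: "(\<lambda>x. h (x i)) \<in> borel_measurable borel" using h(1) by measurable
    have "(LINT x|\<nu>. h (x i)) \<le> (LINT x|\<nu>. indicator {x. \<bar>x i\<bar> > real k} x)"
    proof (rule integral_mono)
      show "integrable \<nu> (\<lambda>x. h (x i))" using bint_nu[OF hb, of 1] h(2) by simp
      show "integrable \<nu> (indicator {x. \<bar>x i\<bar> > real k} :: _ \<Rightarrow> real)"
        by (rule integrable_real_indicator) (auto simp: less_top[symmetric])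
    qed (auto simp: h_def indicator_def)
    also have "\<dots> = measure \<nu> {x. \<bar>x i\<bar> > real k}" by simp
    finally have "(LINT x|\<nu>. h (x i)) < e" using k e by simp
    then have ev: "\<forall>\<^sub>F n in sequentially. (LINT x|\<mu> n. h (x i)) < e"
      using order_tendstoD(2)[OF lim] by blast
    have le: "measure N {x. \<bar>x i\<bar> > real k + 1} \<le> (LINT x|N. h (x i))"
      if "finite_measure N" "sets N = sets borel" "integrable N (\<lambda>x. h (x i))" for N :: "(nat \<Rightarrow> real) measure"
    proof -
      interpret finite_measure N by fact
      note [measurable_cong] = that(2)
      have "measure N {x. \<bar>x i\<bar> > real k + 1} = (LINT x|N. indicator {x. \<bar>x i\<bar> > real k + 1} x)"
        using sets_eq_imp_space_eq[OF that(2)] by simp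
      also have "\<dots> \<le> (LINT x|N. h (x i))"
      proof (rule integral_mono[OF _ that(3)])
        show "integrable N (indicator {x. \<bar>x i\<bar> > real k + 1} :: _ \<Rightarrow> real)"
          by (rule integrable_real_indicator) (auto simp: less_top[symmetric])
      qed (auto simp: h_def indicator_def)
      finally show ?thesis .
    qed
    show ?thesis
    proof (intro exI[of _ "real k + 1"] conjI)
      show "\<forall>\<^sub>F n in sequentially. measure (\<mu> n) {x. \<bar>x i\<bar> > real k + 1} \<le> e"
        using ev by eventually_elim
          (use le[OF mu.finite_measure_axioms mu(2) bint_mu[OF hb, of 1]] h(2) in \<open>force intro: order_trans\<close>)
      show "measure \<nu> {x. \<bar>x i\<bar> > real k + 1} \<le> e"
        using le[OF nu.finite_measure_axioms nu(2) bint_nu[OF hb, of 1]] h(2) \<open>(LINT x|\<nu>. h (x i)) < e\<close> by auto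
    qed simp
  qed
  show ?thesis
    unfolding weak_conv_top_def
  proof (intro allI impI)
    fix f :: "(nat \<Rightarrow> real) \<Rightarrow> real"
    assume cf: "continuous_on UNIV f" and "bounded (range f)"
    then obtain B where B: "\<And>x. \<bar>f x\<bar> \<le> B" unfolding bounded_iff by auto
    have B0: "B \<ge> 0" using B[of undefined] by linarith
    have fm: "f \<in> borel_measurable borel" by (rule borel_measurable_continuous_onI[OF cf])
    define S where "S = {y :: nat \<Rightarrow> real. (\<forall>i<d. \<bar>y i\<bar> \<le> 1) \<and> (\<forall>i\<ge>d. y i = 0)}"
    show "(\<lambda>n. integral\<^sup>L (\<mu> n) f) \<longlonglongrightarrow> integral\<^sup>L \<nu> f"
    proof (rule LIMSEQ_I)
      fix r :: real assume r: "r > 0"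
      \<comment> \<open>Read off from the final estimate: two comparisons of \<open>f\<close> with
        its approximant and one convergence error must stay below \<open>r\<close>.\<close>
      define e where "e = min 1 (r / (3 + 2 * (2 * B + 1) * real d + 1))"
      have "0 \<le> 2 * (2 * B + 1) * real d" using B0 by (intro mult_nonneg_nonneg) auto
      then have den: "3 + 2 * (2 * B + 1) * real d + 1 > 0" by linarith
      have e: "e > 0" "e \<le> 1" using r den by (auto simp: e_def)
      have er: "3 * e + 2 * (2 * B + 1) * real d * e < r"
      proof -
        have "(3 + 2 * (2 * B + 1) * real d + 1) * e \<le> r"
          using den by (simp add: e_def min_def pos_le_divide_eq mult.commute)
        then show ?thesis using e by (simp add: algebra_simps)
      qed
      obtain K where K: "\<And>i. i < d \<Longrightarrow> K i > 0"
          "\<And>i. i < d \<Longrightarrow> \<forall>\<^sub>F n in sequentially. measure (\<mu> n) {x. \<bar>x i\<bar> > K i} \<le> e"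
          "\<And>i. i < d \<Longrightarrow> measure \<nu> {x. \<bar>x i\<bar> > K i} \<le> e"
        using tight[OF _ e(1)] by metis
      \<comment> \<open>On the cube |x i| <= K i the argument k i * x i then stays within
        [-pi/2, pi/2], where arcsin undoes the sine.\<close>
      define k where "k i = pi / (2 * K i)" for i
      have k: "k i > 0" if "i < d" for i using K(1)[OF that] by (simp add: k_def)
      define \<sigma> where "\<sigma> x = (\<lambda>i. if i < d then sin (k i * x i) else 0)" for x :: "nat \<Rightarrow> real"
      \<comment> \<open>This is \<open>f\<close> in the coordinates y i = sin (k i * x i). Outside
        the large cube it agrees with \<open>f\<close> no longer, but it is defined and bounded on
        all of \<open>S\<close>.\<close>
      define G where "G y = f (\<lambda>i. if i < d then arcsin (y i) / k i else 0)" for y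
      have \<sigma>S: "\<sigma> x \<in> S" for x by (simp add: \<sigma>_def S_def)
      have contG: "continuous_on S G"
        unfolding G_def
      proof (rule continuous_on_compose2[OF cf])
        show "continuous_on S (\<lambda>y i. if i < d then arcsin (y i) / k i else 0)"
        proof (rule continuous_on_coordinatewise_then_product)
          fix i
          have c: "continuous_on S (\<lambda>y. y i)"
            by (rule continuous_on_subset[OF continuous_on_product_coordinates]) simp
          show "continuous_on S (\<lambda>y. if i < d then arcsin (y i) / k i else 0)"
          proof (cases "i < d")
            case True
            then have "continuous_on S (\<lambda>y. arcsin (y i) / k i)"
              using k[OF True] by (intro continuous_on_divide continuous_on_const continuous_on_arcsin c) (auto simp: S_def abs_le_iff)
            then show ?thesis using True by simp
          qed simp
        qed
      qed simp
      \<comment> \<open>The algebra consists of the continuous functions on the cube whose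
        composition with \<open>\<sigma>\<close> is a trigonometric polynomial; coordinate functions
        belong to it and separate points.\<close>
      have "\<exists>g. (continuous_on S g \<and> (\<lambda>x. g (\<sigma> x)) \<in> trig_poly d) \<and> (\<forall>x\<in>S. \<bar>G x - g x\<bar> < e)"
      proof (rule Stone_Weierstrass_HOL[where P="\<lambda>g. continuous_on S g \<and> (\<lambda>x. g (\<sigma> x)) \<in> trig_poly d"])
        show "compact S" unfolding S_def by (rule compact_cube)
        fix x y assume xy: "x \<in> S \<and> y \<in> S \<and> x \<noteq> y"
        then obtain i where i: "x i \<noteq> y i" by blast
        then have "i < d" using xy by (force simp: S_def not_less)
        then have "(\<lambda>x. \<sigma> x i) \<in> trig_poly d"
          using trig_poly_sin[of i d "k i"] by (simp add: \<sigma>_def)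
        moreover have "continuous_on S (\<lambda>y. y i)"
          by (rule continuous_on_subset[OF continuous_on_product_coordinates]) simp
        ultimately show "\<exists>f. (continuous_on S f \<and> (\<lambda>x. f (\<sigma> x)) \<in> trig_poly d) \<and> f x \<noteq> f y"
          using i by (intro exI[of _ "\<lambda>y. y i"]) auto
      qed (use contG e in \<open>auto intro!: continuous_intros trig_poly_const trig_poly.add trig_poly_mult\<close>)
      then obtain g where g: "(\<lambda>x. g (\<sigma> x)) \<in> trig_poly d" "\<And>x. x \<in> S \<Longrightarrow> \<bar>G x - g x\<bar> < e" by blast
      define q where "q x = g (\<sigma> x)" for x
      have qt: "q \<in> trig_poly d" using g(1) by (simp add: q_def[abs_def])
      \<comment> \<open>Valid on the whole space, because \<open>\<sigma>\<close> maps every point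
        into \<open>S\<close> and \<open>G\<close> inherits the bound of \<open>f\<close> there.
        Hence the mass outside the large cube costs only a constant times its measure.\<close>
      have qB: "\<bar>q x\<bar> \<le> B + e" for x
        using g(2)[OF \<sigma>S, of x] B[of "\<lambda>i. if i < d then arcsin (\<sigma> x i) / k i else 0"]
        by (simp add: q_def G_def)
      have fB: "\<bar>f x\<bar> \<le> B + e" for x using B[of x] e by linarith
      have qm: "q \<in> borel_measurable borel" using trig_poly_bounded[OF qt] by blast
      have qf: "\<bar>f x - q x\<bar> \<le> e" if x: "\<forall>i\<ge>d. x i = 0" "\<forall>i<d. \<bar>x i\<bar> \<le> K i" for x
      proof -
        have "(if i < d then arcsin (\<sigma> x i) / k i else 0) = x i" for i
        proof (cases "i < d")
          case True
          have "k i * \<bar>x i\<bar> \<le> k i * K i" using x True k[OF True] by (intro mult_left_mono) auto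
          then have "\<bar>k i * x i\<bar> \<le> pi / 2" using k[OF True] K(1)[OF True] by (simp add: abs_mult k_def)
          then have "arcsin (sin (k i * x i)) = k i * x i" by (intro arcsin_sin) auto
          then show ?thesis using True k[OF True] by (simp add: \<sigma>_def)
        qed (use x in auto)
        then have "G (\<sigma> x) = f x" by (simp add: G_def cong: if_cong)
        then show ?thesis using g(2)[OF \<sigma>S, of x] by (simp add: q_def)
      qed
      have close: "\<bar>integral\<^sup>L N f - integral\<^sup>L N q\<bar> \<le> e + (2 * B + 1) * (real d * e)"
        if N: "prob_space N" "sets N = sets borel" "AE x in N. \<forall>i\<ge>d. x i = 0"
          and Ke: "\<And>i. i < d \<Longrightarrow> measure N {x. \<bar>x i\<bar> > K i} \<le> e" for N :: "(nat \<Rightarrow> real) measure"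
      proof -
        interpret N: prob_space N by fact
        note [measurable_cong] = N(2)
        have int: "integrable N f" "integrable N q"
          using fB qB fm qm by (auto intro!: N.integrable_const_bound[where B="B + e"] simp: measurable_cong_sets[OF N(2) refl])
        have inti: "integrable N (indicator {x. \<bar>x i\<bar> > K i} :: _ \<Rightarrow> real)" for i
          by (auto simp: less_top[symmetric] intro!: integrable_real_indicator)
        have "\<bar>integral\<^sup>L N f - integral\<^sup>L N q\<bar> = \<bar>LINT x|N. f x - q x\<bar>" using int by simp
        also have "\<dots> \<le> (LINT x|N. \<bar>f x - q x\<bar>)" by (rule integral_abs_bound)
        also have "\<dots> \<le> (LINT x|N. e + (2 * B + 1) * (\<Sum>i<d. indicator {x. \<bar>x i\<bar> > K i} x))"
        proof (rule integral_mono_AE)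
          show "integrable N (\<lambda>x. \<bar>f x - q x\<bar>)" using int by simp
          show "integrable N (\<lambda>x. e + (2 * B + 1) * (\<Sum>i<d. indicator {x. \<bar>x i\<bar> > K i} x))"
            using inti by simp
          show "AE x in N. \<bar>f x - q x\<bar> \<le> e + (2 * B + 1) * (\<Sum>i<d. indicator {x. \<bar>x i\<bar> > K i} x)"
            using N(3)
          proof eventually_elim
            case (elim x)
            show ?case
            proof (cases "\<forall>i<d. \<bar>x i\<bar> \<le> K i")
              case True
              have "0 \<le> (2 * B + 1) * (\<Sum>i<d. indicator {x. \<bar>x i\<bar> > K i} x)"
                using B0 by (intro mult_nonneg_nonneg sum_nonneg) auto
              then show ?thesis using qf[OF elim True] by linarith
            next
              case False
              then obtain i where i: "i < d" "\<bar>x i\<bar> > K i" by (auto simp: not_le)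
              have "(1::real) = indicator {x. \<bar>x i\<bar> > K i} x" using i by simp
              also have "\<dots> \<le> (\<Sum>i<d. indicator {x. \<bar>x i\<bar> > K i} x)"
                using i by (intro member_le_sum) auto
              finally have "(2 * B + 1) * 1 \<le> (2 * B + 1) * (\<Sum>i<d. indicator {x. \<bar>x i\<bar> > K i} x)"
                using B0 by (intro mult_left_mono) auto
              then have "e + (2 * B + 1) * 1 \<le> e + (2 * B + 1) * (\<Sum>i<d. indicator {x. \<bar>x i\<bar> > K i} x)"
                by (rule add_left_mono)
              moreover have "\<bar>f x - q x\<bar> \<le> e + (2 * B + 1) * 1"
                by (rule order_trans[OF abs_triangle_ineq4], rule order_trans[OF add_mono[OF B qB]]) simp
              ultimately show ?thesis by (rule order_trans[rotated])
            qed
          qed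
        qed
        also have "\<dots> = e + (2 * B + 1) * (\<Sum>i<d. measure N {x. \<bar>x i\<bar> > K i})"
          using inti sets_eq_imp_space_eq[OF N(2)] N.prob_space by simp
        also have "(\<Sum>i<d. measure N {x. \<bar>x i\<bar> > K i}) \<le> (\<Sum>i<d. e)"
          by (intro sum_mono Ke) auto
        finally show ?thesis using B0 by (simp add: mult_left_mono)
      qed
      have "\<forall>\<^sub>F n in sequentially. \<forall>i\<in>{..<d}. measure (\<mu> n) {x. \<bar>x i\<bar> > K i} \<le> e"
        using K(2) by (intro eventually_ball_finite) auto
      moreover have "\<forall>\<^sub>F n in sequentially. dist (integral\<^sup>L (\<mu> n) q) (integral\<^sup>L \<nu> q) < e"
        using trig[OF qt] e(1) by (rule tendstoD)
      ultimately have "\<forall>\<^sub>F n in sequentially. \<bar>integral\<^sup>L (\<mu> n) f - integral\<^sup>L \<nu> f\<bar> < r"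
      proof eventually_elim
        case (elim n)
        have "\<bar>integral\<^sup>L (\<mu> n) f - integral\<^sup>L (\<mu> n) q\<bar> \<le> e + (2 * B + 1) * (real d * e)"
          using elim(1) by (intro close mu) auto
        moreover have "\<bar>integral\<^sup>L \<nu> f - integral\<^sup>L \<nu> q\<bar> \<le> e + (2 * B + 1) * (real d * e)"
          by (intro close nu K)
        moreover have "\<bar>integral\<^sup>L (\<mu> n) q - integral\<^sup>L \<nu> q\<bar> < e" using elim(2) by (simp add: dist_real_def)
        moreover have "(2 * B + 1) * (real d * e) + (2 * B + 1) * (real d * e) = 2 * (2 * B + 1) * real d * e"
          by (simp add: algebra_simps)
        ultimately show ?case using er by linarith
      qed
      then show "\<exists>no. \<forall>n\<ge>no. norm (integral\<^sup>L (\<mu> n) f - integral\<^sup>L \<nu> f) < r"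
        unfolding eventually_sequentially by simp
    qed
  qed
qed

section \<open>Gaussian laws\<close>

(* Cholesky factorization: eliminate the last index by a Schur complement. *)
lemma psd_factor:
  fixes K :: "nat \<Rightarrow> nat \<Rightarrow> real"
  assumes "\<And>i j. i < d \<Longrightarrow> j < d \<Longrightarrow> K i j = K j i"
    and "\<And>x. 0 \<le> (\<Sum>i<d. \<Sum>j<d. x i * x j * K i j)"
  shows "\<exists>A. \<forall>i<d. \<forall>j<d. K i j = (\<Sum>k<d. A i k * A j k)"
  using assms
proof (induction d arbitrary: K)
  case 0
  then show ?case by simp
next
  case (Suc d)
  define c where "c = K d d"
  have sym: "K i j = K j i" if "i < Suc d" "j < Suc d" for i j using Suc.prems(1) that .
  have expand: "(\<Sum>i<Suc d. \<Sum>j<Suc d. x i * x j * K i j)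
      = (\<Sum>i<d. \<Sum>j<d. x i * x j * K i j) + 2 * x d * (\<Sum>i<d. x i * K i d) + (x d)\<^sup>2 * c" for x
  proof -
    have "(\<Sum>j<d. x d * x j * K d j) = x d * (\<Sum>i<d. x i * K i d)"
      unfolding sum_distrib_left by (intro sum.cong) (auto simp: sym[of d])
    moreover have "(\<Sum>i<d. x i * x d * K i d) = x d * (\<Sum>i<d. x i * K i d)"
      unfolding sum_distrib_left by (intro sum.cong) auto
    ultimately show ?thesis
      by (simp add: sum.distrib c_def power2_eq_square)
  qed
  have psd: "0 \<le> (\<Sum>i<d. \<Sum>j<d. x i * x j * K i j) + 2 * y * (\<Sum>i<d. x i * K i d) + y\<^sup>2 * c" for x y
  proof -
    have "(\<Sum>i<d. \<Sum>j<d. (x(d := y)) i * (x(d := y)) j * K i j) = (\<Sum>i<d. \<Sum>j<d. x i * x j * K i j)"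
      "(\<Sum>i<d. (x(d := y)) i * K i d) = (\<Sum>i<d. x i * K i d)"
      by (auto intro!: sum.cong)
    then show ?thesis using Suc.prems(2)[of "x(d := y)"] unfolding expand by simp
  qed
  have c0: "c \<ge> 0" using psd[of "\<lambda>_. 0" 1] by simp
  show ?case
  proof (cases "c = 0")
    case True
    have zero: "K i d = 0" if "i < d" for i
    proof -
      define x where "x = (\<lambda>j. if j = i then 1 else 0 :: real)"
      have "(\<Sum>j<d. x j * K j d) = (\<Sum>j<d. if j = i then K j d else 0)"
        unfolding x_def by (intro sum.cong) auto
      then have s: "(\<Sum>j<d. x j * K j d) = K i d" using that by simp
      define Q where "Q = (\<Sum>i<d. \<Sum>j<d. x i * x j * K i j)"
      \<comment> \<open>Without a quadratic term the form is affine in y; being bounded below, it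
        has slope 0.\<close>
      have ps: "0 \<le> Q + 2 * y * K i d" for y
        using psd[of x y] unfolding s Q_def[symmetric] by (simp add: True)
      show ?thesis
      proof (rule ccontr)
        assume "K i d \<noteq> 0"
        then show False using ps[of "- (Q + 1) / (2 * K i d)"] by (simp add: field_simps)
      qed
    qed
    obtain A where A: "\<forall>i<d. \<forall>j<d. K i j = (\<Sum>k<d. A i k * A j k)"
    proof -
      have "\<exists>A. \<forall>i<d. \<forall>j<d. K i j = (\<Sum>k<d. A i k * A j k)"
      proof (rule Suc.IH)
        show "0 \<le> (\<Sum>i<d. \<Sum>j<d. x i * x j * K i j)" for x using psd[of x 0] by simp
      qed (use sym in auto)
      then show ?thesis using that by blast
    qed
    show ?thesis
    proof (intro exI[of _ "\<lambda>i k. if i < d \<and> k < d then A i k else 0"] allI impI)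
      fix i j assume ij: "i < Suc d" "j < Suc d"
      consider "i < d \<and> j < d" | "i = d" | "j = d" using ij by linarith
      then show "K i j = (\<Sum>k<Suc d. (if i < d \<and> k < d then A i k else 0) * (if j < d \<and> k < d then A j k else 0))"
      proof cases
        case 1
        then show ?thesis using A by simp
      next
        case 2
        then show ?thesis using sym[of d j] zero[of j] ij True by (cases "j = d") (auto simp: c_def)
      next
        case 3
        then show ?thesis using zero[of i] ij True by (cases "i = d") (auto simp: c_def)
      qed
    qed
  next
    case False
    then have c: "c > 0" using c0 by simp
    define K' where "K' i j = K i j - K i d * K j d / c" for i j
    obtain A where A: "\<forall>i<d. \<forall>j<d. K' i j = (\<Sum>k<d. A i k * A j k)"
    proof -
      have "\<exists>A. \<forall>i<d. \<forall>j<d. K' i j = (\<Sum>k<d. A i k * A j k)"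
      proof (rule Suc.IH)
        fix x :: "nat \<Rightarrow> real"
        define s where "s = (\<Sum>i<d. x i * K i d)"
        have "(\<Sum>i<d. \<Sum>j<d. x i * x j * K' i j) = (\<Sum>i<d. \<Sum>j<d. x i * x j * K i j) - s * s / c"
          unfolding K'_def s_def sum_product
          by (simp add: right_diff_distrib sum_subtractf sum_divide_distrib mult_ac)
        \<comment> \<open>The Schur complement is the minimum of the full form over the last
          coordinate, attained at - s / c.\<close>
        also have "\<dots> = (\<Sum>i<d. \<Sum>j<d. x i * x j * K i j) + 2 * (- s / c) * s + (- s / c)\<^sup>2 * c"
          using c by (simp add: field_simps power2_eq_square)
        finally show "0 \<le> (\<Sum>i<d. \<Sum>j<d. x i * x j * K' i j)"
          using psd[of x "- s / c"] unfolding s_def by simp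
      qed (use sym in \<open>auto simp: K'_def\<close>)
      then show ?thesis using that by blast
    qed
    have sc: "sqrt c * sqrt c = c" using c0 by simp
    show ?thesis
    proof (intro exI[of _ "\<lambda>i k. if k = d then K i d / sqrt c else if i < d then A i k else 0"] allI impI)
      fix i j assume ij: "i < Suc d" "j < Suc d"
      let ?A = "\<lambda>i k. if k = d then K i d / sqrt c else if i < d then A i k else 0"
      have e: "(\<Sum>k<Suc d. ?A i k * ?A j k) = (\<Sum>k<d. (if i < d then A i k else 0) * (if j < d then A j k else 0)) + K i d * K j d / c"
        using c sc by (simp add: times_divide_times_eq)
      consider "i < d \<and> j < d" | "i = d" | "j = d" using ij by linarith
      then show "K i j = (\<Sum>k<Suc d. ?A i k * ?A j k)" unfolding e
      proof cases
        case 1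
        then have "K' i j = (\<Sum>k<d. A i k * A j k)" using A by blast
        then show "K i j = (\<Sum>k<d. (if i < d then A i k else 0) * (if j < d then A j k else 0)) + K i d * K j d / c"
          using 1 by (simp add: K'_def)
      next
        case 2
        then show "K i j = (\<Sum>k<d. (if i < d then A i k else 0) * (if j < d then A j k else 0)) + K i d * K j d / c"
          using c ij sym[of d j] by (simp add: c_def)
      next
        case 3
        then show "K i j = (\<Sum>k<d. (if i < d then A i k else 0) * (if j < d then A j k else 0)) + K i d * K j d / c"
          using c ij by (simp add: c_def)
      qed
    qed
  qed
qed

lemma real_distribution_normal_law:
  assumes "normal_law 0 v \<mu>" shows "real_distribution \<mu>"
proof (cases "v = 0")
  case True
  then have "\<mu> = return borel 0" using assms by (simp add: normal_law_def)
  then show ?thesis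
    by (auto intro!: real_distribution.intro prob_space_return simp: real_distribution_axioms_def)
next
  case False
  then have v: "v > 0" and "\<mu> = density lborel (normal_density 0 (sqrt v))"
    using assms by (auto simp: normal_law_def)
  then show ?thesis
    using prob_space_normal_density[of "sqrt v" 0]
    by (auto intro!: real_distribution.intro simp: real_distribution_axioms_def)
qed

lemma char_normal_law:
  assumes "normal_law 0 v \<mu>"
  shows "char \<mu> s = exp (- (v * s\<^sup>2) / 2)"
proof (cases "v = 0")
  case True
  then have "\<mu> = return borel 0" using assms by (simp add: normal_law_def)
  then show ?thesis using True by (simp add: char_def integral_return)
next
  case False
  then have v: "v > 0" and mu: "\<mu> = density lborel (normal_density 0 (sqrt v))"
    using assms by (auto simp: normal_law_def)
  interpret N: real_distribution std_normal_distribution by (rule real_dist_normal_dist)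
  have "distributed std_normal_distribution lborel (\<lambda>x. x) std_normal_density"
    by (auto simp: distributed_def distr_id2)
  from N.normal_density_affine[OF this, of "sqrt v" 0] v
  have "distributed std_normal_distribution lborel (\<lambda>x. sqrt v * x) (normal_density 0 (sqrt v))"
    by simp
  then have "distr std_normal_distribution lborel (\<lambda>x. sqrt v * x) = \<mu>"
    unfolding mu distributed_def by simp
  moreover have "distr std_normal_distribution lborel (\<lambda>x. sqrt v * x) = distr std_normal_distribution borel (\<lambda>x. sqrt v * x)"
    by (rule distr_cong) auto
  ultimately have "\<mu> = distr std_normal_distribution borel (\<lambda>x. sqrt v * x)" by simp
  then have "char \<mu> s = char std_normal_distribution (s * sqrt v)"
    by (simp add: char_def integral_distr mult_ac)
  also have "\<dots> = exp (- (v * s\<^sup>2) / 2)"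
    using v unfolding char_std_normal_distribution by (simp add: power_mult_distrib mult_ac)
  finally show ?thesis .
qed

lemma normal_law_exists: "v \<ge> 0 \<Longrightarrow> \<exists>\<mu>. normal_law m v \<mu>"
  unfolding normal_law_def by blast

lemma normal_law_charI:
  assumes "real_distribution \<mu>" "v \<ge> 0" "\<And>s. char \<mu> s = exp (- (v * s\<^sup>2) / 2)"
  shows "normal_law 0 v \<mu>"
proof -
  obtain \<nu> where nu: "normal_law 0 v \<nu>" using normal_law_exists[OF assms(2)] by blast
  have "\<mu> = \<nu>"
    using assms(3) char_normal_law[OF nu]
    by (intro Levy_uniqueness assms(1) real_distribution_normal_law[OF nu] ext) simp
  then show ?thesis using nu by simp
qed

lemma scalar_prod_mult_mat_vec:
  fixes C :: "real mat"
  assumes "t \<in> carrier_vec d" "C \<in> carrier_mat d d"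
  shows "t \<bullet> (C *\<^sub>v t) = (\<Sum>i<d. \<Sum>j<d. t $ i * t $ j * C $$ (i, j))"
proof -
  have "t \<bullet> (C *\<^sub>v t) = (\<Sum>i<d. t $ i * (\<Sum>j<d. C $$ (i, j) * t $ j))"
    using assms unfolding scalar_prod_def atLeast0LessThan
    by (intro sum.cong) (auto simp: scalar_prod_def atLeast0LessThan intro!: sum.cong)
  also have "\<dots> = (\<Sum>i<d. \<Sum>j<d. t $ i * t $ j * C $$ (i, j))"
    unfolding sum_distrib_left by (intro sum.cong refl) simp
  finally show ?thesis .
qed

lemma indep_vars_PiM_coordinates:
  fixes N :: "real measure"
  assumes "real_distribution N"
  shows "prob_space.indep_vars (PiM (UNIV :: nat set) (\<lambda>_. N)) (\<lambda>_. borel) (\<lambda>i z. z i) UNIV"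
    and "distr (PiM (UNIV :: nat set) (\<lambda>_. N)) borel (\<lambda>z. z i) = N"
    and "prob_space (PiM (UNIV :: nat set) (\<lambda>_. N))"
proof -
  interpret N: real_distribution N by fact
  let ?P = "PiM (UNIV :: nat set) (\<lambda>_. N)"
  show ps: "prob_space ?P" by (intro prob_space_PiM N.prob_space_axioms)
  interpret P: prob_space ?P by fact
  have c: "distr ?P N (\<lambda>z. z i) = N" for i
    by (rule distr_PiM_component) (auto intro: N.prob_space_axioms)
  have b: "distr ?P borel (\<lambda>z. z i) = distr ?P N (\<lambda>z. z i)" for i
    by (rule distr_cong) auto
  show "distr ?P borel (\<lambda>z. z i) = N" using b c by simp
  have rv: "(\<lambda>z. z i) \<in> borel_measurable ?P" for i
    using measurable_component_singleton[of i UNIV "\<lambda>_. N"]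
    by (simp add: measurable_cong_sets[OF refl N.events_eq_borel])
  have m: "sets (PiM UNIV (\<lambda>_::nat. borel)) = sets ?P"
    by (intro sets_PiM_cong) auto
  show "P.indep_vars (\<lambda>_. borel) (\<lambda>i z. z i) UNIV"
  proof (subst P.indep_vars_iff_distr_eq_PiM)
    have "distr ?P (PiM UNIV (\<lambda>_. borel)) (\<lambda>x. \<lambda>i\<in>UNIV. x i) = distr ?P ?P (\<lambda>x. x)"
      using m by (intro distr_cong) auto
    then show "distr ?P (PiM UNIV (\<lambda>_. borel)) (\<lambda>x. \<lambda>i\<in>UNIV. x i) = PiM UNIV (\<lambda>i. distr ?P borel (\<lambda>z. z i))"
      by (simp add: b c)
  qed (auto intro: rv)
qed

text \<open>The law is the image of independent standard normal variables under a factor A with A A'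
  = C. A linear form in it is a sum of independent normal variables, whose characteristic functions
  multiply. Singular C is covered, since A need not be invertible.\<close>

lemma normal_law_vec_exists:
  assumes C: "C \<in> carrier_mat d d" and sym: "C\<^sup>T = C"
    and psd: "\<And>x. 0 \<le> (\<Sum>i<d. \<Sum>j<d. x i * x j * C $$ (i, j))"
  shows "\<exists>\<nu>. normal_law_vec (0\<^sub>v d) C \<nu>"
proof -
  have symC: "C $$ (i, j) = C $$ (j, i)" if "i < d" "j < d" for i j
    using C sym that by (metis carrier_matD(1) carrier_matD(2) index_transpose_mat(1))
  obtain A where A: "\<And>i j. i < d \<Longrightarrow> j < d \<Longrightarrow> C $$ (i, j) = (\<Sum>k<d. A i k * A j k)"
    using psd_factor[of d "\<lambda>i j. C $$ (i, j)"] symC psd by metis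
  let ?N = "std_normal_distribution"
  interpret N: real_distribution ?N by (rule real_dist_normal_dist)
  define P where "P = PiM (UNIV :: nat set) (\<lambda>_. ?N)"
  note PP = indep_vars_PiM_coordinates[OF real_dist_normal_dist, folded P_def]
  interpret P: prob_space P by (rule PP(3))
  have [measurable]: "(\<lambda>z. z k) \<in> borel_measurable P" for k
    using PP(1) unfolding P.indep_vars_def by auto
  define g where "g z = (\<lambda>i. if i < d then \<Sum>k<d. A i k * z k else 0)" for z :: "nat \<Rightarrow> real"
  have [measurable]: "g \<in> borel_measurable P"
    unfolding g_def[abs_def] by (rule measurable_coordinatewise_then_product) simp
  define \<nu> where "\<nu> = distr P borel g"
  have nps: "prob_space \<nu>" unfolding \<nu>_def by (rule P.prob_space_distr) simp
  have "normal_law_vec (0\<^sub>v d) C \<nu>"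
    unfolding normal_law_vec_def Let_def
  proof (intro conjI ballI)
    show "AE x in \<nu>. \<forall>i\<ge>dim_vec (0\<^sub>v d). x i = 0"
      unfolding \<nu>_def by (subst AE_distr_iff) (auto simp: g_def)
  next
    fix t :: "real vec" assume "t \<in> carrier_vec (dim_vec (0\<^sub>v d :: real vec))"
    then have t: "t \<in> carrier_vec d" by simp
    define c where "c k = (\<Sum>i<d. t $ i * A i k)" for k
    have lin: "(\<Sum>i<d. t $ i * g z i) = (\<Sum>k<d. c k * z k)" for z
    proof -
      have "(\<Sum>i<d. t $ i * g z i) = (\<Sum>i<d. \<Sum>k<d. t $ i * A i k * z k)"
        by (intro sum.cong) (auto simp: g_def sum_distrib_left mult_ac)
      also have "\<dots> = (\<Sum>k<d. \<Sum>i<d. t $ i * A i k * z k)" by (rule sum.swap)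
      finally show ?thesis by (simp add: c_def sum_distrib_right)
    qed
    have v: "t \<bullet> (C *\<^sub>v t) = (\<Sum>k<d. (c k)\<^sup>2)"
    proof -
      have "t \<bullet> (C *\<^sub>v t) = (\<Sum>i<d. \<Sum>j<d. \<Sum>k<d. (t $ i * A i k) * (t $ j * A j k))"
        unfolding scalar_prod_mult_mat_vec[OF t C]
        by (intro sum.cong) (auto simp: A sum_distrib_left mult_ac)
      also have "\<dots> = (\<Sum>k<d. \<Sum>i<d. \<Sum>j<d. (t $ i * A i k) * (t $ j * A j k))"
        by (subst sum.swap[of _ "{..<d}" "{..<d}"], subst (2) sum.swap, rule sum.swap)?
           (subst (2) sum.swap, subst sum.swap, simp)
      finally show ?thesis by (simp add: c_def power2_eq_square sum_product)
    qed
    have d1: "distr \<nu> borel (\<lambda>x. \<Sum>i<d. t $ i * x i) = distr P borel (\<lambda>z. \<Sum>k<d. c k * z k)"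
      unfolding \<nu>_def by (subst distr_distr) (auto simp: comp_def lin)
    have ind: "P.indep_vars (\<lambda>_. borel) (\<lambda>k z. c k * z k) {..<d}"
      by (rule P.indep_vars_compose2[where X="\<lambda>k z. z k" and M'="\<lambda>_. borel"])
         (auto intro: P.indep_vars_subset[OF PP(1)])
    have cc: "char (distr P borel (\<lambda>z. c k * z k)) s = exp (- ((c k)\<^sup>2 * s\<^sup>2) / 2)" for k s
    proof -
      have "char (distr P borel (\<lambda>z. c k * z k)) s = char (distr P borel (\<lambda>z. z k)) (s * c k)"
        by (subst (1 2) P.char_distr_eq) (auto simp: mult_ac)
      also have "\<dots> = exp (- ((c k)\<^sup>2 * s\<^sup>2) / 2)"
        unfolding PP(2) char_std_normal_distribution by (simp add: power_mult_distrib mult_ac)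
      finally show ?thesis .
    qed
    have "normal_law 0 (\<Sum>k<d. (c k)\<^sup>2) (distr \<nu> borel (\<lambda>x. \<Sum>i<d. t $ i * x i))"
    proof (rule normal_law_charI)
      show "real_distribution (distr \<nu> borel (\<lambda>x. \<Sum>i<d. t $ i * x i))"
        unfolding d1 by (rule P.real_distribution_distr) simp
      show "char (distr \<nu> borel (\<lambda>x. \<Sum>i<d. t $ i * x i)) s = exp (- ((\<Sum>k<d. (c k)\<^sup>2) * s\<^sup>2) / 2)" for s
        unfolding d1 P.char_distr_sum[OF ind] cc
        by (simp flip: of_real_prod exp_sum add: sum_negf sum_divide_distrib sum_distrib_right)
    qed (simp add: sum_nonneg)
    moreover have "t \<bullet> 0\<^sub>v d = 0" using t by simp
    ultimately show "normal_law (t \<bullet> 0\<^sub>v d) (t \<bullet> (C *\<^sub>v t)) (distr \<nu> borel (\<lambda>x. \<Sum>i<dim_vec (0\<^sub>v d :: real vec). t $ i * x i))"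
      unfolding v by simp
  qed (use C sym nps in \<open>auto simp: \<nu>_def\<close>)
  then show ?thesis by blast
qed

lemma normal_law_vec_char:
  assumes "normal_law_vec (0\<^sub>v d) C \<nu>"
  shows "(CLINT x|\<nu>. iexp (\<Sum>i<d. t i * x i)) = exp (- (\<Sum>i<d. \<Sum>j<d. t i * t j * C $$ (i, j)) / 2)"
proof -
  have C: "C \<in> carrier_mat d d" and sets: "sets \<nu> = sets borel"
    and law: "\<And>t. t \<in> carrier_vec d \<Longrightarrow>
      normal_law (t \<bullet> 0\<^sub>v d) (t \<bullet> (C *\<^sub>v t)) (distr \<nu> borel (\<lambda>x. \<Sum>i<d. t $ i * x i))"
    and ps: "prob_space \<nu>"
    using assms by (auto simp: normal_law_vec_def Let_def)
  interpret prob_space \<nu> by (rule ps)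
  note [measurable_cong] = sets
  let ?t = "vec d t"
  have t: "?t \<in> carrier_vec d" by simp
  have "normal_law 0 (?t \<bullet> (C *\<^sub>v ?t)) (distr \<nu> borel (\<lambda>x. \<Sum>i<d. ?t $ i * x i))"
    using law[OF t] by simp
  from char_normal_law[OF this, of 1]
  have "char (distr \<nu> borel (\<lambda>x. \<Sum>i<d. t i * x i)) 1 = exp (- (\<Sum>i<d. \<Sum>j<d. t i * t j * C $$ (i, j)) / 2)"
    unfolding scalar_prod_mult_mat_vec[OF t C] by (simp cong: sum.cong_simp)
  moreover have "(\<lambda>x. \<Sum>i<d. t i * x i) \<in> borel_measurable \<nu>"
    by (intro borel_measurable_sum borel_measurable_times borel_measurable_const)
       (auto simp: measurable_cong_sets[OF sets refl])
  ultimately show ?thesis by (simp add: char_distr_eq)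
qed

section \<open>Quadratic forms in independent variables\<close>

lemma cesaro_mean:
  fixes h :: "nat \<Rightarrow> real"
  assumes "h \<longlonglongrightarrow> c"
  shows "(\<lambda>n. (\<Sum>k<n. h k) / n) \<longlonglongrightarrow> c"
proof (rule LIMSEQ_I)
  fix r :: real assume r: "r > 0"
  obtain m where m: "\<And>k. k \<ge> m \<Longrightarrow> \<bar>h k - c\<bar> < r / 2"
    using LIMSEQ_D[OF assms, of "r / 2"] r by auto
  then have m': "\<And>k. k \<ge> m \<Longrightarrow> \<bar>h k - c\<bar> \<le> r / 2" by (meson less_imp_le)
  define C where "C = (\<Sum>k<m. \<bar>h k - c\<bar>)"
  have C: "C \<ge> 0" unfolding C_def by (intro sum_nonneg) auto
  obtain n0 where n0: "real n0 > 2 * C / r" using reals_Archimedean2 by blast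
  show "\<exists>no. \<forall>n\<ge>no. norm ((\<Sum>k<n. h k) / n - c) < r"
  proof (intro exI allI impI)
    fix n assume n: "n \<ge> max (Suc m) (Suc n0)"
    then have np: "real n > 0" by simp
    have "2 * C / r < n" using n0 n by (auto intro: less_trans)
    then have C2: "C < r / 2 * n" using r by (simp add: field_simps)
    have "(\<Sum>k<n. h k) / n - c = (\<Sum>k<n. h k - c) / n" using np by (simp add: sum_subtractf diff_divide_distrib)
    moreover have "\<bar>\<Sum>k<n. h k - c\<bar> \<le> (\<Sum>k<n. \<bar>h k - c\<bar>)" by (rule sum_abs)
    moreover have "(\<Sum>k<n. \<bar>h k - c\<bar>) = C + (\<Sum>k=m..<n. \<bar>h k - c\<bar>)"
      unfolding C_def lessThan_atLeast0 using n by (subst sum.atLeastLessThan_concat) auto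
    moreover have "(\<Sum>k=m..<n. \<bar>h k - c\<bar>) \<le> (\<Sum>k=m..<n. r / 2)"
      by (intro sum_mono m') auto
    moreover have "(\<Sum>k=m..<n. r / 2) \<le> r / 2 * n" using r by (simp add: mult_right_mono)
    ultimately have "\<bar>\<Sum>k<n. h k - c\<bar> < r / 2 * n + r / 2 * n" using C2 by linarith
    moreover have "\<bar>(\<Sum>k<n. h k) / n - c\<bar> * n = \<bar>\<Sum>k<n. h k - c\<bar>"
      using np \<open>(\<Sum>k<n. h k) / n - c = (\<Sum>k<n. h k - c) / n\<close> by (simp add: abs_mult)
    ultimately have "\<bar>(\<Sum>k<n. h k) / n - c\<bar> * n < r * n" by linarith
    then show "norm ((\<Sum>k<n. h k) / n - c) < r" using np by simp
  qed
qed

context prob_space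
begin

lemma indep_vars_inj:
  fixes V :: "nat \<Rightarrow> 'a \<Rightarrow> real"
  assumes indep: "indep_vars (\<lambda>_. borel) V J" and f: "inj_on f I" "f ` I \<subseteq> J"
  shows "indep_vars (\<lambda>_. borel) (\<lambda>i. V (f i)) I"
proof -
  have "indep_vars (\<lambda>j. PiM {f j} (\<lambda>_. borel)) (\<lambda>j \<omega>. \<lambda>i\<in>{f j}. V i \<omega>) I"
    using f by (intro indep_vars_restrict[OF indep]) (auto simp: disjoint_family_on_def inj_on_def)
  then have "indep_vars (\<lambda>_. borel) (\<lambda>j \<omega>. (\<lambda>v. v (f j)) (\<lambda>i\<in>{f j}. V i \<omega>)) I"
    by (rule indep_vars_compose2[where Y="\<lambda>j v. v (f j)" and X="\<lambda>j \<omega>. \<lambda>i\<in>{f j}. V i \<omega>" and N="\<lambda>_. borel"])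
       (auto intro: measurable_component_singleton)
  then show ?thesis by simp
qed

lemma abs_mult_le_sum_squares: "\<bar>x * y\<bar> \<le> x\<^sup>2 + y\<^sup>2" for x y :: real
proof -
  have "2 * (\<bar>x\<bar> * \<bar>y\<bar>) \<le> x\<^sup>2 + y\<^sup>2"
    using sum_squares_bound[of "\<bar>x\<bar>" "\<bar>y\<bar>"] by (simp add: mult.assoc)
  moreover have "0 \<le> \<bar>x\<bar> * \<bar>y\<bar>" by simp
  ultimately have "\<bar>x\<bar> * \<bar>y\<bar> \<le> x\<^sup>2 + y\<^sup>2" by linarith
  then show ?thesis by (simp add: abs_mult)
qed

lemma integrable_mult_sq:
  fixes X Y :: "'a \<Rightarrow> real"
  assumes [measurable]: "X \<in> borel_measurable M" "Y \<in> borel_measurable M"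
    and "integrable M (\<lambda>\<omega>. (X \<omega>)\<^sup>2)" "integrable M (\<lambda>\<omega>. (Y \<omega>)\<^sup>2)"
  shows "integrable M (\<lambda>\<omega>. X \<omega> * Y \<omega>)"
proof (rule Bochner_Integration.integrable_bound[OF Bochner_Integration.integrable_add[OF assms(3,4)]])
  show "AE \<omega> in M. norm (X \<omega> * Y \<omega>) \<le> norm ((X \<omega>)\<^sup>2 + (Y \<omega>)\<^sup>2)"
    using abs_mult_le_sum_squares by (intro AE_I2) simp
qed simp

lemma integrable_add_sq:
  fixes X Y :: "'a \<Rightarrow> real"
  assumes [measurable]: "X \<in> borel_measurable M" "Y \<in> borel_measurable M"
    and "integrable M (\<lambda>\<omega>. (X \<omega>)\<^sup>2)" "integrable M (\<lambda>\<omega>. (Y \<omega>)\<^sup>2)"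
  shows "integrable M (\<lambda>\<omega>. (X \<omega> + Y \<omega>)\<^sup>2)"
    and "expectation (\<lambda>\<omega>. (X \<omega> + Y \<omega>)\<^sup>2) =
      expectation (\<lambda>\<omega>. (X \<omega>)\<^sup>2) + expectation (\<lambda>\<omega>. (Y \<omega>)\<^sup>2) + 2 * expectation (\<lambda>\<omega>. X \<omega> * Y \<omega>)"
proof -
  have i: "integrable M (\<lambda>\<omega>. 2 * (X \<omega> * Y \<omega>))" using integrable_mult_sq[OF assms] by simp
  have e: "(X \<omega> + Y \<omega>)\<^sup>2 = (X \<omega>)\<^sup>2 + (Y \<omega>)\<^sup>2 + 2 * (X \<omega> * Y \<omega>)" for \<omega>
    by (simp add: power2_sum)
  show "integrable M (\<lambda>\<omega>. (X \<omega> + Y \<omega>)\<^sup>2)"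
    unfolding e by (intro Bochner_Integration.integrable_add assms i)
  show "expectation (\<lambda>\<omega>. (X \<omega> + Y \<omega>)\<^sup>2) =
      expectation (\<lambda>\<omega>. (X \<omega>)\<^sup>2) + expectation (\<lambda>\<omega>. (Y \<omega>)\<^sup>2) + 2 * expectation (\<lambda>\<omega>. X \<omega> * Y \<omega>)"
    unfolding e using assms i by simp
qed

lemma expectation_abs_le_sqrt:
  fixes X :: "'a \<Rightarrow> real"
  assumes [measurable]: "X \<in> borel_measurable M" and i: "integrable M (\<lambda>\<omega>. (X \<omega>)\<^sup>2)"
  shows "expectation (\<lambda>\<omega>. \<bar>X \<omega>\<bar>) \<le> sqrt (expectation (\<lambda>\<omega>. (X \<omega>)\<^sup>2))"
proof -
  have ia: "integrable M (\<lambda>\<omega>. \<bar>X \<omega>\<bar>)" using square_integrable_imp_integrable[OF assms] by simp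
  define m where "m = expectation (\<lambda>\<omega>. \<bar>X \<omega>\<bar>)"
  have "0 \<le> expectation (\<lambda>\<omega>. (\<bar>X \<omega>\<bar> - m)\<^sup>2)" by simp
  also have "(\<lambda>\<omega>. (\<bar>X \<omega>\<bar> - m)\<^sup>2) = (\<lambda>\<omega>. (X \<omega>)\<^sup>2 - 2 * m * \<bar>X \<omega>\<bar> + m\<^sup>2)"
    by (auto simp: power2_diff)
  also have "expectation \<dots> = expectation (\<lambda>\<omega>. (X \<omega>)\<^sup>2) - 2 * m * m + m\<^sup>2"
    using ia i by (simp add: prob_space m_def)
  finally have "m\<^sup>2 \<le> expectation (\<lambda>\<omega>. (X \<omega>)\<^sup>2)" by (simp add: power2_eq_square)
  then show ?thesis unfolding m_def by (rule real_le_rsqrt)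
qed

lemma char_diff_le:
  assumes [measurable]: "X \<in> borel_measurable M" "Y \<in> borel_measurable M"
    and i: "integrable M (\<lambda>\<omega>. (X \<omega> - Y \<omega>)\<^sup>2)"
  shows "cmod (char (distr M borel X) t - char (distr M borel Y) t) \<le> \<bar>t\<bar> * sqrt (expectation (\<lambda>\<omega>. (X \<omega> - Y \<omega>)\<^sup>2))"
proof -
  have int: "integrable M (\<lambda>\<omega>. iexp (t * X \<omega>))" by (rule integrable_iexp') measurable
  have int': "integrable M (\<lambda>\<omega>. iexp (t * Y \<omega>))" by (rule integrable_iexp') measurable
  have ia: "integrable M (\<lambda>\<omega>. X \<omega> - Y \<omega>)" by (rule square_integrable_imp_integrable[OF _ i]) simp
  have "char (distr M borel X) t - char (distr M borel Y) t = (CLINT \<omega>|M. iexp (t * X \<omega>) - iexp (t * Y \<omega>))"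
    using int int' by (simp add: char_distr_eq)
  also have "cmod \<dots> \<le> (LINT \<omega>|M. cmod (iexp (t * X \<omega>) - iexp (t * Y \<omega>)))"
    by (rule integral_norm_bound)
  also have "\<dots> \<le> (LINT \<omega>|M. \<bar>t\<bar> * \<bar>X \<omega> - Y \<omega>\<bar>)"
  proof (rule integral_mono)
    show "integrable M (\<lambda>\<omega>. cmod (iexp (t * X \<omega>) - iexp (t * Y \<omega>)))"
      using int int' by (intro integrable_norm Bochner_Integration.integrable_diff)
    show "integrable M (\<lambda>\<omega>. \<bar>t\<bar> * \<bar>X \<omega> - Y \<omega>\<bar>)" using ia by simp
    show "cmod (iexp (t * X \<omega>) - iexp (t * Y \<omega>)) \<le> \<bar>t\<bar> * \<bar>X \<omega> - Y \<omega>\<bar>" for \<omega>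
      using norm_iexp_diff_le[of "t * X \<omega>" "t * Y \<omega>"] by (simp add: abs_mult flip: right_diff_distrib)
  qed
  also have "\<dots> \<le> \<bar>t\<bar> * sqrt (expectation (\<lambda>\<omega>. (X \<omega> - Y \<omega>)\<^sup>2))"
    using expectation_abs_le_sqrt[OF _ i] by (simp add: mult_left_mono)
  finally show ?thesis .
qed

end

text \<open>Measurability with respect to the variables with index in I, in Doob-Dynkin form: the
  independence of disjoint subfamilies is stated for composed functions, and this is the shape it
  applies to.\<close>

definition fn_of :: "'w measure \<Rightarrow> (nat \<Rightarrow> 'w \<Rightarrow> real) \<Rightarrow> nat set \<Rightarrow> ('w \<Rightarrow> real) \<Rightarrow> bool" where
  "fn_of M V I F \<longleftrightarrow>
     (\<exists>f\<in>borel_measurable (PiM I (\<lambda>_. borel)). \<forall>\<omega>\<in>space M. F \<omega> = f (\<lambda>i\<in>I. V i \<omega>))"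

lemma fn_of_const: "fn_of M V I (\<lambda>\<omega>. c)"
  unfolding fn_of_def by (rule bexI[of _ "\<lambda>_. c"]) auto

lemma fn_of_base: "i \<in> I \<Longrightarrow> fn_of M V I (V i)"
  unfolding fn_of_def by (rule bexI[of _ "\<lambda>v. v i"]) auto

lemma fn_of_mult: 
  assumes "fn_of M V I F" "fn_of M V I G" shows "fn_of M V I (\<lambda>\<omega>. F \<omega> * G \<omega>)"
proof -
  from assms obtain f g where "f \<in> borel_measurable (PiM I (\<lambda>_. borel))" "\<forall>\<omega>\<in>space M. F \<omega> = f (\<lambda>i\<in>I. V i \<omega>)"
    "g \<in> borel_measurable (PiM I (\<lambda>_. borel))" "\<forall>\<omega>\<in>space M. G \<omega> = g (\<lambda>i\<in>I. V i \<omega>)"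
    unfolding fn_of_def by blast
  then show ?thesis unfolding fn_of_def by (intro bexI[of _ "\<lambda>v. f v * g v"]) auto
qed

lemma fn_of_add: 
  assumes "fn_of M V I F" "fn_of M V I G" shows "fn_of M V I (\<lambda>\<omega>. F \<omega> + G \<omega>)"
proof -
  from assms obtain f g where "f \<in> borel_measurable (PiM I (\<lambda>_. borel))" "\<forall>\<omega>\<in>space M. F \<omega> = f (\<lambda>i\<in>I. V i \<omega>)"
    "g \<in> borel_measurable (PiM I (\<lambda>_. borel))" "\<forall>\<omega>\<in>space M. G \<omega> = g (\<lambda>i\<in>I. V i \<omega>)"
    unfolding fn_of_def by blast
  then show ?thesis unfolding fn_of_def by (intro bexI[of _ "\<lambda>v. f v + g v"]) auto
qed

lemma fn_of_power2: "fn_of M V I F \<Longrightarrow> fn_of M V I (\<lambda>\<omega>. (F \<omega>)\<^sup>2)"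
  unfolding power2_eq_square by (rule fn_of_mult)

lemma fn_of_sum: "(\<And>k. k \<in> K \<Longrightarrow> fn_of M V I (F k)) \<Longrightarrow> fn_of M V I (\<lambda>\<omega>. \<Sum>k\<in>K. F k \<omega>)"
  by (induction K rule: infinite_finite_induct) (auto intro: fn_of_const fn_of_add)

section \<open>Second moments of linear and quadratic forms in the noise\<close>

locale iid_noise = prob_space M for M :: "'w measure" +
  fixes V :: "nat \<Rightarrow> 'w \<Rightarrow> real" and s :: real
  assumes indep: "indep_vars (\<lambda>_. borel) V UNIV"
    and ident: "distr M borel (V n) = distr M borel (V 0)"
    and sq_int: "integrable M (\<lambda>\<omega>. (V n \<omega>)\<^sup>2)"
    and mean0: "expectation (V n) = 0"
    and var: "expectation (\<lambda>\<omega>. (V n \<omega>)\<^sup>2) = s"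
begin

lemma rv [measurable]: "V n \<in> borel_measurable M"
  using indep by (auto simp: indep_vars_def2)

lemma int1: "integrable M (V n)"
  by (rule square_integrable_imp_integrable[OF rv sq_int])

lemma fn_of_measurable:
  assumes "fn_of M V I F" shows "F \<in> borel_measurable M"
proof -
  obtain f where f: "f \<in> borel_measurable (PiM I (\<lambda>_. borel))" "\<forall>\<omega>\<in>space M. F \<omega> = f (\<lambda>i\<in>I. V i \<omega>)"
    using assms unfolding fn_of_def by blast
  have "(\<lambda>\<omega>. \<lambda>i\<in>I. V i \<omega>) \<in> measurable M (PiM I (\<lambda>_. borel))" by measurable
  then have "(\<lambda>\<omega>. f (\<lambda>i\<in>I. V i \<omega>)) \<in> borel_measurable M" using f(1) by (rule measurable_compose)
  then show ?thesis using f(2) by (simp cong: measurable_cong)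
qed

lemma fn_of_mult_indep:
  assumes F: "fn_of M V I F" and G: "fn_of M V J G" and IJ: "I \<inter> J = {}"
    and int: "integrable M F" "integrable M G"
  shows "integrable M (\<lambda>\<omega>. F \<omega> * G \<omega>)" "expectation (\<lambda>\<omega>. F \<omega> * G \<omega>) = expectation F * expectation G"
proof -
  obtain f where f: "f \<in> borel_measurable (PiM I (\<lambda>_. borel))" "\<forall>\<omega>\<in>space M. F \<omega> = f (\<lambda>i\<in>I. V i \<omega>)"
    using F unfolding fn_of_def by blast
  obtain g where g: "g \<in> borel_measurable (PiM J (\<lambda>_. borel))" "\<forall>\<omega>\<in>space M. G \<omega> = g (\<lambda>i\<in>J. V i \<omega>)"
    using G unfolding fn_of_def by blast
  let ?F = "f \<circ> (\<lambda>\<omega>. \<lambda>i\<in>I. V i \<omega>)" and ?G = "g \<circ> (\<lambda>\<omega>. \<lambda>i\<in>J. V i \<omega>)"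
  have "indep_var borel ?F borel ?G"
    using indep_var_compose[OF indep_var_restrict[OF indep IJ] f(1) g(1)] by simp
  moreover have "integrable M ?F" "integrable M ?G"
    using int f(2) g(2) by (auto cong: Bochner_Integration.integrable_cong)
  ultimately have "integrable M (\<lambda>\<omega>. ?F \<omega> * ?G \<omega>)"
    "expectation (\<lambda>\<omega>. ?F \<omega> * ?G \<omega>) = expectation ?F * expectation ?G"
    by (rule indep_var_integrable indep_var_lebesgue_integral)+
  moreover have "integrable M (\<lambda>\<omega>. F \<omega> * G \<omega>) = integrable M (\<lambda>\<omega>. ?F \<omega> * ?G \<omega>)"
    "expectation (\<lambda>\<omega>. F \<omega> * G \<omega>) = expectation (\<lambda>\<omega>. ?F \<omega> * ?G \<omega>)"
    "expectation F = expectation ?F" "expectation G = expectation ?G"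
    using f(2) g(2) by (auto intro!: Bochner_Integration.integral_cong Bochner_Integration.integrable_cong)
  ultimately show "integrable M (\<lambda>\<omega>. F \<omega> * G \<omega>)" "expectation (\<lambda>\<omega>. F \<omega> * G \<omega>) = expectation F * expectation G"
    by simp_all
qed

definition lin :: "(nat \<Rightarrow> real) \<Rightarrow> nat \<Rightarrow> 'w \<Rightarrow> real" where
  "lin c n \<omega> = (\<Sum>l<n. c l * V l \<omega>)"

lemma lin_fn_of: "fn_of M V {..<n} (lin c n)"
  unfolding lin_def[abs_def] by (intro fn_of_sum fn_of_mult fn_of_const fn_of_base) auto

lemma lin_measurable [measurable]: "lin c n \<in> borel_measurable M"
  by (rule fn_of_measurable[OF lin_fn_of])

lemma lin_sq:
  "integrable M (\<lambda>\<omega>. (lin c n \<omega>)\<^sup>2) \<and> expectation (\<lambda>\<omega>. (lin c n \<omega>)\<^sup>2) = s * (\<Sum>l<n. (c l)\<^sup>2)"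
proof (induction n)
  case 0
  then show ?case by (simp add: lin_def)
next
  case (Suc n)
  have e: "lin c (Suc n) \<omega> = lin c n \<omega> + c n * V n \<omega>" for \<omega> by (simp add: lin_def)
  have i: "integrable M (\<lambda>\<omega>. (c n * V n \<omega>)\<^sup>2)" using sq_int by (simp add: power_mult_distrib)
  have li: "integrable M (lin c n)"
    by (rule square_integrable_imp_integrable) (use Suc in auto)
  have cross: "expectation (\<lambda>\<omega>. lin c n \<omega> * (c n * V n \<omega>)) = 0"
  proof (subst fn_of_mult_indep(2)[OF lin_fn_of[of n c], of "{n}"])
    show "fn_of M V {n} (\<lambda>\<omega>. c n * V n \<omega>)" by (intro fn_of_mult fn_of_const fn_of_base) simp
  qed (use li int1 mean0 in auto)
  show ?case
    unfolding e using Suc i cross integrable_add_sq[of "lin c n" "\<lambda>\<omega>. c n * V n \<omega>"]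
    by (simp add: power_mult_distrib var distrib_left)
qed

text \<open>Strictly lower triangular: V k is multiplied by earlier variables only. The summands are
  martingale differences, and the square of a single variable does not occur.\<close>

definition quad :: "(nat \<Rightarrow> nat \<Rightarrow> real) \<Rightarrow> nat \<Rightarrow> 'w \<Rightarrow> real" where
  "quad c n \<omega> = (\<Sum>k<n. V k \<omega> * lin (c k) k \<omega>)"

lemma fn_of_mono:
  assumes "fn_of M V I F" "I \<subseteq> J" shows "fn_of M V J F"
proof -
  obtain f where f: "f \<in> borel_measurable (PiM I (\<lambda>_. borel))" "\<forall>\<omega>\<in>space M. F \<omega> = f (\<lambda>i\<in>I. V i \<omega>)"
    using assms(1) unfolding fn_of_def by blast
  have "(\<lambda>v. restrict v I) \<in> measurable (PiM J (\<lambda>_. borel)) (PiM I (\<lambda>_. borel :: real measure))"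
    using assms(2) by (rule measurable_restrict_subset)
  then have "(\<lambda>v. f (restrict v I)) \<in> borel_measurable (PiM J (\<lambda>_. borel))"
    using f(1) by (rule measurable_compose)
  moreover have "restrict (\<lambda>i\<in>J. V i \<omega>) I = (\<lambda>i\<in>I. V i \<omega>)" for \<omega>
    using assms(2) by (auto simp: restrict_def fun_eq_iff)
  ultimately show ?thesis using f(2) unfolding fn_of_def by (intro bexI[of _ "\<lambda>v. f (restrict v I)"]) auto
qed

lemma quad_fn_of: "fn_of M V {..<n} (quad c n)"
  unfolding quad_def[abs_def]
  by (intro fn_of_sum fn_of_mult fn_of_const fn_of_base fn_of_mono[OF lin_fn_of]) auto

lemma quad_measurable [measurable]: "quad c n \<in> borel_measurable M"
  by (rule fn_of_measurable[OF quad_fn_of])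

text \<open>The new summand is V n times a function of the earlier variables. Independence factors
  its second moment, and in the cross term with the previous sum it splits off the mean of V n,
  which is 0.\<close>

lemma quad_sq:
  "integrable M (\<lambda>\<omega>. (quad c n \<omega>)\<^sup>2) \<and>
   expectation (\<lambda>\<omega>. (quad c n \<omega>)\<^sup>2) = s\<^sup>2 * (\<Sum>k<n. \<Sum>l<k. (c k l)\<^sup>2)"
proof (induction n)
  case 0
  then show ?case by (simp add: quad_def)
next
  case (Suc n)
  let ?L = "lin (c n) n"
  have e: "quad c (Suc n) \<omega> = quad c n \<omega> + V n \<omega> * ?L \<omega>" for \<omega> by (simp add: quad_def)
  have V2: "fn_of M V {n} (\<lambda>\<omega>. (V n \<omega>)\<^sup>2)" "fn_of M V {n} (V n)"
    by (intro fn_of_power2 fn_of_base, simp)+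
  have L2: "fn_of M V {..<n} (\<lambda>\<omega>. (?L \<omega>)\<^sup>2)" by (intro fn_of_power2 lin_fn_of)
  have VL: "integrable M (\<lambda>\<omega>. (V n \<omega> * ?L \<omega>)\<^sup>2)"
    "expectation (\<lambda>\<omega>. (V n \<omega> * ?L \<omega>)\<^sup>2) = s\<^sup>2 * (\<Sum>l<n. (c n l)\<^sup>2)"
    using fn_of_mult_indep[OF V2(1) L2] sq_int lin_sq[of "c n" n]
    by (auto simp: power_mult_distrib var power2_eq_square[of s])
  have LQ: "fn_of M V {..<n} (\<lambda>\<omega>. quad c n \<omega> * ?L \<omega>)" by (intro fn_of_mult lin_fn_of quad_fn_of)
  have iLQ: "integrable M (\<lambda>\<omega>. quad c n \<omega> * ?L \<omega>)"
    using Suc lin_sq[of "c n" n] by (intro integrable_mult_sq) auto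
  have "expectation (\<lambda>\<omega>. V n \<omega> * (quad c n \<omega> * ?L \<omega>)) = 0"
    using fn_of_mult_indep(2)[OF V2(2) LQ] int1 iLQ mean0 by simp
  then have cross: "expectation (\<lambda>\<omega>. quad c n \<omega> * (V n \<omega> * ?L \<omega>)) = 0" by (simp add: mult_ac)
  show ?case
    unfolding e using Suc VL cross integrable_add_sq[of "quad c n" "\<lambda>\<omega>. V n \<omega> * ?L \<omega>"]
    by (simp add: distrib_left)
qed

lemma quad_linear: "quad (\<lambda>k l. x * c k l + y * d k l) n \<omega> = x * quad c n \<omega> + y * quad d n \<omega>"
  unfolding quad_def lin_def
  by (simp add: algebra_simps sum.distrib sum_distrib_left)

lemma quad_extend:
  assumes "n \<le> m" "\<And>k l. n \<le> k \<Longrightarrow> k < m \<Longrightarrow> l < k \<Longrightarrow> c k l = 0"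
  shows "quad c m \<omega> = quad c n \<omega>"
proof -
  have "quad c m \<omega> = (\<Sum>k<n. V k \<omega> * lin (c k) k \<omega>)"
    unfolding quad_def
  proof (rule sum.mono_neutral_right)
    show "\<forall>k\<in>{..<m} - {..<n}. V k \<omega> * lin (c k) k \<omega> = 0"
    proof
      fix k assume k: "k \<in> {..<m} - {..<n}"
      then have "lin (c k) k \<omega> = 0" unfolding lin_def using assms(2)[of k] by (intro sum.neutral) auto
      then show "V k \<omega> * lin (c k) k \<omega> = 0" by simp
    qed
  qed (use assms in auto)
  then show ?thesis by (simp add: quad_def)
qed

section \<open>The block diagonal part of a Toeplitz form\<close>

definition block :: "(nat \<Rightarrow> real) \<Rightarrow> nat \<Rightarrow> nat \<Rightarrow> 'w \<Rightarrow> real" where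
  "block g b r \<omega> = (\<Sum>k<b. V (r * b + k) \<omega> * (\<Sum>l<k. g (k - l) * V (r * b + l) \<omega>))"

lemma sum_shift: "(\<Sum>k\<in>{m..<m + b}. f k) = (\<Sum>k<b. f (m + k :: nat))"
  using sum.shift_bounds_nat_ivl[of f 0 m b] by (simp add: atLeast0LessThan add.commute)

lemma sum_same_block:
  fixes F :: "nat \<Rightarrow> nat \<Rightarrow> real"
  assumes b: "b > 0"
  shows "(\<Sum>k<N * b. \<Sum>l<k. if k div b = l div b then F k l else 0)
    = (\<Sum>r<N. \<Sum>k<b. \<Sum>l<k. F (r * b + k) (r * b + l))"
proof -
  let ?c = "\<lambda>k l. if k div b = l div b then F k l else 0 :: real"
  have "(\<Sum>k<N * b. \<Sum>l<k. ?c k l) = (\<Sum>r<N. \<Sum>k\<in>{r * b..<r * b + b}. \<Sum>l<k. ?c k l)"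
    by (rule sum.nat_group[symmetric])
  also have "\<dots> = (\<Sum>r<N. \<Sum>k<b. \<Sum>l<k. F (r * b + k) (r * b + l))"
    unfolding sum_shift
  proof (rule sum.cong[OF refl], rule sum.cong[OF refl])
    fix r k assume k: "k \<in> {..<b}"
    have dv: "(r * b + k) div b = r" if "k < b" for k using that by simp
    have "(\<Sum>l<r * b + k. ?c (r * b + k) l) = (\<Sum>l\<in>{r * b..<r * b + k}. ?c (r * b + k) l)"
    proof (rule sum.mono_neutral_right)
      show "\<forall>l\<in>{..<r * b + k} - {r * b..<r * b + k}. ?c (r * b + k) l = 0"
      proof
        fix l assume "l \<in> {..<r * b + k} - {r * b..<r * b + k}"
        then have "l < r * b" by auto
        then have "l div b < r" using b by (simp add: div_less_iff_less_mult)
        then show "?c (r * b + k) l = 0" using dv[of k] k by simp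
      qed
    qed auto
    also have "\<dots> = (\<Sum>l<k. F (r * b + k) (r * b + l))"
      unfolding sum_shift using k by (intro sum.cong) (auto simp: dv)
    finally show "(\<Sum>l<r * b + k. ?c (r * b + k) l) = (\<Sum>l<k. F (r * b + k) (r * b + l))" .
  qed
  finally show ?thesis .
qed

lemma quad_blocks:
  assumes b: "b > 0"
  shows "quad (\<lambda>k l. if k div b = l div b then g (k - l) else 0) (N * b) \<omega> = (\<Sum>r<N. block g b r \<omega>)"
proof -
  have "quad (\<lambda>k l. if k div b = l div b then g (k - l) else 0) (N * b) \<omega>
      = (\<Sum>k<N * b. \<Sum>l<k. if k div b = l div b then V k \<omega> * (g (k - l) * V l \<omega>) else 0)"
    unfolding quad_def lin_def sum_distrib_left by (intro sum.cong) auto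
  then show ?thesis unfolding sum_same_block[OF b] block_def sum_distrib_left by simp
qed

lemma block_fn:
  "block g b r \<omega> = (\<lambda>v. \<Sum>k<b. v (r * b + k) * (\<Sum>l<k. g (k - l) * v (r * b + l))) (\<lambda>i\<in>{r * b..<r * b + b}. V i \<omega>)"
  unfolding block_def by (auto intro!: sum.cong)

lemma block_indep: "indep_vars (\<lambda>_. borel) (block g b) UNIV"
proof -
  let ?K = "\<lambda>r. {r * b..<r * b + b}"
  let ?f = "\<lambda>r v. \<Sum>k<b. v (r * b + k) * (\<Sum>l<k. g (k - l) * v (r * b + l)) :: real"
  have dis: "disjoint_family ?K"
    unfolding disjoint_family_on_def
  proof (intro ballI impI)
    have le: "i * b + b \<le> j * b" if "i < j" for i j :: nat
      using mult_le_mono1[of "Suc i" j b] that by simp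
    fix i j :: nat assume "i \<noteq> j"
    then consider "i < j" | "j < i" by linarith
    then show "?K i \<inter> ?K j = {}"
    proof cases
      case 1
      then show ?thesis using le[of i j] by auto
    next
      case 2
      then show ?thesis using le[of j i] by auto
    qed
  qed
  have "indep_vars (\<lambda>r. PiM (?K r) (\<lambda>_. borel)) (\<lambda>r \<omega>. \<lambda>i\<in>?K r. V i \<omega>) UNIV"
    using dis by (intro indep_vars_restrict[OF indep]) auto
  then have "indep_vars (\<lambda>_. borel) (\<lambda>r \<omega>. ?f r (\<lambda>i\<in>?K r. V i \<omega>)) UNIV"
  proof (rule indep_vars_compose2[where Y="?f" and X="\<lambda>r \<omega>. \<lambda>i\<in>?K r. V i \<omega>" and N="\<lambda>_. borel"])
    fix r
    have m: "(\<lambda>v. v (r * b + k)) \<in> borel_measurable (PiM (?K r) (\<lambda>_. borel :: real measure))" if "k < b" for k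
      using that by (intro measurable_component_singleton) auto
    show "?f r \<in> borel_measurable (PiM (?K r) (\<lambda>_. borel))"
      by (intro borel_measurable_sum borel_measurable_times borel_measurable_const m) auto
  qed
  moreover have "block g b = (\<lambda>r \<omega>. ?f r (\<lambda>i\<in>?K r. V i \<omega>))"
    by (intro ext block_fn)
  ultimately show ?thesis by simp
qed

text \<open>Each block is the same function of b consecutive variables, whose joint law is a product
  measure that does not depend on the position. Length 0 is split off because the product
  characterisation of independence is used for a nonempty index set.\<close>

lemma block_ident: "distr M borel (block g b r) = distr M borel (block g b 0)"
proof (cases "b = 0")
  case True
  then show ?thesis by (simp add: block_def[abs_def])
next
  case False
  let ?I = "{..<b}" 
  let ?f = "\<lambda>v. \<Sum>k<b. v k * (\<Sum>l<k. g (k - l) * v l) :: real"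
  have m: "(\<lambda>v. v k) \<in> borel_measurable (PiM ?I (\<lambda>_. borel :: real measure))" if "k < b" for k
    using that by (intro measurable_component_singleton) auto
  have fm: "?f \<in> borel_measurable (PiM ?I (\<lambda>_. borel))"
    by (intro borel_measurable_sum borel_measurable_times borel_measurable_const m) auto
  have "distr M borel (block g b r) = distr (PiM ?I (\<lambda>_. distr M borel (V 0))) borel ?f" for r
  proof -
    let ?X = "\<lambda>\<omega>. \<lambda>k\<in>?I. V (r * b + k) \<omega>"
    have Xm: "?X \<in> measurable M (PiM ?I (\<lambda>_. borel))" by (rule measurable_restrict) simp
    have ind: "indep_vars (\<lambda>_. borel) (\<lambda>k. V (r * b + k)) ?I"
      by (rule indep_vars_inj[OF indep]) (auto simp: inj_on_def)
    have ne: "?I \<noteq> {}" using False by auto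
    have "distr M (PiM ?I (\<lambda>_. borel)) ?X = PiM ?I (\<lambda>k. distr M borel (V (r * b + k)))"
      by (rule iffD1[OF indep_vars_iff_distr_eq_PiM[OF ne rv] ind])
    also have "(\<lambda>k. distr M borel (V (r * b + k))) = (\<lambda>k. distr M borel (V 0))" by (rule ext) (rule ident)
    finally have eq: "distr M (PiM ?I (\<lambda>_. borel)) ?X = PiM ?I (\<lambda>k. distr M borel (V 0))" .
    have "distr (PiM ?I (\<lambda>_. distr M borel (V 0))) borel ?f = distr M borel (?f \<circ> ?X)"
      unfolding eq[symmetric] by (rule distr_distr[OF fm Xm])
    moreover have "?f \<circ> ?X = block g b r"
      unfolding fun_eq_iff block_def comp_def
      by (intro allI sum.cong refl arg_cong2[where f="(*)"]) auto
    ultimately show ?thesis by simp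
  qed
  then show ?thesis by simp
qed

definition G2 :: "(nat \<Rightarrow> real) \<Rightarrow> nat \<Rightarrow> real" where
  "G2 g k = (\<Sum>l<k. (g (k - l))\<^sup>2)"

definition H2 :: "(nat \<Rightarrow> real) \<Rightarrow> nat \<Rightarrow> real" where
  "H2 g b = (\<Sum>k<b. G2 g k)"

lemma G2_eq: "G2 g k = (\<Sum>j<k. (g (Suc j))\<^sup>2)"
  unfolding G2_def using sum.nat_diff_reindex[of "\<lambda>j. (g (Suc j))\<^sup>2" k]
  by (simp add: Suc_diff_Suc cong: sum.cong_simp)

lemma block_measurable [measurable]: "block g b r \<in> borel_measurable M"
  using block_indep[of g b] by (auto simp: indep_vars_def2)

lemma block_mean: "integrable M (block g b r)" "expectation (block g b r) = 0"
proof -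
  have t: "integrable M (\<lambda>\<omega>. V (r * b + k) \<omega> * (g (k - l) * V (r * b + l) \<omega>)) \<and>
    expectation (\<lambda>\<omega>. V (r * b + k) \<omega> * (g (k - l) * V (r * b + l) \<omega>)) = 0" if "l < k" for k l
    using fn_of_mult_indep[of "{r * b + k}" "V (r * b + k)" "{r * b + l}" "\<lambda>\<omega>. g (k - l) * V (r * b + l) \<omega>"] that
    by (simp add: fn_of_base fn_of_mult fn_of_const int1 mean0)
  define T where "T k \<omega> = (\<Sum>l<k. V (r * b + k) \<omega> * (g (k - l) * V (r * b + l) \<omega>))" for k \<omega>
  have T: "integrable M (T k)" "expectation (T k) = 0" for k
    unfolding T_def[abs_def] by (auto intro!: Bochner_Integration.integrable_sum simp: t Bochner_Integration.integral_sum)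
  have e: "block g b r = (\<lambda>\<omega>. \<Sum>k<b. T k \<omega>)"
    by (simp add: block_def[abs_def] T_def sum_distrib_left)
  show "integrable M (block g b r)" "expectation (block g b r) = 0"
    unfolding e using T by (auto simp: Bochner_Integration.integral_sum)
qed

text \<open>Only block 0 is literally a \<open>quad\<close>; the other blocks have the same
  law.\<close>

lemma block_sq: "integrable M (\<lambda>\<omega>. (block g b r \<omega>)\<^sup>2)" "expectation (\<lambda>\<omega>. (block g b r \<omega>)\<^sup>2) = s\<^sup>2 * H2 g b"
proof -
  have b0: "block g b 0 = quad (\<lambda>k l. g (k - l)) b"
    by (auto simp: block_def quad_def lin_def fun_eq_iff)
  have d: "integrable (distr M borel (block g b r)) (\<lambda>x. x\<^sup>2) = integrable (distr M borel (block g b 0)) (\<lambda>x. x\<^sup>2)"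
    "integral\<^sup>L (distr M borel (block g b r)) (\<lambda>x. x\<^sup>2) = integral\<^sup>L (distr M borel (block g b 0)) (\<lambda>x. x\<^sup>2)"
    by (simp_all only: block_ident[of g b r])
  show "integrable M (\<lambda>\<omega>. (block g b r \<omega>)\<^sup>2)" "expectation (\<lambda>\<omega>. (block g b r \<omega>)\<^sup>2) = s\<^sup>2 * H2 g b"
    using d quad_sq[of "\<lambda>k l. g (k - l)" b]
    by (simp_all add: integrable_distr_eq integral_distr b0 H2_def G2_def)
qed

text \<open>For a fixed block length this is the central limit theorem for independent identically
  distributed summands. Vanishing variance is separate: there all blocks are 0 almost
  surely.\<close>

lemma char_blocks:
  assumes b: "b > 0"
  shows "(\<lambda>N. char (distr M borel (\<lambda>\<omega>. (\<Sum>r<N. block g b r \<omega>) / sqrt (real (N * b)))) t)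
    \<longlonglongrightarrow> exp (- (s\<^sup>2 * H2 g b / b * t\<^sup>2) / 2)"
proof (cases "s\<^sup>2 * H2 g b = 0")
  case True
  have z: "AE \<omega> in M. \<forall>r. block g b r \<omega> = 0"
  proof (subst AE_all_countable, intro allI)
    fix r
    have "AE \<omega> in M. (block g b r \<omega>)\<^sup>2 = 0"
      using block_sq[of g b r] True by (subst integral_nonneg_eq_0_iff_AE[symmetric]) auto
    then show "AE \<omega> in M. block g b r \<omega> = 0" by simp
  qed
  have "char (distr M borel (\<lambda>\<omega>. (\<Sum>r<N. block g b r \<omega>) / sqrt (real (N * b)))) t = 1" for N
  proof -
    have "char (distr M borel (\<lambda>\<omega>. (\<Sum>r<N. block g b r \<omega>) / sqrt (real (N * b)))) t
      = (CLINT \<omega>|M. iexp (t * ((\<Sum>r<N. block g b r \<omega>) / sqrt (real (N * b)))))"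
      by (rule char_distr_eq) simp
    also have "\<dots> = (CLINT \<omega>|M. 1)"
    proof (rule integral_cong_AE)
      show "AE \<omega> in M. iexp (t * ((\<Sum>r<N. block g b r \<omega>) / sqrt (real (N * b)))) = 1"
        using z by eventually_elim simp
    qed auto
    finally show ?thesis by (simp add: prob_space)
  qed
  then show ?thesis by (simp only: True) simp
next
  case False
  define v where "v = s\<^sup>2 * H2 g b"
  have v: "v > 0" using False by (auto simp: v_def H2_def G2_def intro!: mult_nonneg_nonneg sum_nonneg order.not_eq_order_implies_strict)
  have "weak_conv_m (\<lambda>n. distr M borel (\<lambda>\<omega>. (\<Sum>i<n. block g b i \<omega>) / sqrt (n * (sqrt v)\<^sup>2))) std_normal_distribution"
  proof (rule central_limit_theorem_zero_mean)
    show "distr M borel (block g b n) = distr M borel (block g b 0)" for n by (rule block_ident)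
    show "indep_vars (\<lambda>i. borel) (block g b) UNIV" by (rule block_indep)
    show "variance (block g b n) = (sqrt v)\<^sup>2" for n
      using v by (simp add: block_mean block_sq v_def[symmetric])
  qed (use v in \<open>simp_all add: block_mean block_sq\<close>)
  \<comment> \<open>The argument t * sqrt (v / b) converts the normalisation by sqrt (n * v) into
    the one by sqrt (n * b).\<close>
  then have "(\<lambda>n. char (distr M borel (\<lambda>\<omega>. (\<Sum>i<n. block g b i \<omega>) / sqrt (n * (sqrt v)\<^sup>2))) (t * sqrt (v / b)))
      \<longlonglongrightarrow> char std_normal_distribution (t * sqrt (v / b))"
    by (intro levy_continuity1 real_distribution_distr real_dist_normal_dist) simp_all
  moreover have "char (distr M borel (\<lambda>\<omega>. (\<Sum>i<n. block g b i \<omega>) / sqrt (n * (sqrt v)\<^sup>2))) (t * sqrt (v / b))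
      = char (distr M borel (\<lambda>\<omega>. (\<Sum>r<n. block g b r \<omega>) / sqrt (real (n * b)))) t" for n
  proof -
    have "t * sqrt (v / b) * (x / sqrt (n * (sqrt v)\<^sup>2)) = t * (x / sqrt (real (n * b)))" for x
      using v b by (simp add: real_sqrt_divide real_sqrt_mult field_simps)
    then show ?thesis by (simp add: char_distr_eq)
  qed
  moreover have "char std_normal_distribution (t * sqrt (v / b)) = exp (- (s\<^sup>2 * H2 g b / b * t\<^sup>2) / 2)"
    using v unfolding char_std_normal_distribution v_def by (simp add: power_mult_distrib mult_ac)
  ultimately show ?thesis by simp
qed

text \<open>The form minus its block diagonal part has a second moment that is the difference of the two
  second moments, because the coefficients of the latter are either equal to those of the form or 0.\<close>

theorem quad_clt:
  assumes sm: "summable (\<lambda>j. (g (Suc j))\<^sup>2)"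
  shows "(\<lambda>n. char (distr M borel (\<lambda>\<omega>. quad (\<lambda>k l. g (k - l)) n \<omega> / sqrt (real n))) t)
    \<longlonglongrightarrow> exp (- (s\<^sup>2 * (\<Sum>j. (g (Suc j))\<^sup>2) * t\<^sup>2) / 2)"
proof (rule LIMSEQ_I)
  fix r :: real assume r: "r > 0"
  define \<gamma> where "\<gamma> = (\<Sum>j. (g (Suc j))\<^sup>2)"
  have G2lim: "G2 g \<longlonglongrightarrow> \<gamma>" unfolding G2_eq[abs_def] \<gamma>_def by (rule summable_LIMSEQ[OF sm])
  have G2le: "G2 g k \<le> \<gamma>" for k unfolding G2_eq \<gamma>_def by (rule sum_le_suminf[OF sm]) auto
  have H2le: "H2 g n \<le> n * \<gamma>" for n
    unfolding H2_def using sum_mono[of "{..<n}" "G2 g" "\<lambda>_. \<gamma>"] G2le by simp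
  have H2n: "H2 g n \<ge> 0" for n unfolding H2_def G2_def by (intro sum_nonneg) auto
  have H2lim: "(\<lambda>b. H2 g b / b) \<longlonglongrightarrow> \<gamma>" unfolding H2_def by (rule cesaro_mean[OF G2lim])
  define L where "L b = exp (- (s\<^sup>2 * H2 g b / b * t\<^sup>2) / 2)" for b :: nat
  define L0 where "L0 = exp (- (s\<^sup>2 * \<gamma> * t\<^sup>2) / 2)"
  have "(\<lambda>b. exp (- (s\<^sup>2 * (H2 g b / b) * t\<^sup>2) / 2)) \<longlonglongrightarrow> L0"
    unfolding L0_def by (intro tendsto_intros H2lim) simp
  then have Llim: "L \<longlonglongrightarrow> L0" by (simp add: L_def[abs_def])
  \<comment> \<open>Up to |t|, this is the L2 distance between form and block part that remains for
    fixed b as n grows. It vanishes for long blocks, because H2 g b / b is a Cesaro mean of G2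
    g.\<close>
  have "(\<lambda>b. \<bar>t\<bar> * sqrt (s\<^sup>2 * (\<gamma> - H2 g b / b))) \<longlonglongrightarrow> \<bar>t\<bar> * sqrt (s\<^sup>2 * (\<gamma> - \<gamma>))"
    by (intro tendsto_intros H2lim)
  then have "\<forall>\<^sub>F b in sequentially. \<bar>t\<bar> * sqrt (s\<^sup>2 * (\<gamma> - H2 g b / b)) < r / 4"
    by (rule order_tendstoD) (use r in simp)
  moreover have "\<forall>\<^sub>F b in sequentially. dist (L b) L0 < r / 4"
    using Llim r by (intro tendstoD) auto
  ultimately have "\<forall>\<^sub>F b in sequentially. \<bar>t\<bar> * sqrt (s\<^sup>2 * (\<gamma> - H2 g b / b)) < r / 4 \<and> dist (L b) L0 < r / 4 \<and> b > 0"
    using eventually_gt_at_top[of 0] by eventually_elim simp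
  then obtain b where b: "\<bar>t\<bar> * sqrt (s\<^sup>2 * (\<gamma> - H2 g b / b)) < r / 4" "dist (L b) L0 < r / 4" "b > 0"
    by (auto dest: eventually_happens)
  define U where "U n \<omega> = quad (\<lambda>k l. g (k - l)) n \<omega> / sqrt (real n)" for n \<omega>
  define B where "B N \<omega> = (\<Sum>r<N. block g b r \<omega>) / sqrt (real (N * b))" for N \<omega>
  have [measurable]: "U n \<in> borel_measurable M" "B n \<in> borel_measurable M" for n
    unfolding U_def[abs_def] B_def[abs_def] by simp_all
  \<comment> \<open>The ratio of the two normalisations sqrt (N * b) and sqrt n, where N = n div b
    counts the complete blocks; here \<open>\<rho>\<close> is not the autoregressive
    parameter.\<close>
  define \<rho> where "\<rho> n = sqrt (real (n div b * b) / real n)" for n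
  have rho: "\<rho> \<longlonglongrightarrow> 1"
  proof -
    have "(\<lambda>n. 1 - real (n mod b) / real n) \<longlonglongrightarrow> 1 - 0"
    proof (intro tendsto_diff tendsto_const)
      show "(\<lambda>n. real (n mod b) / real n) \<longlonglongrightarrow> 0"
      proof (rule Lim_null_comparison)
        show "\<forall>\<^sub>F n in sequentially. norm (real (n mod b) / real n) \<le> real b / real n"
          using b(3) mod_less_divisor[of b]
          by (intro always_eventually allI) (simp add: divide_right_mono less_imp_le)
        show "(\<lambda>n. real b / real n) \<longlonglongrightarrow> 0" by real_asymp
      qed
    qed
    then have "(\<lambda>n. sqrt (1 - real (n mod b) / real n)) \<longlonglongrightarrow> sqrt (1 - 0)" by (rule tendsto_real_sqrt)
    then have "(\<lambda>n. sqrt (1 - real (n mod b) / real n)) \<longlonglongrightarrow> 1" by simp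
    moreover have "\<forall>\<^sub>F n in sequentially. sqrt (1 - real (n mod b) / real n) = \<rho> n"
      using eventually_gt_at_top[of 0]
    proof eventually_elim
      case (elim n)
      have "real (n div b * b) = real n - real (n mod b)"
        using div_mult_mod_eq[of n b] by (metis add_diff_cancel_right' of_nat_add)
      then show ?case using elim by (simp add: \<rho>_def diff_divide_distrib)
    qed
    ultimately show ?thesis by (rule Lim_transform_eventually)
  qed
  \<comment> \<open>A bound for the second moment of U n - B N: its terms come from the square of
    the form, the square of the block part and the cross term. It tends to
    \<open>s\<^sup>2 * (\<gamma> - H2 g b / b)\<close>.\<close>
  define q where "q n = s\<^sup>2 * (\<gamma> + H2 g b / b - 2 * (H2 g b / b) * \<rho> n)" for n
  have close: "cmod (char (distr M borel (U n)) t - char (distr M borel (B (n div b))) t) \<le> \<bar>t\<bar> * sqrt (q n)"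
    if n: "n \<ge> b" for n
  proof -
    define N where "N = n div b"
    have N: "N > 0" "N * b \<le> n" using n b(3) by (auto simp: N_def div_greater_zero_iff)
    define c where "c k l = g (k - l)" for k l
    define d where "d k l = (if k < N * b \<and> k div b = l div b then g (k - l) else 0)" for k l
    have dq: "quad d n \<omega> = (\<Sum>r<N. block g b r \<omega>)" for \<omega>
    proof -
      have "quad d n \<omega> = quad d (N * b) \<omega>" by (rule quad_extend[OF N(2)]) (simp add: d_def)
      also have "\<dots> = quad (\<lambda>k l. if k div b = l div b then g (k - l) else 0) (N * b) \<omega>"
        by (auto simp: quad_def lin_def d_def intro!: sum.cong)
      finally show ?thesis by (simp add: quad_blocks[OF b(3)])
    qed
    define x where "x = 1 / sqrt (real n)"
    define y where "y = - 1 / sqrt (real (N * b))"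
    have UB: "U n \<omega> - B N \<omega> = quad (\<lambda>k l. x * c k l + y * d k l) n \<omega>" for \<omega>
      unfolding quad_linear dq by (simp add: U_def B_def x_def y_def c_def)
    have sqd: "(\<Sum>k<n. \<Sum>l<k. (d k l)\<^sup>2) = N * H2 g b"
    proof -
      have "(\<Sum>k<n. \<Sum>l<k. (d k l)\<^sup>2) = (\<Sum>k<N * b. \<Sum>l<k. (d k l)\<^sup>2)"
        using N(2) by (intro sum.mono_neutral_right) (auto simp: d_def)
      also have "\<dots> = (\<Sum>k<N * b. \<Sum>l<k. if k div b = l div b then (g (k - l))\<^sup>2 else 0)"
        by (auto simp: d_def intro!: sum.cong)
      also have "\<dots> = N * H2 g b" unfolding sum_same_block[OF b(3)] by (simp add: H2_def G2_def)
      finally show ?thesis .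
    qed
    have sqc: "(\<Sum>k<n. \<Sum>l<k. (c k l)\<^sup>2) = H2 g n" by (simp add: H2_def G2_def c_def)
    \<comment> \<open>Since d is either equal to c or 0, the product c * d is the square of
      d.\<close>
    have "(x * c k l + y * d k l)\<^sup>2 = x\<^sup>2 * (c k l)\<^sup>2 + (y\<^sup>2 + 2 * x * y) * (d k l)\<^sup>2" for k l
      by (cases "d k l = 0") (auto simp: c_def d_def power2_sum power_mult_distrib power2_eq_square algebra_simps split: if_splits)
    then have "(\<Sum>k<n. \<Sum>l<k. (x * c k l + y * d k l)\<^sup>2) = x\<^sup>2 * H2 g n + (y\<^sup>2 + 2 * x * y) * (N * H2 g b)"
      by (simp add: sum.distrib sqc[symmetric] sqd[symmetric] sum_distrib_left)
    then have E: "integrable M (\<lambda>\<omega>. (U n \<omega> - B N \<omega>)\<^sup>2)"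
      "expectation (\<lambda>\<omega>. (U n \<omega> - B N \<omega>)\<^sup>2) = s\<^sup>2 * (x\<^sup>2 * H2 g n + (y\<^sup>2 + 2 * x * y) * (N * H2 g b))"
      unfolding UB using quad_sq[of "\<lambda>k l. x * c k l + y * d k l" n] by simp_all
    have n0: "real n > 0" "real (N * b) > 0" using n b(3) N by auto
    have x2: "x\<^sup>2 * H2 g n \<le> \<gamma>" using H2le[of n] n0 by (simp add: x_def power_divide divide_le_eq mult.commute)
    have y2: "y\<^sup>2 * (N * H2 g b) = H2 g b / b" using N(1) b(3) by (simp add: y_def power_divide)
    have xy: "2 * x * y * (N * H2 g b) = - (2 * (H2 g b / b) * \<rho> n)"
    proof -
      have "- (x * y * real (N * b)) = real (N * b) / sqrt (real (N * b)) / sqrt (real n)"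
        unfolding x_def y_def by simp
      also have "\<dots> = \<rho> n"
        using n0(2) unfolding \<rho>_def N_def[symmetric] by (simp only: real_div_sqrt real_sqrt_divide less_imp_le)
      finally have "- (x * y * real (N * b)) = \<rho> n" .
      then have r: "x * y * real (N * b) = - \<rho> n" by simp
      have e: "2 * x * y * (N * H2 g b) = 2 * (x * y * real (N * b)) * (H2 g b / b)" using b(3) by simp
      show ?thesis unfolding e r by simp
    qed
    have "x\<^sup>2 * H2 g n + (y\<^sup>2 + 2 * x * y) * (N * H2 g b) \<le> \<gamma> + H2 g b / b - 2 * (H2 g b / b) * \<rho> n"
      using x2 y2 xy by (simp add: distrib_right)
    then have "expectation (\<lambda>\<omega>. (U n \<omega> - B N \<omega>)\<^sup>2) \<le> q n"
      unfolding E(2) q_def by (intro mult_left_mono) auto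
    then have "\<bar>t\<bar> * sqrt (expectation (\<lambda>\<omega>. (U n \<omega> - B N \<omega>)\<^sup>2)) \<le> \<bar>t\<bar> * sqrt (q n)"
      by (intro mult_left_mono) auto
    then show ?thesis using char_diff_le[OF _ _ E(1), of t] unfolding N_def[symmetric] by simp
  qed
  have "(\<lambda>n. \<bar>t\<bar> * sqrt (q n)) \<longlonglongrightarrow> \<bar>t\<bar> * sqrt (s\<^sup>2 * (\<gamma> + H2 g b / b - 2 * (H2 g b / b) * 1))"
    unfolding q_def by (intro tendsto_intros rho)
  then have "\<forall>\<^sub>F n in sequentially. \<bar>t\<bar> * sqrt (q n) < r / 4"
    by (rule order_tendstoD) (use b(1) in \<open>simp add: algebra_simps\<close>)
  moreover have "filterlim (\<lambda>n. n div b) at_top sequentially"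
    unfolding filterlim_at_top eventually_sequentially
  proof (intro allI exI impI)
    fix Z n assume "Z * b \<le> n"
    then show "Z \<le> n div b" using b(3) by (simp add: less_eq_div_iff_mult_less_eq)
  qed
  then have "(\<lambda>n. char (distr M borel (B (n div b))) t) \<longlonglongrightarrow> L b"
    using filterlim_compose[OF char_blocks[OF b(3), of g t]] by (simp add: B_def[abs_def] L_def)
  then have "\<forall>\<^sub>F n in sequentially. dist (char (distr M borel (B (n div b))) t) (L b) < r / 4"
    using r by (intro tendstoD) auto
  ultimately have "\<forall>\<^sub>F n in sequentially. cmod (char (distr M borel (U n)) t - L0) < r"
    using eventually_ge_at_top[of b]
  proof eventually_elim
    case (elim n)
    have tri: "cmod (u - z) \<le> cmod (u - v) + cmod (v - w) + cmod (w - z)" for u v w z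
      using norm_triangle_ineq[of "u - v + (v - w)" "w - z"] norm_triangle_ineq[of "u - v" "v - w"] by simp
    have "cmod (char (distr M borel (U n)) t - L0) \<le>
        cmod (char (distr M borel (U n)) t - char (distr M borel (B (n div b))) t)
        + cmod (char (distr M borel (B (n div b))) t - L b) + cmod (complex_of_real (L b) - L0)"
      by (rule tri)
    also have "cmod (complex_of_real (L b) - L0) = dist (L b) L0"
      by (simp add: dist_real_def flip: of_real_diff)
    finally show ?case using close[OF elim(3)] elim b(2) r by (simp add: dist_complex_def)
  qed
  then show "\<exists>no. \<forall>n\<ge>no. cmod (char (distr M borel (\<lambda>\<omega>. quad (\<lambda>k l. g (k - l)) n \<omega> / sqrt (real n))) t
      - exp (- (s\<^sup>2 * (\<Sum>j. (g (Suc j))\<^sup>2) * t\<^sup>2) / 2)) < r"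
    unfolding eventually_sequentially U_def[abs_def] L0_def \<gamma>_def by simp
qed

end

section \<open>The autoregressive coefficients\<close>

text \<open>The supremum K of |f| is finite by \<open>bd\<close> and satisfies K <= r K, so it is
  0.\<close>

lemma contraction_zero:
  fixes f :: "int \<Rightarrow> real"
  assumes bd: "\<And>k. \<bar>f k\<bar> \<le> C" and r: "r < 1"
    and step: "\<And>K k. (\<And>j. \<bar>f j\<bar> \<le> K) \<Longrightarrow> \<bar>f k\<bar> \<le> r * K"
  shows "f k = 0"
proof -
  define K where "K = (SUP k. \<bar>f k\<bar>)"
  have bdd: "bdd_above (range (\<lambda>k. \<bar>f k\<bar>))" using bd by (auto intro!: bdd_aboveI2)
  have le: "\<bar>f j\<bar> \<le> K" for j unfolding K_def by (rule cSUP_upper[OF UNIV_I bdd])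
  have "K \<le> r * K" unfolding K_def by (rule cSUP_least) (use step[OF le] in \<open>auto simp: K_def\<close>)
  then have "(1 - r) * K \<le> 0" by (simp add: algebra_simps)
  then have "K \<le> 0" using r by (simp add: mult_le_0_iff)
  then show ?thesis using le[of k] by linarith
qed

declare sum.cong [fundef_cong]

text \<open>The power series coefficients of 1 / a(z), that is, the impulse response of the
  recursion with leading coefficient 1.\<close>

fun psi :: "(nat \<Rightarrow> real) \<Rightarrow> nat \<Rightarrow> real" where
  "psi a n = (if n = 0 then 1 else - (\<Sum>j<n. a (n - j) * psi a j))"

text \<open>Continues given values at 0, ..., q by the homogeneous recursion. The guard in the sum
  ensures that the recursive calls have smaller arguments.\<close>

fun rec_ext :: "nat \<Rightarrow> (nat \<Rightarrow> real) \<Rightarrow> (nat \<Rightarrow> real) \<Rightarrow> nat \<Rightarrow> real" where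
  "rec_ext q a w n = (if n \<le> q then w n else - (\<Sum>i\<in>{1..q}. a i * (if 0 < i \<and> i \<le> n then rec_ext q a w (n - i) else 0)))"

declare psi.simps [simp del] rec_ext.simps [simp del]

locale ar_coeffs =
  fixes p :: nat and \<theta> :: "real vec" and \<rho> :: real
  assumes p1: "p \<ge> 1" and theta_dim: "\<theta> \<in> carrier_vec p"
    and theta_norm: "(\<Sum>i<p. \<bar>\<theta> $ i\<bar>) < 1" and rho1: "\<bar>\<rho>\<bar> < 1"
begin

section \<open>Factorisation of the recursion and its impulse response\<close>

definition tt :: "nat \<Rightarrow> real" where
  "tt i = (if 1 \<le> i \<and> i \<le> p then \<theta> $ (i - 1) else 0)"

definition a :: "nat \<Rightarrow> real" where "a i = a_coeff p \<theta> \<rho> (int i)"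

definition c :: real where "c = \<theta> $ (p - 1) * \<rho>"

lemma a_eq: "a i = (if i = 0 then 1 else 0) - (if i = 1 then \<rho> else 0) - tt i + (if i \<ge> 1 then \<rho> * tt (i - 1) else 0)"
proof -
  consider "i = 0" | "i = 1" | "2 \<le> i \<and> i \<le> p" | "i = p + 1" | "i > p + 1" using p1 by linarith
  then show ?thesis
  proof cases
    case 3
    then have "nat (int i) - 1 = i - 1" "i - 1 - 1 = i - 2" "i - Suc (Suc 0) = i - 2" by auto
    then show ?thesis using 3 by (auto simp: a_def a_coeff_def tt_def beta_def mult.commute)
  qed (use p1 in \<open>auto simp: a_def a_coeff_def tt_def beta_def mult.commute\<close>)
qed

lemma a0 [simp]: "a 0 = 1" by (simp add: a_def a_coeff_def)

lemma a_out: "i > p + 1 \<Longrightarrow> a i = 0"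
  by (auto simp: a_def a_coeff_def)

lemma sum_tt: "(\<Sum>i\<in>{1..p}. \<bar>tt i\<bar>) = (\<Sum>i<p. \<bar>\<theta> $ i\<bar>)"
  unfolding tt_def by (rule sum.reindex_bij_witness[of _ Suc "\<lambda>i. i - 1"]) auto

lemma abs_c: "\<bar>c\<bar> < 1"
proof -
  have "\<bar>\<theta> $ (p - 1)\<bar> \<le> (\<Sum>i<p. \<bar>\<theta> $ i\<bar>)" using p1 by (intro member_le_sum) auto
  then have "\<bar>\<theta> $ (p - 1)\<bar> * \<bar>\<rho>\<bar> \<le> 1 * \<bar>\<rho>\<bar>" using theta_norm by (intro mult_right_mono) auto
  then show ?thesis using rho1 by (simp add: c_def abs_mult)
qed

definition AR :: "(int \<Rightarrow> real) \<Rightarrow> int \<Rightarrow> real" where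
  "AR x n = (\<Sum>i\<le>p+1. a i * x (n - int i))"

text \<open>The factorisation as an identity of operators. The two stability conditions concern the
  two factors separately, so statements about the recursion are proved first for x k - \<rho> x (k -
  1) and then for x.\<close>

lemma AR_factor:
  "AR x n = (x n - \<rho> * x (n - 1)) - (\<Sum>i\<in>{1..p}. tt i * (x (n - int i) - \<rho> * x (n - int i - 1)))"
proof -
  have "AR x n = (\<Sum>i\<le>p+1. (if i = 0 then x (n - int i) else 0)) - (\<Sum>i\<le>p+1. (if i = 1 then \<rho> * x (n - int i) else 0))
      - (\<Sum>i\<le>p+1. tt i * x (n - int i)) + (\<Sum>i\<le>p+1. (if i \<ge> 1 then \<rho> * tt (i - 1) * x (n - int i) else 0))"
    unfolding AR_def a_eq sum_subtractf[symmetric] sum.distrib[symmetric]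
    by (intro sum.cong) (auto simp: algebra_simps)
  also have "(\<Sum>i\<le>p+1. (if i = 0 then x (n - int i) else 0)) = x n" by simp
  also have "(\<Sum>i\<le>p+1. (if i = 1 then \<rho> * x (n - int i) else 0)) = \<rho> * x (n - 1)" by simp
  also have "(\<Sum>i\<le>p+1. tt i * x (n - int i)) = (\<Sum>i\<in>{1..p}. tt i * x (n - int i))"
    by (rule sum.mono_neutral_right) (auto simp: tt_def)
  also have "(\<Sum>i\<le>p+1. (if i \<ge> 1 then \<rho> * tt (i - 1) * x (n - int i) else 0)) = (\<Sum>i\<in>{1..p}. \<rho> * tt i * x (n - int i - 1))"
  proof -
    have "(\<Sum>i\<le>p+1. (if i \<ge> 1 then \<rho> * tt (i - 1) * x (n - int i) else 0)) = (\<Sum>i\<le>p. \<rho> * tt i * x (n - int (Suc i)))"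
      by (simp only: Suc_eq_plus1[symmetric] sum.atMost_Suc_shift) simp
    also have "\<dots> = (\<Sum>i\<in>{1..p}. \<rho> * tt i * x (n - int (Suc i)))"
      by (rule sum.mono_neutral_right) (auto simp: tt_def)
    finally show ?thesis by (simp add: algebra_simps)
  qed
  finally show ?thesis
    by (simp add: right_diff_distrib sum_subtractf sum_distrib_left mult_ac)
qed

text \<open>Extended by 0 to negative times, so that the recursion holds on all integers, with a
  unit impulse at 0.\<close>

definition xpsi :: "int \<Rightarrow> real" where "xpsi k = (if k < 0 then 0 else psi a (nat k))"

lemma psi_0 [simp]: "psi a 0 = 1" by (simp add: psi.simps)

lemma psi_conv: "(\<Sum>j\<le>n. a (n - j) * psi a j) = (if n = 0 then 1 else 0)"
proof (cases n)
  case (Suc m)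
  then have "psi a n = - (\<Sum>j<n. a (n - j) * psi a j)" by (subst psi.simps) simp
  then show ?thesis using Suc by (simp add: lessThan_Suc_atMost[symmetric])
qed simp

lemma AR_xpsi: "AR xpsi n = (if n = 0 then 1 else 0)"
proof (cases "n < 0")
  case True
  then show ?thesis by (simp add: AR_def xpsi_def)
next
  case False
  define m where "m = nat n"
  have n: "n = int m" using False by (simp add: m_def)
  have "AR xpsi n = (\<Sum>i\<in>{..p+1} \<inter> {..m}. a i * psi a (m - i))"
    unfolding AR_def sum.inter_restrict[OF finite_atMost] n xpsi_def
    by (intro sum.cong) (auto simp: nat_diff_distrib)
  also have "\<dots> = (\<Sum>i\<le>m. a i * psi a (m - i))"
    by (rule sum.mono_neutral_left) (auto simp: a_out)
  also have "\<dots> = (\<Sum>j\<le>m. a (m - j) * psi a j)"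
    by (rule sum.reindex_bij_witness[of _ "\<lambda>j. m - j" "\<lambda>j. m - j"]) auto
  finally show ?thesis by (simp add: psi_conv n)
qed

text \<open>For each factor the partial sums of absolute values satisfy S <= const + r S with r < 1.
  They are finite sums, so r S can be moved to the left before convergence is known. A delay does
  not enlarge the partial sums of a sequence that vanishes at negative times.\<close>

lemma psi_summable: "summable (\<lambda>n. \<bar>psi a n\<bar>)"
proof -
  define m where "m k = xpsi k - \<rho> * xpsi (k - 1)" for k
  have m_rec: "m k = (if k = 0 then 1 else 0) + (\<Sum>i\<in>{1..p}. tt i * m (k - int i))" for k
    using AR_factor[of xpsi k] AR_xpsi[of k] by (simp add: m_def)
  have m_neg: "m k = 0" if "k < 0" for k using that by (simp add: m_def xpsi_def)
  define r where "r = (\<Sum>i<p. \<bar>\<theta> $ i\<bar>)"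
  have r: "r < 1" "(\<Sum>i\<in>{1..p}. \<bar>tt i\<bar>) = r" using theta_norm by (simp_all only: r_def sum_tt)
  have shift: "(\<Sum>n<N. \<bar>f (int n - int i)\<bar>) \<le> (\<Sum>n<N. \<bar>f (int n)\<bar>)" if "\<And>k. k < 0 \<Longrightarrow> f k = 0"
    for f :: "int \<Rightarrow> real" and i N
  proof -
    have "(\<Sum>n<N. \<bar>f (int n - int i)\<bar>) = (\<Sum>n\<in>{i..<N}. \<bar>f (int n - int i)\<bar>)"
      using that by (intro sum.mono_neutral_right) auto
    also have "\<dots> = (\<Sum>n<N - i. \<bar>f (int n)\<bar>)"
      by (rule sum.reindex_bij_witness[of _ "\<lambda>n. n + i" "\<lambda>n. n - i"]) auto
    also have "\<dots> \<le> (\<Sum>n<N. \<bar>f (int n)\<bar>)" by (intro sum_mono2) auto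
    finally show ?thesis .
  qed
  define A where "A = 1 / (1 - r)"
  have Sm: "(\<Sum>n<N. \<bar>m (int n)\<bar>) \<le> A" for N
  proof -
    have "(\<Sum>n<N. \<bar>m (int n)\<bar>) \<le> (\<Sum>n<N. (if n = 0 then 1 else 0) + (\<Sum>i\<in>{1..p}. \<bar>tt i\<bar> * \<bar>m (int n - int i)\<bar>))"
    proof (rule sum_mono)
      fix n
      have "\<bar>\<Sum>i\<in>{1..p}. tt i * m (int n - int i)\<bar> \<le> (\<Sum>i\<in>{1..p}. \<bar>tt i\<bar> * \<bar>m (int n - int i)\<bar>)"
        by (rule order_trans[OF sum_abs]) (simp add: abs_mult)
      then show "\<bar>m (int n)\<bar> \<le> (if n = 0 then 1 else 0) + (\<Sum>i\<in>{1..p}. \<bar>tt i\<bar> * \<bar>m (int n - int i)\<bar>)"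
        by (subst m_rec) auto
    qed
    also have "\<dots> = (\<Sum>n<N. if n = 0 then 1 else 0) + (\<Sum>i\<in>{1..p}. \<bar>tt i\<bar> * (\<Sum>n<N. \<bar>m (int n - int i)\<bar>))"
      by (simp add: sum.distrib sum_distrib_left) (rule sum.swap)
    also have "\<dots> \<le> 1 + (\<Sum>i\<in>{1..p}. \<bar>tt i\<bar> * (\<Sum>n<N. \<bar>m (int n)\<bar>))"
      by (intro add_mono sum_mono mult_left_mono shift m_neg) auto
    also have "\<dots> = 1 + r * (\<Sum>n<N. \<bar>m (int n)\<bar>)" by (simp add: r(2)[symmetric] sum_distrib_right)
    finally show ?thesis using r(1) by (simp add: A_def field_simps)
  qed
  have "(\<Sum>n<N. \<bar>xpsi (int n)\<bar>) \<le> A / (1 - \<bar>\<rho>\<bar>)" for N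
  proof -
    have "(\<Sum>n<N. \<bar>xpsi (int n)\<bar>) \<le> (\<Sum>n<N. \<bar>m (int n)\<bar> + \<bar>\<rho>\<bar> * \<bar>xpsi (int n - int 1)\<bar>)"
    proof (rule sum_mono)
      fix n
      have "xpsi (int n) = m (int n) + \<rho> * xpsi (int n - int 1)" by (simp add: m_def)
      then show "\<bar>xpsi (int n)\<bar> \<le> \<bar>m (int n)\<bar> + \<bar>\<rho>\<bar> * \<bar>xpsi (int n - int 1)\<bar>"
        using abs_triangle_ineq[of "m (int n)" "\<rho> * xpsi (int n - int 1)"] by (simp add: abs_mult)
    qed
    also have "\<dots> = (\<Sum>n<N. \<bar>m (int n)\<bar>) + \<bar>\<rho>\<bar> * (\<Sum>n<N. \<bar>xpsi (int n - int 1)\<bar>)"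
      by (simp add: sum.distrib sum_distrib_left)
    also have "\<dots> \<le> A + \<bar>\<rho>\<bar> * (\<Sum>n<N. \<bar>xpsi (int n)\<bar>)"
      by (intro add_mono Sm mult_left_mono shift) (auto simp: xpsi_def)
    finally show ?thesis using rho1 by (simp add: pos_le_divide_eq algebra_simps)
  qed
  from this[of "Suc _"] have "(\<Sum>n\<le>N. \<bar>psi a n\<bar>) \<le> A / (1 - \<bar>\<rho>\<bar>)" for N
    by (simp only: lessThan_Suc_atMost xpsi_def) simp
  then show ?thesis by (intro bounded_imp_summable) auto
qed

lemma psi_prod_summable: "summable (\<lambda>j. psi a (j + h) * psi a (j + k))"
proof -
  have "(\<lambda>n. \<bar>psi a n\<bar>) \<longlonglongrightarrow> 0" by (rule summable_LIMSEQ_zero[OF psi_summable])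
  then have "Bseq (\<lambda>n. \<bar>psi a n\<bar>)" by (rule convergent_imp_Bseq[OF convergentI])
  then obtain K where K: "\<And>n. \<bar>psi a n\<bar> \<le> K" by (auto simp: Bseq_def)
  have "summable (\<lambda>j. K * \<bar>psi a (j + k)\<bar>)"
    using summable_ignore_initial_segment[OF psi_summable, of k] by (rule summable_mult)
  then show ?thesis
    by (rule summable_comparison_test') (auto simp: abs_mult intro!: mult_right_mono K)
qed

text \<open>The autocovariances of the stationary solution driven by white noise of variance 1.\<close>

definition l :: "nat \<Rightarrow> real" where "l h = (\<Sum>j. psi a j * psi a (j + h))"

lemma xpsi_sums:
  fixes i j :: nat
  shows "(\<lambda>k. xpsi (int k - int i) * xpsi (int k - int j)) sums l (nat \<bar>int i - int j\<bar>)"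
proof -
  have main: "(\<lambda>k. xpsi (int k - int i) * xpsi (int k - int j)) sums l (i - j)" if "j \<le> i" for i j
  proof -
    have "(\<lambda>k. psi a k * psi a (k + (i - j))) sums l (i - j)"
      unfolding l_def using psi_prod_summable[of 0 "i - j"] by (simp add: summable_sums)
    moreover have "xpsi (int (k + i) - int i) * xpsi (int (k + i) - int j) = psi a k * psi a (k + (i - j))" for k
    proof -
      have "nat (int k + int i - int j) = k + (i - j)" "\<not> int k + int i < int j" using that by auto
      then show ?thesis by (simp add: xpsi_def)
    qed
    ultimately have "(\<lambda>k. xpsi (int (k + i) - int i) * xpsi (int (k + i) - int j)) sums l (i - j)" by simp
    then have "(\<lambda>k. xpsi (int k - int i) * xpsi (int k - int j)) sums (l (i - j) + (\<Sum>k<i. xpsi (int k - int i) * xpsi (int k - int j)))"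
      by (subst (asm) sums_iff_shift) 
    moreover have "(\<Sum>k<i. xpsi (int k - int i) * xpsi (int k - int j)) = 0"
      by (intro sum.neutral) (auto simp: xpsi_def)
    ultimately show ?thesis by simp
  qed
  show ?thesis
  proof (cases "j \<le> i")
    case True
    then show ?thesis using main[of j i] by (simp add: nat_diff_distrib' of_nat_diff[symmetric] del: of_nat_diff)
  next
    case False
    then have "nat \<bar>int i - int j\<bar> = j - i" by auto
    then show ?thesis using main[of i j] False by (simp add: mult.commute)
  qed
qed

text \<open>The Yule-Walker equations of order p + 1: applying the recursion to one factor leaves
  the unit impulse at time 0, where the other factor is xpsi (- d).\<close>

lemma l_AR: "(\<Sum>i\<le>p+1. a i * l (nat \<bar>int d - int i\<bar>)) = (if d = 0 then 1 else 0)"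
proof -
  have "(\<lambda>k. \<Sum>i\<le>p+1. a i * (xpsi (int k - int i) * xpsi (int k - int d))) sums (\<Sum>i\<le>p+1. a i * l (nat \<bar>int d - int i\<bar>))"
    using xpsi_sums by (intro sums_sum sums_mult) (simp add: abs_minus_commute)
  moreover have "(\<Sum>i\<le>p+1. a i * (xpsi (int k - int i) * xpsi (int k - int d))) = (if k = 0 then (if d = 0 then 1 else 0) else 0)" for k
  proof -
    have "(\<Sum>i\<le>p+1. a i * (xpsi (int k - int i) * xpsi (int k - int d))) = AR xpsi (int k) * xpsi (int k - int d)"
      unfolding AR_def by (simp only: sum_distrib_right mult.assoc)
    then show ?thesis unfolding AR_xpsi by (auto simp: xpsi_def)
  qed
  ultimately have "(\<lambda>k. if k = 0 then (if d = 0 then 1 else 0) else 0) sums (\<Sum>i\<le>p+1. a i * l (nat \<bar>int d - int i\<bar>))"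
    by simp
  moreover have "(\<lambda>k. if k = 0 then (if d = 0 then 1 else 0) else (0::real)) sums (if d = 0 then 1 else 0)"
    using sums_single[of 0 "\<lambda>_. if d = 0 then 1 else (0::real)"] by simp
  ultimately show ?thesis by (rule sums_unique2)
qed

text \<open>The impulse response of the x-combination of q consecutive lags, so that its square sum is a
  quadratic form of the Toeplitz matrix of \<open>l\<close>.\<close>

definition G :: "nat \<Rightarrow> (nat \<Rightarrow> real) \<Rightarrow> nat \<Rightarrow> real" where
  "G q x k = (\<Sum>i<q. x i * xpsi (int k - int i))"

lemma G_sums: "(\<lambda>k. (G q x k)\<^sup>2) sums (\<Sum>i<q. \<Sum>j<q. x i * x j * l (nat \<bar>int i - int j\<bar>))"
proof -
  have "(\<lambda>k. \<Sum>i<q. \<Sum>j<q. x i * x j * (xpsi (int k - int i) * xpsi (int k - int j)))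
      sums (\<Sum>i<q. \<Sum>j<q. x i * x j * l (nat \<bar>int i - int j\<bar>))"
    by (intro sums_sum sums_mult xpsi_sums)
  moreover have "(G q x k)\<^sup>2 = (\<Sum>i<q. \<Sum>j<q. x i * x j * (xpsi (int k - int i) * xpsi (int k - int j)))" for k
    unfolding G_def power2_eq_square sum_product by (simp add: mult_ac)
  ultimately show ?thesis by simp
qed

lemma toeplitz_psd: "0 \<le> (\<Sum>i<q. \<Sum>j<q. x i * x j * l (nat \<bar>int i - int j\<bar>))"
  by (rule sums_le[OF _ sums_zero G_sums]) simp

text \<open>At the first index k with x k nonzero the combined impulse response equals x k, because
  psi a 0 = 1; one positive term makes the sum of squares positive.\<close>

lemma toeplitz_pd:
  assumes "i < q" "x i \<noteq> 0" shows "0 < (\<Sum>i<q. \<Sum>j<q. x i * x j * l (nat \<bar>int i - int j\<bar>))"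
proof -
  define k where "k = (LEAST i. x i \<noteq> 0)"
  have k: "x k \<noteq> 0" "k \<le> i" "\<And>j. j < k \<Longrightarrow> x j = 0"
    unfolding k_def using LeastI[of "\<lambda>i. x i \<noteq> 0", OF assms(2)] Least_le[of "\<lambda>i. x i \<noteq> 0", OF assms(2)]
    by (auto dest: not_less_Least)
  have "G q x k = (\<Sum>j<q. if j = k then x k else 0)"
    unfolding G_def using k(3) by (intro sum.cong) (auto simp: xpsi_def not_less_iff_gr_or_eq linorder_neq_iff)
  then have "G q x k = x k" using k(2) assms(1) by simp
  then have "0 < (G q x k)\<^sup>2" using k(1) by simp
  moreover have "(G q x k)\<^sup>2 \<le> (\<Sum>k. (G q x k)\<^sup>2)"
    using sum_le_suminf[of "\<lambda>k. (G q x k)\<^sup>2" "{k}"] G_sums[of q x] by (auto simp: sums_iff)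
  moreover have "(\<Sum>k. (G q x k)\<^sup>2) = (\<Sum>i<q. \<Sum>j<q. x i * x j * l (nat \<bar>int i - int j\<bar>))"
    using sums_unique[OF G_sums] by simp
  ultimately show ?thesis by linarith
qed

text \<open>The matrix B is the recursion acting on an even sequence: column j > 0 collects the lags
  j and -j, while column 0 counts lag 0 once.\<close>

lemma B_mat_mult:
  fixes f :: "nat \<Rightarrow> real"
  assumes d: "d < p + 2"
  shows "(B_mat p \<theta> \<rho> *\<^sub>v vec (p + 2) f) $ d = (\<Sum>i\<le>p+1. a i * f (nat \<bar>int d - int i\<bar>))"
proof -
  let ?A = "a_coeff p \<theta> \<rho>"
  have A0: "?A k = 0" if "k < 0 \<or> k > int p + 1" for k using that by (auto simp: a_coeff_def)
  have "(B_mat p \<theta> \<rho> *\<^sub>v vec (p + 2) f) $ d = (\<Sum>j<p+2. B_mat p \<theta> \<rho> $$ (d, j) * f j)"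
    using d by (simp add: B_mat_def scalar_prod_def atLeast0LessThan)
  also have "\<dots> = (\<Sum>j<p+2. if j = 0 then a d * f 0 else ?A (int d - int j) * f j + ?A (int d + int j) * f j)"
    using d by (intro sum.cong) (auto simp: B_mat_def a_def distrib_right)
  also have "\<dots> = a d * f 0 + ((\<Sum>j\<in>{1..p+1}. ?A (int d - int j) * f j) + (\<Sum>j\<in>{1..p+1}. ?A (int d + int j) * f j))"
  proof -
    have "{..<p+2} = insert 0 {1..p+1}" by auto
    then show ?thesis by (simp add: sum.distrib)
  qed
  also have "(\<Sum>j\<in>{1..p+1}. ?A (int d - int j) * f j) = (\<Sum>j\<in>{1..d}. ?A (int d - int j) * f j)"
    using d A0 by (intro sum.mono_neutral_right) auto
  also have "\<dots> = (\<Sum>i<d. a i * f (nat \<bar>int d - int i\<bar>))"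
  proof (rule sum.reindex_bij_witness[of _ "\<lambda>i. d - i" "\<lambda>j. d - j"])
    fix j assume "j \<in> {1..d}"
    then have "int (d - j) = int d - int j" "nat \<bar>int d - int (d - j)\<bar> = j" by auto
    then show "a (d - j) * f (nat \<bar>int d - int (d - j)\<bar>) = ?A (int d - int j) * f j"
      by (simp add: a_def)
  qed auto
  also have "(\<Sum>j\<in>{1..p+1}. ?A (int d + int j) * f j) = (\<Sum>j\<in>{1..p+1-d}. ?A (int d + int j) * f j)"
    using A0 by (intro sum.mono_neutral_right) auto
  also have "\<dots> = (\<Sum>i\<in>{d<..p+1}. a i * f (nat \<bar>int d - int i\<bar>))"
    by (rule sum.reindex_bij_witness[of _ "\<lambda>i. i - d" "\<lambda>j. d + j"]) (auto simp: a_def)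
  also have "a d * f 0 + ((\<Sum>i<d. a i * f (nat \<bar>int d - int i\<bar>)) + (\<Sum>i\<in>{d<..p+1}. a i * f (nat \<bar>int d - int i\<bar>)))
      = (\<Sum>i\<le>p+1. a i * f (nat \<bar>int d - int i\<bar>))"
  proof -
    have e: "{..p+1} = insert d ({..<d} \<union> {d<..p+1})" using d by auto
    show ?thesis unfolding e by (subst sum.insert, simp, simp, subst sum.union_disjoint) auto
  qed
  finally show ?thesis .
qed

text \<open>Contraction twice, with constant the 1-norm of \<theta> for the filtered sequence and
  then |\<rho>| for the sequence itself. Two-sided boundedness supplies the finite suprema.\<close>

lemma AR_kernel_trivial:
  fixes L :: "int \<Rightarrow> real"
  assumes zero: "\<And>n. AR L n = 0" and bd: "\<And>k. \<bar>L k\<bar> \<le> C"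
  shows "L k = 0"
proof -
  define m where "m k = L k - \<rho> * L (k - 1)" for k
  have m_rec: "m k = (\<Sum>i\<in>{1..p}. tt i * m (k - int i))" for k
    using AR_factor[of L k] zero[of k] by (simp add: m_def)
  have "\<bar>\<rho> * L (k - 1)\<bar> \<le> \<bar>C\<bar>" for k
    using mult_mono[of "\<bar>\<rho>\<bar>" 1 "\<bar>L (k - 1)\<bar>" "\<bar>C\<bar>"] bd[of "k - 1"] rho1 by (simp add: abs_mult)
  then have mb: "\<bar>m k\<bar> \<le> C + \<bar>C\<bar>" for k
    unfolding m_def using bd[of k] abs_triangle_ineq4[of "L k" "\<rho> * L (k - 1)"] by (meson add_mono order_trans)
  have m0: "m k = 0" for k
  proof (rule contraction_zero[OF mb theta_norm])
    fix K k assume K: "\<And>j. \<bar>m j\<bar> \<le> K"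
    have "\<bar>m k\<bar> \<le> (\<Sum>i\<in>{1..p}. \<bar>tt i\<bar> * \<bar>m (k - int i)\<bar>)"
      by (subst m_rec) (rule order_trans[OF sum_abs], simp add: abs_mult)
    also have "\<dots> \<le> (\<Sum>i\<in>{1..p}. \<bar>tt i\<bar> * K)" by (intro sum_mono mult_left_mono K) auto
    finally show "\<bar>m k\<bar> \<le> (\<Sum>i<p. \<bar>\<theta> $ i\<bar>) * K" by (simp add: sum_tt[symmetric] sum_distrib_right)
  qed
  show ?thesis
  proof (rule contraction_zero[OF bd rho1])
    fix K k assume K: "\<And>j. \<bar>L j\<bar> \<le> K"
    have "L k = \<rho> * L (k - 1)" using m0[of k] by (simp add: m_def)
    then show "\<bar>L k\<bar> \<le> \<bar>\<rho>\<bar> * K" using K[of "k - 1"] by (simp add: abs_mult mult_left_mono)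
  qed
qed

(* A kernel vector extends to an even sequence L, and AR L vanishes on the nonnegative integers.
   Convolving with the reversed coefficients gives an even sequence again, which is therefore 0. *)
lemma B_mat_inj:
  assumes w: "w \<in> carrier_vec (p + 2)" and zero: "B_mat p \<theta> \<rho> *\<^sub>v w = 0\<^sub>v (p + 2)"
  shows "w = 0\<^sub>v (p + 2)"
proof -
  define e where "e = rec_ext (p + 1) a (\<lambda>i. w $ i)"
  have e_lo: "e n = w $ n" if "n \<le> p + 1" for n using that by (simp add: e_def rec_ext.simps)
  have e_hi: "e n = - (\<Sum>i\<in>{1..p+1}. a i * e (n - i))" if "n > p + 1" for n
    using that unfolding e_def by (subst rec_ext.simps) (auto intro!: sum.cong)
  define L where "L k = e (nat \<bar>k\<bar>)" for k
  have Lsym: "L (- k) = L k" for k by (simp add: L_def)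
  have AR0: "AR L n = 0" if "n \<ge> 0" for n
  proof -
    define d where "d = nat n"
    have n: "n = int d" using that by (simp add: d_def)
    show ?thesis
    proof (cases "d \<le> p + 1")
      case True
      have "vec (p + 2) e = w" using w e_lo by (auto simp: vec_eq_iff)
      then have "(\<Sum>i\<le>p+1. a i * e (nat \<bar>int d - int i\<bar>)) = 0"
        using B_mat_mult[of d e] zero True by simp
      then show ?thesis by (simp add: AR_def L_def n)
    next
      case False
      have "{..p+1} = insert 0 {1..p+1}" by auto
      then have "AR L n = e d + (\<Sum>i\<in>{1..p+1}. a i * L (n - int i))"
        by (simp add: AR_def L_def n)
      also have "(\<Sum>i\<in>{1..p+1}. a i * L (n - int i)) = (\<Sum>i\<in>{1..p+1}. a i * e (d - i))"
      proof (intro sum.cong refl arg_cong2[where f="(*)"])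
        fix i assume "i \<in> {1..p+1}"
        then have "nat \<bar>int d - int i\<bar> = d - i" using False by auto
        then show "L (n - int i) = e (d - i)" by (simp only: L_def n)
      qed
      finally show ?thesis using e_hi[of d] False by simp
    qed
  qed
  define m where "m k = L k - \<rho> * L (k - 1)" for k
  have m_rec: "m k = (\<Sum>i\<in>{1..p}. tt i * m (k - int i))" if "k \<ge> 0" for k
    using AR_factor[of L k] AR0[OF that] by (simp add: m_def)
  \<comment> \<open>The recursion for \<open>m\<close> is available from time 0 on; the p values
    before it start the induction.\<close>
  define Cm where "Cm = (\<Sum>k\<in>{- int p..-1}. \<bar>m k\<bar>)"
  have Cm0: "Cm \<ge> 0" unfolding Cm_def by (intro sum_nonneg) auto
  have mb: "\<bar>m k\<bar> \<le> Cm" if "k \<ge> - int p" for k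
    using that
  proof (induction "nat (k + int p)" arbitrary: k rule: less_induct)
    case less
    show ?case
    proof (cases "k < 0")
      case True
      then show ?thesis unfolding Cm_def using less.prems by (intro member_le_sum) auto
    next
      case False
      have "\<bar>m k\<bar> \<le> (\<Sum>i\<in>{1..p}. \<bar>tt i\<bar> * \<bar>m (k - int i)\<bar>)"
        using False by (subst m_rec) (simp, rule order_trans[OF sum_abs], simp add: abs_mult)
      also have "\<dots> \<le> (\<Sum>i\<in>{1..p}. \<bar>tt i\<bar> * Cm)"
        using False by (intro sum_mono mult_left_mono less) auto
      also have "\<dots> = (\<Sum>i<p. \<bar>\<theta> $ i\<bar>) * Cm" by (simp add: sum_tt[symmetric] sum_distrib_right)
      also have "\<dots> \<le> 1 * Cm" using theta_norm Cm0 by (intro mult_right_mono) auto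
      finally show ?thesis by simp
    qed
  qed
  \<comment> \<open>Chosen so that Cm + |\<rho>| * C <= C, which carries the bound from n to n +
    1.\<close>
  define C where "C = \<bar>L 0\<bar> + Cm / (1 - \<bar>\<rho>\<bar>)"
  have Lb: "\<bar>L (int n)\<bar> \<le> C" for n
  proof (induction n)
    case 0
    show ?case unfolding C_def using Cm0 rho1 by simp
  next
    case (Suc n)
    have "L (int (Suc n)) = m (int (Suc n)) + \<rho> * L (int n)" by (simp add: m_def)
    then have "\<bar>L (int (Suc n))\<bar> \<le> \<bar>m (int (Suc n))\<bar> + \<bar>\<rho>\<bar> * \<bar>L (int n)\<bar>"
      using abs_triangle_ineq[of "m (int (Suc n))" "\<rho> * L (int n)"] by (simp add: abs_mult)
    also have "\<dots> \<le> Cm + \<bar>\<rho>\<bar> * C" by (intro add_mono mult_left_mono mb Suc) auto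
    also have "\<dots> \<le> C"
    proof -
      have "(1 - \<bar>\<rho>\<bar>) * C = (1 - \<bar>\<rho>\<bar>) * \<bar>L 0\<bar> + Cm" using rho1 by (simp add: C_def distrib_left)
      moreover have "0 \<le> (1 - \<bar>\<rho>\<bar>) * \<bar>L 0\<bar>" using rho1 by simp
      ultimately show ?thesis by (simp add: algebra_simps)
    qed
    finally show ?case .
  qed
  have Lb': "\<bar>L k\<bar> \<le> C" for k
  proof -
    have "L k = L (int (nat \<bar>k\<bar>))" by (simp add: L_def)
    then show ?thesis using Lb[of "nat \<bar>k\<bar>"] by simp
  qed
  define h where "h d = (\<Sum>j\<le>p+1. a j * AR L (d + int j))" for d
  have h_eq: "h d = (\<Sum>j\<le>p+1. \<Sum>i\<le>p+1. a j * a i * L (d + int j - int i))" for d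
    unfolding h_def AR_def by (simp only: sum_distrib_left mult.assoc)
  have h_sym: "h (- d) = h d" for d
  proof -
    have "h (- d) = (\<Sum>j\<le>p+1. \<Sum>i\<le>p+1. a j * a i * L (d + int i - int j))"
      unfolding h_eq
    proof (intro sum.cong refl arg_cong2[where f="(*)"])
      fix i j
      show "L (- d + int j - int i) = L (d + int i - int j)"
        using Lsym[of "d + int i - int j"] by (simp add: algebra_simps)
    qed
    also have "\<dots> = (\<Sum>i\<le>p+1. \<Sum>j\<le>p+1. a j * a i * L (d + int i - int j))" by (rule sum.swap)
    also have "\<dots> = h d" unfolding h_eq by (simp add: mult.commute)
    finally show ?thesis .
  qed
  have h_pos: "h d = 0" if "d \<ge> 0" for d
    unfolding h_def using AR0 that by (intro sum.neutral) simp
  have h0: "h d = 0" for d using h_pos[of d] h_pos[of "- d"] h_sym[of d] by (cases "d \<ge> 0") auto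
  \<comment> \<open>Because a 0 = 1, the equation h (- n) = 0 expresses AR L at - n by its values at
    later times, which vanish by induction or by \<open>AR0\<close>.\<close>
  have ARneg: "AR L (- int n) = 0" for n
  proof (induction n rule: less_induct)
    case (less n)
    have "{..p+1} = insert 0 {1..p+1}" by auto
    then have "h (- int n) = AR L (- int n) + (\<Sum>j\<in>{1..p+1}. a j * AR L (- int n + int j))"
      by (simp add: h_def)
    moreover have "(\<Sum>j\<in>{1..p+1}. a j * AR L (- int n + int j)) = 0"
    proof (intro sum.neutral ballI)
      fix j assume j: "j \<in> {1..p+1}"
      show "a j * AR L (- int n + int j) = 0"
      proof (cases "j \<le> n")
        case True
        then have "- int n + int j = - int (n - j)" by auto
        then show ?thesis using less.IH[of "n - j"] j True by simp
      qed (use AR0 in auto)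
    qed
    ultimately show ?case using h0 by simp
  qed
  have "AR L n = 0" for n
    using AR0[of n] ARneg[of "nat (- n)"] by (cases "n \<ge> 0") auto
  then have "L k = 0" for k by (rule AR_kernel_trivial[OF _ Lb'])
  then have "L (int n) = 0" for n .
  then have "e n = 0" for n by (simp add: L_def)
  then show ?thesis using w e_lo by (auto simp: vec_eq_iff)
qed

section \<open>Lambda as the autocovariances of the stationary solution\<close>

lemma B_dim: "B_mat p \<theta> \<rho> \<in> carrier_mat (p + 2) (p + 2)" by (simp add: B_mat_def)

lemma Lambda_eq: "Lambda p \<theta> \<rho> = vec (p + 2) l"
  unfolding Lambda_def
proof (rule the_equality)
  have "B_mat p \<theta> \<rho> *\<^sub>v vec (p + 2) l = unit_vec (p + 2) 0"
  proof (rule eq_vecI)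
    fix i assume "i < dim_vec (unit_vec (p + 2) 0 :: real vec)"
    then have i: "i < p + 2" by simp
    show "(B_mat p \<theta> \<rho> *\<^sub>v vec (p + 2) l) $ i = unit_vec (p + 2) 0 $ i"
      unfolding B_mat_mult[OF i] l_AR using i by (simp add: unit_vec_def)
  qed (simp add: B_mat_def)
  then show *: "vec (p + 2) l \<in> carrier_vec (p + 2) \<and> B_mat p \<theta> \<rho> *\<^sub>v vec (p + 2) l = unit_vec (p + 2) 0"
    by simp
  fix w assume w: "w \<in> carrier_vec (p + 2) \<and> B_mat p \<theta> \<rho> *\<^sub>v w = unit_vec (p + 2) 0"
  have "B_mat p \<theta> \<rho> *\<^sub>v (w - vec (p + 2) l)
      = B_mat p \<theta> \<rho> *\<^sub>v w - B_mat p \<theta> \<rho> *\<^sub>v vec (p + 2) l"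
    by (rule mult_minus_distrib_mat_vec[OF B_dim]) (use w in simp_all)
  also have "\<dots> = unit_vec (p + 2) 0 - unit_vec (p + 2) 0"
    by (simp only: conjunct2[OF w] conjunct2[OF *])
  also have "\<dots> = 0\<^sub>v (p + 2)" by (rule eq_vecI) simp_all
  finally have "B_mat p \<theta> \<rho> *\<^sub>v (w - vec (p + 2) l) = 0\<^sub>v (p + 2)" .
  then have z: "w - vec (p + 2) l = 0\<^sub>v (p + 2)" by (rule B_mat_inj[rotated]) (use w in simp)
  show "w = vec (p + 2) l"
  proof (rule eq_vecI)
    fix i assume "i < dim_vec (vec (p + 2) l)"
    then have i: "i < p + 2" by simp
    have "(w - vec (p + 2) l) $ i = 0" unfolding z using i by simp
    then show "w $ i = vec (p + 2) l $ i" using i by simp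
  qed (use w in simp)
qed

end

section \<open>The limit quantities\<close>

text \<open>Injectivity makes the determinant nonzero, so \<open>mat_inverse\<close> returns a
  matrix and \<open>mat_inv\<close> is the genuine inverse.\<close>

lemma mat_inv_inverse:
  assumes A: "A \<in> carrier_mat n n"
    and inj: "\<And>v. v \<in> carrier_vec n \<Longrightarrow> A *\<^sub>v v = 0\<^sub>v n \<Longrightarrow> v = 0\<^sub>v n"
  shows "mat_inv A \<in> carrier_mat n n" "A * mat_inv A = 1\<^sub>m n" "mat_inv A * A = 1\<^sub>m n" "det A \<noteq> 0"
proof -
  show det: "det A \<noteq> 0" using det_0_iff_vec_prod_zero[OF A] inj by blast
  then have "A \<in> Units (ring_mat TYPE(real) n undefined)" by (rule det_non_zero_imp_unit[OF A])
  then obtain B where B: "mat_inverse A = Some B"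
    using mat_inverse(1)[OF A, of undefined] by (cases "mat_inverse A") auto
  then have "mat_inv A = B" by (simp add: mat_inv_def)
  then show "mat_inv A \<in> carrier_mat n n" "A * mat_inv A = 1\<^sub>m n" "mat_inv A * A = 1\<^sub>m n"
    using mat_inverse(2)[OF A B] by auto
qed

lemma mat_mult_index_sum:
  assumes "A \<in> carrier_mat n m" "B \<in> carrier_mat m q" "i < n" "j < q"
  shows "(A * B) $$ (i, j) = (\<Sum>k<m. A $$ (i, k) * B $$ (k, j))"
  using assms by (simp add: scalar_prod_def atLeast0LessThan)

lemma mat_vec_index_sum:
  assumes "A \<in> carrier_mat n m" "v \<in> carrier_vec m" "i < n"
  shows "(A *\<^sub>v v) $ i = (\<Sum>k<m. A $$ (i, k) * v $ k)"
  using assms by (simp add: scalar_prod_def atLeast0LessThan)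

lemma sum_flip: "(\<Sum>j<p. f (p - 1 - j)) = (\<Sum>j<(p::nat). f j)"
  by (rule sum.reindex_bij_witness[of _ "\<lambda>j. p - 1 - j" "\<lambda>j. p - 1 - j"]) auto

context ar_coeffs
begin

definition al :: real where "al = alpha p \<theta> \<rho>"
definition bet :: "nat \<Rightarrow> real" where "bet i = beta p \<theta> \<rho> $ i"
definition b :: "nat \<Rightarrow> real" where "b i = theta_star p \<theta> \<rho> $ i"
definition D :: "nat \<Rightarrow> nat \<Rightarrow> real" where "D i j = mat_inv (Delta_mat p \<theta> \<rho> p) $$ (i, j)"

lemma c2: "1 - c\<^sup>2 > 0"
  using abs_c by (simp add: abs_square_less_1)

lemma al_eq: "al = 1 / (1 - c\<^sup>2)"
  by (simp add: al_def alpha_def c_def power2_eq_square algebra_simps)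

lemma al_pos: "al > 0" using c2 by (simp add: al_eq)

lemma al_mult: "al * (1 - c\<^sup>2) = 1" using c2 by (simp add: al_eq)

lemma IJ_dim: "IJ_mat p \<theta> \<rho> \<in> carrier_mat p p"
  by (auto simp: IJ_mat_def exchange_mat_def)

lemma IJ_index: "i < p \<Longrightarrow> j < p \<Longrightarrow> IJ_mat p \<theta> \<rho> $$ (i, j) = (if j = i then 1 else 0) - (if j = p - 1 - i then c else 0)"
  by (auto simp: IJ_mat_def exchange_mat_def c_def)

lemma sum_IJ:
  assumes "i < p" shows "(\<Sum>j<p. IJ_mat p \<theta> \<rho> $$ (i, j) * f j) = f i - c * f (p - 1 - i)"
proof -
  have "(\<Sum>j<p. IJ_mat p \<theta> \<rho> $$ (i, j) * f j) = (\<Sum>j<p. (if j = i then f i else 0) - (if j = p - 1 - i then c * f (p - 1 - i) else 0))"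
    using assms by (intro sum.cong) (auto simp: IJ_index algebra_simps)
  then show ?thesis using assms by (simp add: sum_subtractf)
qed

lemma beta_dim: "beta p \<theta> \<rho> \<in> carrier_vec p" by (simp add: beta_def)

lemma theta_star_dim: "theta_star p \<theta> \<rho> \<in> carrier_vec p"
  unfolding theta_star_def by (rule mult_mat_vec_carrier[OF _ beta_dim]) (use IJ_dim in simp)

lemma b_eq: assumes "i < p" shows "b i = al * (bet i - c * bet (p - 1 - i))"
proof -
  have "b i = (\<Sum>j<p. (al \<cdot>\<^sub>m IJ_mat p \<theta> \<rho>) $$ (i, j) * beta p \<theta> \<rho> $ j)"
    unfolding b_def theta_star_def al_def[symmetric] using IJ_dim beta_dim assms
    by (subst mat_vec_index_sum[of _ p p]) auto
  also have "\<dots> = al * (\<Sum>j<p. IJ_mat p \<theta> \<rho> $$ (i, j) * bet j)"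
    unfolding sum_distrib_left using IJ_dim assms by (intro sum.cong) (auto simp: bet_def)
  finally show ?thesis using sum_IJ[OF assms] by simp
qed

text \<open>With J the reversal of indices, the hypothesis reads (I + c J) y = z. As J is an
  involution, the inverse of I + c J is al (I - c J).\<close>

lemma flip_solve:
  assumes y: "\<And>i. i < p \<Longrightarrow> y i + c * y (p - 1 - i) = z i" and i: "i < p"
  shows "y i = al * (z i - c * z (p - 1 - i))"
proof -
  define k where "k = p - 1 - i"
  have k: "k < p" "p - 1 - k = i" using i by (auto simp: k_def)
  have e: "y i + c * y k = z i" "y k + c * y i = z k"
    using y[OF i] y[OF k(1)] by (simp_all only: k(2) k_def[symmetric])
  have "al * (z i - c * z k) = y i * (al * (1 - c\<^sup>2))"
    unfolding e[symmetric] by (simp add: algebra_simps power2_eq_square)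
  then show ?thesis unfolding k_def[symmetric] by (simp only: al_mult mult_1_right)
qed

text \<open>The Levinson-Durbin relation between the coefficients of orders p and p + 1, obtained by
  inverting the definition of \<open>theta_star\<close>.\<close>

lemma bet_eq: assumes "i < p" shows "bet i = b i + c * b (p - 1 - i)"
proof -
  define k where "k = p - 1 - i"
  have k: "k < p" "p - 1 - k = i" using assms by (auto simp: k_def)
  have e: "b i = al * (bet i - c * bet k)" "b k = al * (bet k - c * bet i)"
    using b_eq[OF assms] b_eq[OF k(1)] by (simp_all only: k(2) k_def[symmetric])
  have "b i + c * b k = bet i * (al * (1 - c\<^sup>2))"
    unfolding e by (simp add: algebra_simps power2_eq_square)
  then show ?thesis unfolding k_def[symmetric] by (simp only: al_mult mult_1_right)
qed

lemma a_sum: "(\<Sum>i\<le>p+1. a i * f i) = f 0 - (\<Sum>j<p. bet j * f (j + 1)) + c * f (p + 1)"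
proof -
  have "(\<Sum>i\<le>Suc p. a i * f i) = a 0 * f 0 + (\<Sum>i\<le>p. a (Suc i) * f (Suc i))"
    by (rule sum.atMost_Suc_shift)
  moreover have "(\<Sum>i\<le>p. a (Suc i) * f (Suc i)) = (\<Sum>j<p. a (Suc j) * f (Suc j)) + a (Suc p) * f (Suc p)"
    by (simp only: lessThan_Suc_atMost[symmetric] sum.lessThan_Suc)
  moreover have "(\<Sum>j<p. a (Suc j) * f (Suc j)) = - (\<Sum>j<p. bet j * f (j + 1))"
  proof -
    have "nat (1 + int x) - Suc 0 = x" for x by arith
    then show ?thesis
      unfolding sum_negf[symmetric] by (intro sum.cong) (auto simp: a_def a_coeff_def bet_def)
  qed
  moreover have "a (Suc p) = c" using p1 by (simp add: a_def a_coeff_def c_def)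
  ultimately show ?thesis by simp
qed

text \<open>The defect of the candidate t in the order p Yule-Walker equation at lag i + 1, for a
  covariance sequence f.\<close>

definition yw :: "(nat \<Rightarrow> real) \<Rightarrow> (nat \<Rightarrow> real) \<Rightarrow> nat \<Rightarrow> real" where
  "yw t f i = f (i + 1) - (\<Sum>j<p. f (nat \<bar>int i - int j\<bar>) * t j)"

text \<open>By \<open>bet_eq\<close> an equation of order p + 1 is the one of order p plus c times
  its mirror image. This is an identity in f, so it serves for the limit covariances and for the
  sample covariances alike.\<close>

lemma a_sum_yw:
  assumes i: "i < p"
  shows "(\<Sum>k\<le>p+1. a k * f (nat \<bar>int (i + 1) - int k\<bar>)) = yw b f i + c * yw b f (p - 1 - i)"
proof -
  have s: "(\<Sum>j<p. b (p - 1 - j) * f (nat \<bar>int i - int j\<bar>)) = (\<Sum>j<p. f (nat \<bar>int (p - 1 - i) - int j\<bar>) * b j)"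
  proof -
    have "(\<Sum>j<p. b (p - 1 - j) * f (nat \<bar>int i - int j\<bar>))
      = (\<Sum>j<p. b (p - 1 - (p - 1 - j)) * f (nat \<bar>int i - int (p - 1 - j)\<bar>))"
      by (rule sum_flip[symmetric])
    also have "\<dots> = (\<Sum>j<p. f (nat \<bar>int (p - 1 - i) - int j\<bar>) * b j)"
    proof (rule sum.cong[OF refl])
      fix j assume "j \<in> {..<p}"
      then have "p - 1 - (p - 1 - j) = j" "nat \<bar>int i - int (p - 1 - j)\<bar> = nat \<bar>int (p - 1 - i) - int j\<bar>"
        using i by auto
      then show "b (p - 1 - (p - 1 - j)) * f (nat \<bar>int i - int (p - 1 - j)\<bar>) = f (nat \<bar>int (p - 1 - i) - int j\<bar>) * b j"
        by simp
    qed
    finally show ?thesis .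
  qed
  have "(\<Sum>j<p. bet j * f (nat \<bar>int (i + 1) - int (j + 1)\<bar>))
      = (\<Sum>j<p. f (nat \<bar>int i - int j\<bar>) * b j) + c * (\<Sum>j<p. b (p - 1 - j) * f (nat \<bar>int i - int j\<bar>))"
    unfolding sum_distrib_left sum.distrib[symmetric] by (intro sum.cong) (auto simp: bet_eq algebra_simps)
  moreover have "nat \<bar>int (i + 1) - int (p + 1)\<bar> = p - 1 - i + 1" "nat \<bar>int (i + 1) - int 0\<bar> = i + 1" using i by auto
  ultimately show ?thesis unfolding a_sum yw_def s by (simp add: algebra_simps)
qed

text \<open>This identifies \<open>theta_star\<close> as the best linear predictor of order p: I + c
  J annihilates the vector of defects, and it is invertible.\<close>

lemma yule_walker: assumes "i < p" shows "yw b l i = 0"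
proof -
  have "yw b l i + c * yw b l (p - 1 - i) = 0" if "i < p" for i
    using a_sum_yw[OF that, of l] l_AR[of "i + 1"] by simp
  from flip_solve[of "yw b l" "\<lambda>_. 0", OF this assms] show ?thesis by simp
qed

lemma last_flip: "(\<Sum>j<p. b (p - 1 - j) * f (p - j)) = (\<Sum>j<p. b j * f (j + 1))"
proof -
  have "(\<Sum>j<p. b (p - 1 - j) * f (p - j)) = (\<Sum>j<p. b (p - 1 - (p - 1 - j)) * f (p - (p - 1 - j)))"
    by (rule sum_flip[symmetric])
  also have "\<dots> = (\<Sum>j<p. b j * f (j + 1))"
  proof (rule sum.cong[OF refl])
    fix j assume "j \<in> {..<p}"
    then have "p - 1 - (p - 1 - j) = j" "p - (p - 1 - j) = j + 1" by auto
    then show "b (p - 1 - (p - 1 - j)) * f (p - (p - 1 - j)) = b j * f (j + 1)" by simp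
  qed
  finally show ?thesis .
qed

text \<open>The same splitting at lag p + 1, where the mirror image is no longer a Yule-Walker
  equation but the prediction error f 0 - (\<Sum>j<p. b j * f (j + 1)).\<close>

lemma a_sum_last:
  "(\<Sum>k\<le>p+1. a k * f (nat \<bar>int (p + 1) - int k\<bar>)) =
     f (p + 1) - (\<Sum>j<p. b j * f (p - j)) - c * (\<Sum>j<p. b j * f (j + 1)) + c * f 0"
proof -
  have "(\<Sum>j<p. bet j * f (nat \<bar>int (p + 1) - int (j + 1)\<bar>))
      = (\<Sum>j<p. b j * f (p - j)) + c * (\<Sum>j<p. b (p - 1 - j) * f (p - j))"
    unfolding sum_distrib_left sum.distrib[symmetric]
  proof (rule sum.cong[OF refl])
    fix j assume j: "j \<in> {..<p}"
    then have "nat \<bar>int (p + 1) - int (j + 1)\<bar> = p - j" by auto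
    then show "bet j * f (nat \<bar>int (p + 1) - int (j + 1)\<bar>) = b j * f (p - j) + c * (b (p - 1 - j) * f (p - j))"
      using j by (simp add: bet_eq algebra_simps)
  qed
  moreover have "nat \<bar>int (p + 1) - int (p + 1)\<bar> = 0" "nat \<bar>int (p + 1) - int 0\<bar> = p + 1" by auto
  ultimately show ?thesis unfolding a_sum last_flip by (simp add: algebra_simps)
qed

text \<open>This value identifies the limit of the residual sum of squares, and is the source of the
  factor \<open>- inverse \<alpha>\<close> in \<open>phi\<close>.\<close>

lemma prediction_error: "l 0 - (\<Sum>j<p. b j * l (j + 1)) = al"
proof -
  define d0 where "d0 = l 0 - (\<Sum>j<p. b j * l (j + 1))"
  have "l (p + 1) - (\<Sum>j<p. b j * l (p - j)) + c * d0 = 0"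
    using a_sum_last[of l] l_AR[of "p + 1"] by (simp add: d0_def algebra_simps)
  then have e: "l (p + 1) = (\<Sum>j<p. b j * l (p - j)) - c * d0" by simp
  have "(\<Sum>k\<le>p+1. a k * l k) = 1" using l_AR[of 0] by simp
  then have "l 0 - (\<Sum>j<p. bet j * l (j + 1)) + c * l (p + 1) = 1" unfolding a_sum .
  moreover have "(\<Sum>j<p. bet j * l (j + 1)) = (\<Sum>j<p. b j * l (j + 1)) + c * (\<Sum>j<p. b (p - 1 - j) * l (j + 1))"
    unfolding sum_distrib_left sum.distrib[symmetric] by (intro sum.cong) (auto simp: bet_eq algebra_simps)
  moreover have "(\<Sum>j<p. b (p - 1 - j) * l (j + 1)) = (\<Sum>j<p. b j * l (p - j))"
  proof -
    have "(\<Sum>j<p. b (p - 1 - j) * l (j + 1)) = (\<Sum>j<p. (\<lambda>j. b j * l (p - j)) (p - 1 - j))"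
    proof (rule sum.cong[OF refl])
      fix j assume "j \<in> {..<p}"
      then have "p - (p - 1 - j) = j + 1" by auto
      then show "b (p - 1 - j) * l (j + 1) = (\<lambda>j. b j * l (p - j)) (p - 1 - j)" by simp
    qed
    then show ?thesis by (simp only: sum_flip[of "\<lambda>j. b j * l (p - j)" p])
  qed
  \<comment> \<open>The equations at lags 0 and p + 1 are two linear equations in d0 and l (p + 1);
    the latter is eliminated.\<close>
  ultimately have "d0 * (1 - c\<^sup>2) = 1"
    unfolding e by (simp add: d0_def algebra_simps power2_eq_square)
  then have "d0 = al" using c2 by (simp add: al_eq eq_divide_eq)
  then show ?thesis by (simp add: d0_def)
qed

section \<open>The Toeplitz matrix and the symmetries of its inverse\<close>

lemma Delta_index: "q \<le> p + 2 \<Longrightarrow> i < q \<Longrightarrow> j < q \<Longrightarrow> Delta_mat p \<theta> \<rho> q $$ (i, j) = l (nat \<bar>int i - int j\<bar>)"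
  by (simp add: Delta_mat_def Lambda_eq)

lemma Delta_dim: "Delta_mat p \<theta> \<rho> q \<in> carrier_mat q q" by (simp add: Delta_mat_def)

lemma Delta_inj:
  assumes v: "v \<in> carrier_vec p" and z: "Delta_mat p \<theta> \<rho> p *\<^sub>v v = 0\<^sub>v p"
  shows "v = 0\<^sub>v p"
proof (rule ccontr)
  assume "v \<noteq> 0\<^sub>v p"
  then obtain i where i: "i < p" "v $ i \<noteq> 0" using v by (auto simp: vec_eq_iff)
  have "(\<Sum>j<p. l (nat \<bar>int i - int j\<bar>) * v $ j) = 0" if "i < p" for i
  proof -
    have "(Delta_mat p \<theta> \<rho> p *\<^sub>v v) $ i = 0" using z that by simp
    then show ?thesis using that by (simp add: mat_vec_index_sum[OF Delta_dim v] Delta_index)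
  qed
  then have "(\<Sum>i<p. v $ i * (\<Sum>j<p. l (nat \<bar>int i - int j\<bar>) * v $ j)) = 0" by simp
  then have "(\<Sum>i<p. \<Sum>j<p. v $ i * v $ j * l (nat \<bar>int i - int j\<bar>)) = 0"
    by (simp add: sum_distrib_left mult_ac)
  then show False using toeplitz_pd[of i p "\<lambda>i. v $ i"] i by simp
qed

lemma Delta_inv:
  shows "mat_inv (Delta_mat p \<theta> \<rho> p) \<in> carrier_mat p p"
    and "Delta_mat p \<theta> \<rho> p * mat_inv (Delta_mat p \<theta> \<rho> p) = 1\<^sub>m p"
    and "mat_inv (Delta_mat p \<theta> \<rho> p) * Delta_mat p \<theta> \<rho> p = 1\<^sub>m p"
  by (rule mat_inv_inverse[OF Delta_dim]; rule Delta_inj; assumption)+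

lemma D_left: assumes "i < p" "k < p" shows "(\<Sum>j<p. D i j * l (nat \<bar>int j - int k\<bar>)) = (if i = k then 1 else 0)"
proof -
  have "(mat_inv (Delta_mat p \<theta> \<rho> p) * Delta_mat p \<theta> \<rho> p) $$ (i, k) = (if i = k then 1 else 0)"
    unfolding Delta_inv(3) using assms by simp
  then show ?thesis using assms
    by (simp add: mat_mult_index_sum[OF Delta_inv(1) Delta_dim] Delta_index D_def)
qed

lemma D_right: assumes "i < p" "k < p" shows "(\<Sum>j<p. l (nat \<bar>int i - int j\<bar>) * D j k) = (if i = k then 1 else 0)"
proof -
  have "(Delta_mat p \<theta> \<rho> p * mat_inv (Delta_mat p \<theta> \<rho> p)) $$ (i, k) = (if i = k then 1 else 0)"
    unfolding Delta_inv(2) using assms by simp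
  then show ?thesis using assms
    by (simp add: mat_mult_index_sum[OF Delta_dim Delta_inv(1)] Delta_index D_def)
qed

text \<open>A left inverse is the inverse; symmetries of the Toeplitz matrix pass to
  \<open>D\<close> in this way.\<close>

lemma D_unique:
  assumes E: "\<And>i k. i < p \<Longrightarrow> k < p \<Longrightarrow> (\<Sum>j<p. E i j * l (nat \<bar>int j - int k\<bar>)) = (if i = k then 1 else 0)"
    and ik: "i < p" "k < p"
  shows "E i k = D i k"
proof -
  have "(\<Sum>m<p. (\<Sum>j<p. E i j * l (nat \<bar>int j - int m\<bar>)) * D m k) = (\<Sum>m<p. if m = i then D m k else 0)"
    using E ik by (intro sum.cong) auto
  moreover have "(\<Sum>m<p. (\<Sum>j<p. E i j * l (nat \<bar>int j - int m\<bar>)) * D m k)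
      = (\<Sum>j<p. E i j * (\<Sum>m<p. l (nat \<bar>int j - int m\<bar>) * D m k))"
    unfolding sum_distrib_right sum_distrib_left by (subst sum.swap) (simp add: mult.assoc)
  moreover have "(\<Sum>j<p. E i j * (\<Sum>m<p. l (nat \<bar>int j - int m\<bar>) * D m k)) = (\<Sum>j<p. if j = k then E i j else 0)"
    using D_right ik by (intro sum.cong) auto
  ultimately show ?thesis using ik by simp
qed

lemma D_sym: assumes "i < p" "k < p" shows "D k i = D i k"
proof (rule D_unique[of "\<lambda>i k. D k i", OF _ assms])
  fix i k assume ik: "i < p" "k < p"
  have "(\<Sum>j<p. D j i * l (nat \<bar>int j - int k\<bar>)) = (\<Sum>j<p. l (nat \<bar>int k - int j\<bar>) * D j i)"
    by (intro sum.cong) (auto simp: mult.commute abs_minus_commute)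
  then show "(\<Sum>j<p. D j i * l (nat \<bar>int j - int k\<bar>)) = (if i = k then 1 else 0)"
    using D_right[OF ik(2,1)] by auto
qed

text \<open>Reversing both indices leaves differences unchanged up to sign, so the Toeplitz matrix,
  and with it its inverse, is persymmetric.\<close>

lemma D_persym: assumes "i < p" "k < p" shows "D (p - 1 - i) (p - 1 - k) = D i k"
proof (rule D_unique[of "\<lambda>i k. D (p - 1 - i) (p - 1 - k)", OF _ assms])
  fix i k assume ik: "i < p" "k < p"
  have "(\<Sum>j<p. D (p - 1 - i) (p - 1 - j) * l (nat \<bar>int j - int k\<bar>))
      = (\<Sum>j<p. (\<lambda>j. D (p - 1 - i) j * l (nat \<bar>int j - int (p - 1 - k)\<bar>)) (p - 1 - j))"
  proof (rule sum.cong[OF refl])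
    fix j assume "j \<in> {..<p}"
    then have "nat \<bar>int (p - 1 - j) - int (p - 1 - k)\<bar> = nat \<bar>int j - int k\<bar>" using ik by auto
    then show "D (p - 1 - i) (p - 1 - j) * l (nat \<bar>int j - int k\<bar>)
      = (\<lambda>j. D (p - 1 - i) j * l (nat \<bar>int j - int (p - 1 - k)\<bar>)) (p - 1 - j)" by simp
  qed
  also have "\<dots> = (\<Sum>j<p. D (p - 1 - i) j * l (nat \<bar>int j - int (p - 1 - k)\<bar>))"
    by (rule sum_flip)
  also have "\<dots> = (if i = k then 1 else 0)" using ik by (subst D_left) auto
  finally show "(\<Sum>j<p. D (p - 1 - i) (p - 1 - j) * l (nat \<bar>int j - int k\<bar>)) = (if i = k then 1 else 0)" .
qed

lemma D_flip: assumes "i < p" "k < p" shows "D i (p - 1 - k) = D (p - 1 - i) k"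
proof -
  have "p - 1 - i < p" "p - 1 - (p - 1 - i) = i" using assms by auto
  then show ?thesis using D_persym[of "p - 1 - i" k] assms by simp
qed

lemma D_lambda: assumes "i < p" shows "(\<Sum>j<p. D i j * l (j + 1)) = b i"
proof -
  have "l (j + 1) = (\<Sum>m<p. l (nat \<bar>int j - int m\<bar>) * b m)" if "j < p" for j
    using yule_walker[OF that] by (simp add: yw_def)
  then have "(\<Sum>j<p. D i j * l (j + 1)) = (\<Sum>j<p. \<Sum>m<p. D i j * l (nat \<bar>int j - int m\<bar>) * b m)"
    by (intro sum.cong) (auto simp: sum_distrib_left mult.assoc)
  also have "\<dots> = (\<Sum>m<p. (\<Sum>j<p. D i j * l (nat \<bar>int j - int m\<bar>)) * b m)"
    by (subst sum.swap) (simp add: sum_distrib_right)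
  also have "\<dots> = (\<Sum>m<p. if m = i then b m else 0)"
    using D_left assms by (intro sum.cong) auto
  finally show ?thesis using assms by simp
qed

section \<open>Entries of the matrix P\<close>

lemma PB_dim: "PB_mat p \<theta> \<rho> \<in> carrier_mat p p"
  unfolding PB_mat_def using IJ_dim Delta_inv(1) by auto

lemma PB_index: assumes "i < p" "d < p" shows "PB_mat p \<theta> \<rho> $$ (i, d) = al * (D i d - c * D (p - 1 - i) d)"
proof -
  have "PB_mat p \<theta> \<rho> $$ (i, d) = (\<Sum>k<p. (al \<cdot>\<^sub>m IJ_mat p \<theta> \<rho>) $$ (i, k) * D k d)"
    unfolding PB_mat_def al_def[symmetric] D_def
    using IJ_dim Delta_inv(1) assms by (intro mat_mult_index_sum[of _ p p _ p]) auto
  also have "\<dots> = al * (\<Sum>k<p. IJ_mat p \<theta> \<rho> $$ (i, k) * D k d)"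
    unfolding sum_distrib_left using IJ_dim assms by (intro sum.cong) auto
  finally show ?thesis using sum_IJ[OF assms(1)] by simp
qed

lemma exch_dim: "exchange_mat p \<in> carrier_mat p p" by (simp add: exchange_mat_def)

lemma PL_dim: "PL_vec p \<theta> \<rho> \<in> carrier_vec p"
  unfolding PL_vec_def by (rule mult_mat_vec_carrier[OF mult_carrier_mat[OF exch_dim IJ_dim]])
    (use Delta_inv(1) beta_dim in auto)

text \<open>The shape in which this row arises from the expansion of the estimator of \<rho>: c
  times the error of the last component of \<theta>, plus the effect of all components on the lag p
  + 1 equation. Persymmetry and symmetry turn the first column of \<open>D\<close> into its last
  row.\<close>

lemma PL_index:
  assumes d: "d < p"
  shows "PL_vec p \<theta> \<rho> $ d = c * PB_mat p \<theta> \<rho> $$ (p - 1, d) + b (p - 1) / al * b (p - 1 - d)"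
proof -
  define y where "y i = al * c * D i 0 + b (p - 1) * bet i" for i
  define yv where "yv = (alpha p \<theta> \<rho> * (\<theta> $ (p - 1)) * \<rho>) \<cdot>\<^sub>v (mat_inv (Delta_mat p \<theta> \<rho> p) *\<^sub>v unit_vec p 0)
      + (theta_star p \<theta> \<rho> $ (p - 1)) \<cdot>\<^sub>v beta p \<theta> \<rho>"
  have yv: "yv \<in> carrier_vec p" unfolding yv_def using Delta_inv(1) beta_dim by auto
  have yi: "yv $ i = y i" if "i < p" for i
  proof -
    have "(mat_inv (Delta_mat p \<theta> \<rho> p) *\<^sub>v unit_vec p 0) $ i = (\<Sum>k<p. D i k * unit_vec p 0 $ k)"
      unfolding D_def by (rule mat_vec_index_sum[OF Delta_inv(1) unit_vec_carrier that])
    also have "\<dots> = (\<Sum>k<p. if k = 0 then D i k else 0)" by (intro sum.cong) (auto simp: unit_vec_def)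
    also have "\<dots> = D i 0" using p1 by simp
    finally show ?thesis unfolding yv_def y_def using that Delta_inv(1) beta_dim
      by (simp add: al_def c_def b_def bet_def mult.assoc)
  qed
  have "PL_vec p \<theta> \<rho> = exchange_mat p *\<^sub>v (IJ_mat p \<theta> \<rho> *\<^sub>v yv)"
    unfolding PL_vec_def yv_def[symmetric] by (rule assoc_mult_mat_vec[OF exch_dim IJ_dim yv])
  then have "PL_vec p \<theta> \<rho> $ d = (\<Sum>k<p. exchange_mat p $$ (d, k) * (IJ_mat p \<theta> \<rho> *\<^sub>v yv) $ k)"
    using mat_vec_index_sum[OF exch_dim mult_mat_vec_carrier[OF IJ_dim yv] d] by simp
  also have "\<dots> = (\<Sum>k<p. if k = p - 1 - d then (IJ_mat p \<theta> \<rho> *\<^sub>v yv) $ k else 0)"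
    using d by (intro sum.cong) (auto simp: exchange_mat_def)
  also have "\<dots> = (IJ_mat p \<theta> \<rho> *\<^sub>v yv) $ (p - 1 - d)" using d by simp
  also have "\<dots> = (\<Sum>k<p. IJ_mat p \<theta> \<rho> $$ (p - 1 - d, k) * y k)"
    using d yi by (subst mat_vec_index_sum[OF IJ_dim yv]) (auto intro!: sum.cong)
  also have "\<dots> = y (p - 1 - d) - c * y d" using d by (subst sum_IJ) auto
  also have "\<dots> = c * (al * (D (p - 1 - d) 0 - c * D d 0)) + b (p - 1) * (bet (p - 1 - d) - c * bet d)"
    by (simp add: y_def algebra_simps)
  also have "bet (p - 1 - d) - c * bet d = b (p - 1 - d) / al"
  proof -
    have "p - 1 - d < p" "p - 1 - (p - 1 - d) = d" using d by auto
    then show ?thesis using b_eq[of "p - 1 - d"] al_pos by simp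
  qed
  also have "D (p - 1 - d) 0 = D (p - 1) d"
  proof -
    have k: "p - 1 - d < p" "p - 1 < p" "p - 1 - (p - 1 - d) = d" "p - 1 - (p - 1) = 0" using d by auto
    have "D (p - 1 - d) 0 = D d (p - 1)" using D_flip[OF k(1,2)] by (simp only: k(3,4))
    then show ?thesis using D_sym[OF d k(2)] by simp
  qed
  also have "D d 0 = D (p - 1 - (p - 1)) d" using D_sym[of d 0] d p1 by simp
  finally show ?thesis using PB_index[of "p - 1" d] d p1 by simp
qed

text \<open>The weights are I + c J applied to the reversed autocovariances l p, ..., l 1. This
  cancels the factor al (I - c J) of P_B, and \<open>D\<close> maps the reversed autocovariances to
  the reversed \<open>theta_star\<close>, the mirror image of \<open>D_lambda\<close>.\<close>

lemma PB_sum_lambda: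
  assumes d: "d < p"
  shows "(\<Sum>j<p. (l (p - j) + c * l (j + 1)) * PB_mat p \<theta> \<rho> $$ (j, d)) = b (p - 1 - d)"
proof -
  define f where "f j = l (p - j) + c * l (j + 1)" for j
  have "(\<Sum>j<p. f j * PB_mat p \<theta> \<rho> $$ (j, d)) = (\<Sum>j<p. al * (f j * D j d) - al * c * (f j * D (p - 1 - j) d))"
    using d by (intro sum.cong) (auto simp: PB_index algebra_simps)
  also have "\<dots> = al * (\<Sum>j<p. f j * D j d) - al * c * (\<Sum>j<p. f j * D (p - 1 - j) d)"
    by (simp add: sum_subtractf sum_distrib_left)
  also have "(\<Sum>j<p. f j * D (p - 1 - j) d) = (\<Sum>j<p. f (p - 1 - j) * D j d)"
  proof -
    have "(\<Sum>j<p. f j * D (p - 1 - j) d) = (\<Sum>j<p. (\<lambda>j. f (p - 1 - j) * D j d) (p - 1 - j))"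
      by (intro sum.cong) auto
    then show ?thesis by (simp only: sum_flip[of "\<lambda>j. f (p - 1 - j) * D j d" p])
  qed
  also have "al * (\<Sum>j<p. f j * D j d) - al * c * (\<Sum>j<p. f (p - 1 - j) * D j d)
      = al * (\<Sum>j<p. (f j - c * f (p - 1 - j)) * D j d)"
    by (simp add: sum_distrib_left sum_subtractf[symmetric] algebra_simps)
  also have "(\<Sum>j<p. (f j - c * f (p - 1 - j)) * D j d) = (\<Sum>j<p. (1 - c\<^sup>2) * (l (p - j) * D j d))"
  proof (rule sum.cong[OF refl])
    fix j assume "j \<in> {..<p}"
    then have "p - (p - 1 - j) = j + 1" "p - 1 - j + 1 = p - j" by auto
    then show "(f j - c * f (p - 1 - j)) * D j d = (1 - c\<^sup>2) * (l (p - j) * D j d)"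
      unfolding f_def by (simp add: algebra_simps power2_eq_square)
  qed
  also have "al * \<dots> = al * (1 - c\<^sup>2) * (\<Sum>j<p. l (p - j) * D j d)"
    by (simp only: sum_distrib_left mult.assoc)
  also have "\<dots> = (\<Sum>j<p. l (p - j) * D j d)" by (simp only: al_mult mult_1_left)
  also have "\<dots> = (\<Sum>j<p. (\<lambda>j. D (p - 1 - d) j * l (j + 1)) (p - 1 - j))"
  proof (rule sum.cong[OF refl])
    fix j assume j: "j \<in> {..<p}"
    then have "p - 1 - j + 1 = p - j" by auto
    moreover have "D (p - 1 - d) (p - 1 - j) = D j d" using D_persym[of d j] D_sym[of j d] j d by simp
    ultimately show "l (p - j) * D j d = (\<lambda>j. D (p - 1 - d) j * l (j + 1)) (p - 1 - j)" by simp
  qed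
  also have "\<dots> = (\<Sum>j<p. D (p - 1 - d) j * l (j + 1))" by (rule sum_flip)
  also have "\<dots> = b (p - 1 - d)" using d by (intro D_lambda) auto
  finally show ?thesis unfolding f_def .
qed

text \<open>The coefficients N do not depend on f. They can therefore be applied pathwise to sample
  covariances, and limits in probability pass through the fixed linear combinations.\<close>

lemma B_solve:
  "\<exists>N. \<forall>f :: nat \<Rightarrow> real. \<forall>h\<le>p+1. f h = (\<Sum>d<p+2. N h d * (\<Sum>i\<le>p+1. a i * f (nat \<bar>int d - int i\<bar>)))"
proof -
  let ?B = "B_mat p \<theta> \<rho>"
  have Bi: "mat_inv ?B \<in> carrier_mat (p + 2) (p + 2)" "mat_inv ?B * ?B = 1\<^sub>m (p + 2)"
    by (rule mat_inv_inverse[OF B_dim]; rule B_mat_inj; assumption)+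
  show ?thesis
  proof (intro exI[of _ "\<lambda>h d. mat_inv ?B $$ (h, d)"] allI impI)
    fix f :: "nat \<Rightarrow> real" and h assume h: "h \<le> p + 1"
    have "mat_inv ?B *\<^sub>v (?B *\<^sub>v vec (p + 2) f) = vec (p + 2) f"
      using assoc_mult_mat_vec[OF Bi(1) B_dim, of "vec (p + 2) f"] Bi(2) by simp
    then have "f h = (mat_inv ?B *\<^sub>v (?B *\<^sub>v vec (p + 2) f)) $ h" using h by simp
    also have "\<dots> = (\<Sum>d<p+2. mat_inv ?B $$ (h, d) * (?B *\<^sub>v vec (p + 2) f) $ d)"
      using h by (intro mat_vec_index_sum[OF Bi(1)] mult_mat_vec_carrier[OF B_dim]) auto
    also have "\<dots> = (\<Sum>d<p+2. mat_inv ?B $$ (h, d) * (\<Sum>i\<le>p+1. a i * f (nat \<bar>int d - int i\<bar>)))"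
      by (rule sum.cong[OF refl]) (subst B_mat_mult, auto)
    finally show "f h = (\<Sum>d<p+2. mat_inv ?B $$ (h, d) * (\<Sum>i\<le>p+1. a i * f (nat \<bar>int d - int i\<bar>)))" .
  qed
qed

section \<open>The quadratic form of Gamma\<close>

lemma P_index:
  shows "i < p \<Longrightarrow> d < p \<Longrightarrow> P_mat p \<theta> \<rho> $$ (i, d) = PB_mat p \<theta> \<rho> $$ (i, d)"
    and "i < p \<Longrightarrow> P_mat p \<theta> \<rho> $$ (i, p) = 0"
    and "d < p \<Longrightarrow> P_mat p \<theta> \<rho> $$ (p, d) = PL_vec p \<theta> \<rho> $ d"
    and "P_mat p \<theta> \<rho> $$ (p, p) = - (b (p - 1) / al)"
    and "P_mat p \<theta> \<rho> \<in> carrier_mat (p + 1) (p + 1)"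
  using PB_dim PL_dim unfolding P_mat_def
  by (auto simp: phi_def b_def al_def divide_inverse mult.commute mat_of_rows_def)

lemma Gamma_quad:
  fixes t :: "nat \<Rightarrow> real"
  defines "w \<equiv> \<lambda>d. \<Sum>i<p+1. t i * P_mat p \<theta> \<rho> $$ (i, d)"
  shows "(\<Sum>i<p+1. \<Sum>j<p+1. t i * t j * Gamma_mat p \<theta> \<rho> $$ (i, j))
    = (\<Sum>d<p+1. \<Sum>e<p+1. w d * w e * l (nat \<bar>int d - int e\<bar>))"
proof -
  let ?P = "P_mat p \<theta> \<rho>" and ?D = "Delta_mat p \<theta> \<rho> (p + 1)" and ?q = "p + 1"
  note P = P_index(5)
  have PT: "?P\<^sup>T \<in> carrier_mat ?q ?q" using P by simp
  have "Gamma_mat p \<theta> \<rho> $$ (i, j) = (\<Sum>e<?q. (\<Sum>d<?q. ?P $$ (i, d) * l (nat \<bar>int d - int e\<bar>)) * ?P $$ (j, e))"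
    if "i < ?q" "j < ?q" for i j
    unfolding Gamma_mat_def mat_mult_index_sum[OF mult_carrier_mat[OF P Delta_dim] PT that]
  proof (intro sum.cong refl arg_cong2[where f="(*)"])
    fix e assume "e \<in> {..<?q}"
    then have e: "e < ?q" by simp
    show "(?P * ?D) $$ (i, e) = (\<Sum>d<?q. ?P $$ (i, d) * l (nat \<bar>int d - int e\<bar>))"
      unfolding mat_mult_index_sum[OF P Delta_dim that(1) e]
      by (intro sum.cong refl) (use e Delta_index[of ?q] in simp)
    show "?P\<^sup>T $$ (e, j) = ?P $$ (j, e)" using P e that by (intro index_transpose_mat(1)) auto
  qed
  then have "(\<Sum>i<?q. \<Sum>j<?q. t i * t j * Gamma_mat p \<theta> \<rho> $$ (i, j))
      = (\<Sum>i<?q. \<Sum>j<?q. t i * t j * (\<Sum>e<?q. (\<Sum>d<?q. ?P $$ (i, d) * l (nat \<bar>int d - int e\<bar>)) * ?P $$ (j, e)))"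
    by (intro sum.cong refl arg_cong2[where f="(*)"]) simp_all
  also have "\<dots> = (\<Sum>i<?q. \<Sum>j<?q. \<Sum>e<?q. \<Sum>d<?q. (t i * ?P $$ (i, d)) * (t j * ?P $$ (j, e)) * l (nat \<bar>int d - int e\<bar>))"
    unfolding sum_distrib_left sum_distrib_right by (intro sum.cong refl) (simp only: mult_ac)
  also have "\<dots> = (\<Sum>i<?q. \<Sum>e<?q. \<Sum>j<?q. \<Sum>d<?q. (t i * ?P $$ (i, d)) * (t j * ?P $$ (j, e)) * l (nat \<bar>int d - int e\<bar>))"
    by (intro sum.cong refl sum.swap)
  also have "\<dots> = (\<Sum>e<?q. \<Sum>i<?q. \<Sum>j<?q. \<Sum>d<?q. (t i * ?P $$ (i, d)) * (t j * ?P $$ (j, e)) * l (nat \<bar>int d - int e\<bar>))"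
    by (rule sum.swap)
  also have "\<dots> = (\<Sum>e<?q. \<Sum>i<?q. \<Sum>d<?q. \<Sum>j<?q. (t i * ?P $$ (i, d)) * (t j * ?P $$ (j, e)) * l (nat \<bar>int d - int e\<bar>))"
    by (intro sum.cong refl sum.swap)
  also have "\<dots> = (\<Sum>e<?q. \<Sum>d<?q. \<Sum>i<?q. \<Sum>j<?q. (t i * ?P $$ (i, d)) * (t j * ?P $$ (j, e)) * l (nat \<bar>int d - int e\<bar>))"
    by (rule sum.cong[OF refl], rule sum.swap)
  also have "\<dots> = (\<Sum>e<?q. \<Sum>d<?q. w d * w e * l (nat \<bar>int d - int e\<bar>))"
  proof (intro sum.cong refl)
    fix d e
    have resid_coeff: "w d * w e = (\<Sum>i<?q. \<Sum>j<?q. (t i * ?P $$ (i, d)) * (t j * ?P $$ (j, e)))"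
      by (simp only: w_def sum_product)
    show "(\<Sum>i<?q. \<Sum>j<?q. (t i * ?P $$ (i, d)) * (t j * ?P $$ (j, e)) * l (nat \<bar>int d - int e\<bar>))
        = w d * w e * l (nat \<bar>int d - int e\<bar>)"
      by (simp only: resid_coeff sum_distrib_right)
  qed
  also have "\<dots> = (\<Sum>d<?q. \<Sum>e<?q. w d * w e * l (nat \<bar>int d - int e\<bar>))" by (rule sum.swap)
  finally show ?thesis .
qed

lemma Gamma_dim: "Gamma_mat p \<theta> \<rho> \<in> carrier_mat (p + 1) (p + 1)"
  unfolding Gamma_mat_def using P_index(5) Delta_dim by auto

lemma Gamma_sym: "(Gamma_mat p \<theta> \<rho>)\<^sup>T = Gamma_mat p \<theta> \<rho>"
proof -
  let ?P = "P_mat p \<theta> \<rho>" and ?D = "Delta_mat p \<theta> \<rho> (p + 1)"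
  note P = P_index(5)
  have DT: "?D\<^sup>T = ?D" by (rule eq_matI) (auto simp: Delta_mat_def abs_minus_commute)
  have "(?P * ?D * ?P\<^sup>T)\<^sup>T = (?P\<^sup>T)\<^sup>T * (?P * ?D)\<^sup>T"
    using P Delta_dim by (intro transpose_mult[of _ "p + 1" "p + 1" _ "p + 1"]) auto
  also have "(?P * ?D)\<^sup>T = ?D * ?P\<^sup>T" by (simp only: transpose_mult[OF P Delta_dim] DT)
  also have "(?P\<^sup>T)\<^sup>T * (?D * ?P\<^sup>T) = ?P * ?D * ?P\<^sup>T"
    using P Delta_dim[of "p + 1"] by (simp add: assoc_mult_mat[of _ "p + 1" "p + 1" _ "p + 1" _ "p + 1"])
  finally show ?thesis unfolding Gamma_mat_def .
qed

lemma Gamma_psd: "0 \<le> (\<Sum>i<p+1. \<Sum>j<p+1. t i * t j * Gamma_mat p \<theta> \<rho> $$ (i, j))"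
  unfolding Gamma_quad by (rule toeplitz_psd)

end

section \<open>Asymptotic equivalence in probability\<close>

text \<open>Neither sequence has to converge: expansions of the scaled errors are chained by this
  relation down to the quadratic form, whose limit law is then used.\<close>

definition eqP :: "'w measure \<Rightarrow> (nat \<Rightarrow> 'w \<Rightarrow> real) \<Rightarrow> (nat \<Rightarrow> 'w \<Rightarrow> real) \<Rightarrow> bool" where
  "eqP M X Y \<longleftrightarrow> oP M (\<lambda>n \<omega>. X n \<omega> - Y n \<omega>)"

definition sqn :: "(nat \<Rightarrow> 'w \<Rightarrow> real) \<Rightarrow> nat \<Rightarrow> 'w \<Rightarrow> real" where
  "sqn X n \<omega> = sqrt (real n) * X n \<omega>"

context prob_space
begin

lemma eqP_refl: "eqP M X X"
  by (simp add: eqP_def oP_zero)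

lemma eqP_sym: "eqP M X Y \<Longrightarrow> eqP M Y X"
  unfolding eqP_def using oP_minus[of M "\<lambda>n \<omega>. X n \<omega> - Y n \<omega>"] by simp

lemma eqP_trans: 
  assumes "eqP M X Y" "eqP M Y Z" shows "eqP M X Z"
  using oP_add[OF assms[unfolded eqP_def]] by (simp add: eqP_def)

lemma eqP_add: 
  assumes "eqP M X X'" "eqP M Y Y'" shows "eqP M (\<lambda>n \<omega>. X n \<omega> + Y n \<omega>) (\<lambda>n \<omega>. X' n \<omega> + Y' n \<omega>)"
  using oP_add[OF assms[unfolded eqP_def]] by (simp add: eqP_def algebra_simps)

lemma eqP_diff: 
  assumes "eqP M X X'" "eqP M Y Y'" shows "eqP M (\<lambda>n \<omega>. X n \<omega> - Y n \<omega>) (\<lambda>n \<omega>. X' n \<omega> - Y' n \<omega>)"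
  using oP_diff[OF assms[unfolded eqP_def]] by (simp add: eqP_def algebra_simps)

lemma eqP_sum: 
  assumes "\<And>i. i \<in> I \<Longrightarrow> eqP M (X i) (Y i)" shows "eqP M (\<lambda>n \<omega>. \<Sum>i\<in>I. X i n \<omega>) (\<lambda>n \<omega>. \<Sum>i\<in>I. Y i n \<omega>)"
  using oP_sum[of I "\<lambda>i n \<omega>. X i n \<omega> - Y i n \<omega>"] assms by (simp add: eqP_def sum_subtractf)

lemma eqP_OP: "eqP M X Y \<Longrightarrow> OP M Y \<Longrightarrow> OP M X"
  unfolding eqP_def using OP_add[OF oP_imp_OP[of M "\<lambda>n \<omega>. X n \<omega> - Y n \<omega>"], of Y] by simp

lemma eqP_mult: 
  assumes X: "eqP M X X'" and Y: "eqP M Y Y'" and OP: "OP M X'" "OP M Y'"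
  shows "eqP M (\<lambda>n \<omega>. X n \<omega> * Y n \<omega>) (\<lambda>n \<omega>. X' n \<omega> * Y' n \<omega>)"
proof -
  have "oP M (\<lambda>n \<omega>. (X n \<omega> - X' n \<omega>) * Y n \<omega> + X' n \<omega> * (Y n \<omega> - Y' n \<omega>))"
    using X Y OP eqP_OP[OF Y OP(2)]
    by (intro oP_add oP_mult_OP OP_mult_oP) (auto simp: eqP_def)
  then show ?thesis by (simp add: eqP_def algebra_simps)
qed

lemma eqP_cmult: "eqP M X X' \<Longrightarrow> eqP M (\<lambda>n \<omega>. c * X n \<omega>) (\<lambda>n \<omega>. c * X' n \<omega>)"
  unfolding eqP_def using oP_cmult[of "\<lambda>n \<omega>. X n \<omega> - X' n \<omega>" c] by (simp add: right_diff_distrib)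

lemma eqP_mult_left:
  assumes "OP M Z" "eqP M X X'" shows "eqP M (\<lambda>n \<omega>. Z n \<omega> * X n \<omega>) (\<lambda>n \<omega>. Z n \<omega> * X' n \<omega>)"
  unfolding eqP_def using OP_mult_oP[OF assms(1) assms(2)[unfolded eqP_def]] by (simp add: right_diff_distrib)

lemma eqP_const_OP: "eqP M X (\<lambda>n \<omega>. c) \<Longrightarrow> OP M X"
  by (erule eqP_OP) (rule OP_const)

lemma eqP_inverse:
  "eqP M X (\<lambda>n \<omega>. c) \<Longrightarrow> c \<noteq> 0 \<Longrightarrow> eqP M (\<lambda>n \<omega>. inverse (X n \<omega>)) (\<lambda>n \<omega>. inverse c)"
  unfolding eqP_def by (rule oP_inverse)

lemma eqP_cong_ev:
  assumes "eqP M X Y" "\<And>n \<omega>. n \<ge> 1 \<Longrightarrow> \<omega> \<in> space M \<Longrightarrow> X' n \<omega> = X n \<omega>"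
    "\<And>n \<omega>. n \<ge> 1 \<Longrightarrow> \<omega> \<in> space M \<Longrightarrow> Y' n \<omega> = Y n \<omega>"
  shows "eqP M X' Y'"
  using assms oP_cong_ev[of M "\<lambda>n \<omega>. X n \<omega> - Y n \<omega>" "\<lambda>n \<omega>. X' n \<omega> - Y' n \<omega>"] by (simp add: eqP_def)

(* Junk value: inverse 0 = 0, so the product is 1 unless D n vanishes. *)
lemma oP_inverse_defect:
  assumes "eqP M D (\<lambda>n \<omega>. d)" "d \<noteq> 0"
  shows "oP M (\<lambda>n \<omega>. K n \<omega> * (1 - inverse (D n \<omega>) * D n \<omega>))"
  unfolding oP_def
proof (intro allI impI)
  fix e :: real assume e: "e > 0"
  define r where "r = min e (\<bar>d\<bar> / 2)"
  have r: "r > 0" "r \<le> e" "r \<le> \<bar>d\<bar> / 2" using e assms(2) by (auto simp: r_def)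
  have "\<forall>\<^sub>F n in sequentially. whp M r (\<lambda>\<omega>. \<bar>D n \<omega> - d\<bar> \<le> r)"
    using assms(1) r(1) unfolding eqP_def oP_def by blast
  then show "\<forall>\<^sub>F n in sequentially. whp M e (\<lambda>\<omega>. \<bar>K n \<omega> * (1 - inverse (D n \<omega>) * D n \<omega>)\<bar> \<le> e)"
  proof eventually_elim
    case (elim n)
    then show ?case
    proof (rule whp_mono)
      fix \<omega> assume "\<bar>D n \<omega> - d\<bar> \<le> r"
      then have "D n \<omega> \<noteq> 0" using r(3) assms(2) by auto
      then show "\<bar>K n \<omega> * (1 - inverse (D n \<omega>) * D n \<omega>)\<bar> \<le> e" using e by simp
    qed (rule r(2))
  qed
qed

lemma OP_sqn_imp:
  assumes "OP M (sqn Z)" shows "oP M Z"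
proof -
  have c: "(\<lambda>n. inverse (sqrt (real n))) \<longlonglongrightarrow> 0"
    by (rule tendsto_inverse_0_at_top) (rule filterlim_compose[OF sqrt_at_top filterlim_real_sequentially])
  have "oP M (\<lambda>n \<omega>. inverse (sqrt (real n)) * sqn Z n \<omega>)"
    by (rule oP_mult_OP[OF oP_seq[OF c] assms])
  then show ?thesis by (rule oP_cong_ev) (simp add: sqn_def mult.assoc[symmetric])
qed

lemma sqn_eqP_imp:
  assumes "eqP M (sqn X) (sqn Y)" shows "eqP M X Y"
proof -
  have "OP M (sqn (\<lambda>n \<omega>. X n \<omega> - Y n \<omega>))"
    using oP_imp_OP[OF assms[unfolded eqP_def]] by (simp add: sqn_def[abs_def] right_diff_distrib)
  then show ?thesis unfolding eqP_def by (rule OP_sqn_imp)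
qed

lemma linear_system_eqP:
  fixes p :: nat and A :: "nat \<Rightarrow> nat \<Rightarrow> nat \<Rightarrow> 'a \<Rightarrow> real" and D T :: "nat \<Rightarrow> nat \<Rightarrow> real"
  assumes A: "\<And>i j. i < p \<Longrightarrow> j < p \<Longrightarrow> eqP M (A i j) (\<lambda>n \<omega>. T i j)"
    and left: "\<And>i k. i < p \<Longrightarrow> k < p \<Longrightarrow> (\<Sum>j<p. D i j * T j k) = (if i = k then 1 else 0)"
    and sys: "\<And>i. i < p \<Longrightarrow> eqP M (\<lambda>n \<omega>. \<Sum>j<p. A i j n \<omega> * Z j n \<omega>) (r i)"
    and r: "\<And>i. i < p \<Longrightarrow> OP M (r i)" and i: "i < p"
  shows "eqP M (Z i) (\<lambda>n \<omega>. \<Sum>j<p. D i j * r j n \<omega>)" "OP M (Z i)"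
proof -
  define m where "m i n \<omega> = (\<Sum>j<p. A i j n \<omega> * Z j n \<omega>)" for i n \<omega>
  have m: "eqP M (m i) (r i)" "OP M (m i)" if "i < p" for i
    using sys[OF that] eqP_OP[OF sys[OF that] r[OF that]] by (simp_all add: m_def[abs_def])
  define H where "H i k n \<omega> = (\<Sum>j<p. D i j * (A j k n \<omega> - T j k))" for i k n \<omega>
  have H: "oP M (H i k)" if "i < p" "k < p" for i k
    unfolding H_def[abs_def] using A that by (intro oP_sum oP_cmult) (auto simp: eqP_def)
  have Z: "Z i n \<omega> = (\<Sum>j<p. D i j * m j n \<omega>) - (\<Sum>k<p. H i k n \<omega> * Z k n \<omega>)" if i: "i < p" for i n \<omega>
  proof -
    have "(\<Sum>j<p. D i j * m j n \<omega>) = (\<Sum>k<p. (\<Sum>j<p. D i j * A j k n \<omega>) * Z k n \<omega>)"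
      unfolding m_def sum_distrib_left sum_distrib_right by (subst sum.swap) (simp add: mult.assoc)
    moreover have "(\<Sum>j<p. D i j * A j k n \<omega>) = H i k n \<omega> + (if i = k then 1 else 0)" if "k < p" for k
      unfolding H_def left[OF i that, symmetric] by (simp add: right_diff_distrib sum_subtractf)
    ultimately have "(\<Sum>j<p. D i j * m j n \<omega>) = (\<Sum>k<p. H i k n \<omega> * Z k n \<omega> + (if k = i then Z k n \<omega> else 0))"
      by (simp add: distrib_right) (intro sum.cong refl, auto simp: distrib_right)
    then show ?thesis using i by (simp add: sum.distrib)
  qed
  \<comment> \<open>No bound for the single Z k is available yet; their absolute sum satisfies Y <=
    R + h Y with \<open>R\<close> bounded and \<open>h\<close> negligible in probability.\<close>
  define Y where "Y n \<omega> = (\<Sum>k<p. \<bar>Z k n \<omega>\<bar>)" for n \<omega>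
  define R where "R n \<omega> = (\<Sum>i<p. \<bar>\<Sum>j<p. D i j * m j n \<omega>\<bar>)" for n \<omega>
  define h where "h n \<omega> = (\<Sum>i<p. \<Sum>k<p. \<bar>H i k n \<omega>\<bar>)" for n \<omega>
  have abs_oP: "oP M (\<lambda>n \<omega>. \<bar>X n \<omega>\<bar>)" if "oP M X" for X using that by (simp add: oP_def)
  have abs_OP: "OP M (\<lambda>n \<omega>. \<bar>X n \<omega>\<bar>)" if "OP M X" for X using that by (simp add: OP_def)
  have "OP M R" unfolding R_def[abs_def] by (intro OP_sum abs_OP OP_cmult m) auto
  moreover have "oP M h" unfolding h_def[abs_def] by (intro oP_sum abs_oP H) auto
  moreover have "\<bar>Y n \<omega>\<bar> \<le> R n \<omega> + h n \<omega> * \<bar>Y n \<omega>\<bar>" for n \<omega>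
  proof -
    have Y0: "Y n \<omega> \<ge> 0" unfolding Y_def by (intro sum_nonneg) auto
    have "Y n \<omega> \<le> (\<Sum>i<p. \<bar>\<Sum>j<p. D i j * m j n \<omega>\<bar> + (\<Sum>k<p. \<bar>H i k n \<omega>\<bar>) * Y n \<omega>)"
      unfolding Y_def[of n \<omega>]
    proof (rule sum_mono)
      fix i assume "i \<in> {..<p}"
      then have i: "i < p" by simp
      have "\<bar>\<Sum>k<p. H i k n \<omega> * Z k n \<omega>\<bar> \<le> (\<Sum>k<p. \<bar>H i k n \<omega>\<bar> * \<bar>Z k n \<omega>\<bar>)"
        by (rule order_trans[OF sum_abs]) (simp add: abs_mult)
      also have "\<dots> \<le> (\<Sum>k<p. \<bar>H i k n \<omega>\<bar> * Y n \<omega>)"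
        unfolding Y_def by (intro sum_mono mult_left_mono member_le_sum) auto
      finally show "\<bar>Z i n \<omega>\<bar> \<le> \<bar>\<Sum>j<p. D i j * m j n \<omega>\<bar> + (\<Sum>k<p. \<bar>H i k n \<omega>\<bar>) * (\<Sum>k<p. \<bar>Z k n \<omega>\<bar>)"
        unfolding Y_def[symmetric] sum_distrib_right[symmetric]
        by (subst Z[OF i]) (rule order_trans[OF abs_triangle_ineq4 add_left_mono])
    qed
    also have "\<dots> = R n \<omega> + h n \<omega> * Y n \<omega>"
      by (simp add: R_def h_def sum.distrib sum_distrib_right)
    finally show ?thesis using Y0 by simp
  qed
  ultimately have Y: "OP M Y" by (rule OP_self_bound)
  have ZOP: "OP M (Z k)" if k: "k < p" for k
  proof (rule OP_mono[OF Y], intro always_eventually allI ballI)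
    fix n \<omega>
    have "\<bar>Z k n \<omega>\<bar> \<le> Y n \<omega>"
      unfolding Y_def by (rule member_le_sum[where f="\<lambda>k. \<bar>Z k n \<omega>\<bar>"]) (use k in auto)
    then show "\<bar>Z k n \<omega>\<bar> \<le> \<bar>Y n \<omega>\<bar>" by simp
  qed
  show "OP M (Z i)" by (rule ZOP[OF i])
  have "oP M (\<lambda>n \<omega>. \<Sum>j<p. D i j * (m j n \<omega> - r j n \<omega>))"
    using m(1) by (intro oP_sum oP_cmult) (auto simp: eqP_def)
  moreover have "oP M (\<lambda>n \<omega>. \<Sum>k<p. H i k n \<omega> * Z k n \<omega>)"
    using i by (intro oP_sum oP_mult_OP H ZOP) auto
  ultimately have "oP M (\<lambda>n \<omega>. (\<Sum>j<p. D i j * (m j n \<omega> - r j n \<omega>)) - (\<Sum>k<p. H i k n \<omega> * Z k n \<omega>))"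
    by (rule oP_diff)
  then show "eqP M (Z i) (\<lambda>n \<omega>. \<Sum>j<p. D i j * r j n \<omega>)"
    unfolding eqP_def by (rule oP_cong_ev) (subst Z[OF i], simp add: right_diff_distrib sum_subtractf)
qed

end

section \<open>Least squares sums of the process\<close>

locale ar_process = ar_coeffs p \<theta> \<rho> + prob_space M
  for p :: nat and \<theta> :: "real vec" and \<rho> :: real and M :: "'w measure" +
  fixes \<sigma> :: real and S :: "real mat" and X :: "int \<Rightarrow> 'w \<Rightarrow> real" and \<epsilon> V :: "nat \<Rightarrow> 'w \<Rightarrow> real"
  assumes X_rec: "\<And>n \<omega>. n \<ge> 1 \<Longrightarrow> \<omega> \<in> space M \<Longrightarrow>
      X (int n) \<omega> = (\<Sum>i=1..p. \<theta> $ (i - 1) * X (int n - int i) \<omega>) + \<epsilon> n \<omega>"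
    and eps_rec: "\<And>n \<omega>. n \<ge> 1 \<Longrightarrow> \<omega> \<in> space M \<Longrightarrow> \<epsilon> n \<omega> = \<rho> * \<epsilon> (n - 1) \<omega> + V n \<omega>"
    and X_init: "\<And>\<omega>. \<omega> \<in> space M \<Longrightarrow> X 0 \<omega> = \<epsilon> 0 \<omega>"
      "X 0 \<in> borel_measurable M" "integrable M (\<lambda>\<omega>. (X 0 \<omega>)\<^sup>2)"
    and X_neg: "\<And>i \<omega>. 1 \<le> i \<Longrightarrow> i \<le> p \<Longrightarrow> \<omega> \<in> space M \<Longrightarrow> X (- int i) \<omega> = 0"
    and V_indep: "indep_vars (\<lambda>_. borel) V {1..}"
    and V_ident: "\<And>n. n \<ge> 1 \<Longrightarrow> distr M borel (V n) = distr M borel (V 1)"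
    and V_sq: "\<And>n. n \<ge> 1 \<Longrightarrow> integrable M (\<lambda>\<omega>. (V n \<omega>)\<^sup>2)"
    and V_mean: "\<And>n. n \<ge> 1 \<Longrightarrow> expectation (V n) = 0"
    and V_var: "\<And>n. n \<ge> 1 \<Longrightarrow> variance (V n) = \<sigma>\<^sup>2"
    and sigma_pos: "\<sigma>\<^sup>2 > 0"
    and V_fourth: "\<And>n. n \<ge> 1 \<Longrightarrow> integrable M (\<lambda>\<omega>. (V n \<omega>) ^ 4)"
    and S_pd: "sym_pos_def p S"
begin

lemma V_sq_exp: "n \<ge> 1 \<Longrightarrow> expectation (\<lambda>\<omega>. (V n \<omega>)\<^sup>2) = \<sigma>\<^sup>2"
  using V_var[of n] V_mean[of n] by simp

sublocale noise: iid_noise M "\<lambda>n. V (Suc n)" "\<sigma>\<^sup>2"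
proof
  show "indep_vars (\<lambda>_. borel) (\<lambda>n. V (Suc n)) UNIV"
    by (rule indep_vars_inj[OF V_indep]) auto
  show "distr M borel (V (Suc n)) = distr M borel (V (Suc 0))" for n
    using V_ident[of "Suc n"] by simp
qed (use V_sq V_mean V_sq_exp in auto)

lemma V_rv [measurable]: "n \<ge> 1 \<Longrightarrow> V n \<in> borel_measurable M"
  using noise.rv[of "n - 1"] by simp

text \<open>The inputs of the recursion, with X 0 as the input at time 0. Joint statements about U 0
  and later inputs must do without independence.\<close>

definition U :: "nat \<Rightarrow> 'w \<Rightarrow> real" where "U j = (if j = 0 then X 0 else V j)"

lemma U_rv [measurable]: "U j \<in> borel_measurable M"
  using X_init(2) V_rv by (simp add: U_def)

definition K0 :: real where "K0 = \<sigma>\<^sup>2 + expectation (\<lambda>\<omega>. (X 0 \<omega>)\<^sup>2)"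

lemma U_sq: "integrable M (\<lambda>\<omega>. (U j \<omega>)\<^sup>2)" "expectation (\<lambda>\<omega>. (U j \<omega>)\<^sup>2) \<le> K0"
  using X_init(3) V_sq[of j] V_sq_exp[of j] by (auto simp: U_def K0_def)

text \<open>Both factors are applied in turn: the first yields \<epsilon>, the second V. The
  equation for X holds at time 0 as well, by the initial values, and so the combined recursion
  starts at n = 1.\<close>

lemma AR_X:
  assumes n: "n \<ge> 1" and w: "\<omega> \<in> space M"
  shows "AR (\<lambda>k. X k \<omega>) (int n) = V n \<omega>"
proof -
  have tt: "(\<Sum>i\<in>{1..p}. tt i * X (k - int i) \<omega>) = (\<Sum>i=1..p. \<theta> $ (i - 1) * X (k - int i) \<omega>)" for k
    by (intro sum.cong) (auto simp: tt_def)
  have e: "X (int m) \<omega> - (\<Sum>i\<in>{1..p}. tt i * X (int m - int i) \<omega>) = \<epsilon> m \<omega>" for m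
  proof (cases "m = 0")
    case True
    have "(\<Sum>i\<in>{1..p}. tt i * X (int m - int i) \<omega>) = 0"
      using X_neg[OF _ _ w] True by (intro sum.neutral) auto
    then show ?thesis using True X_init(1)[OF w] by simp
  next
    case False
    then show ?thesis unfolding tt using X_rec[of m \<omega>] w by simp
  qed
  have m1: "int n - 1 = int (n - 1)" using n by simp
  have "AR (\<lambda>k. X k \<omega>) (int n) = (X (int n) \<omega> - (\<Sum>i\<in>{1..p}. tt i * X (int n - int i) \<omega>))
      - \<rho> * (X (int (n - 1)) \<omega> - (\<Sum>i\<in>{1..p}. tt i * X (int (n - 1) - int i) \<omega>))"
    unfolding AR_factor m1[symmetric]
    by (simp add: right_diff_distrib sum_subtractf sum_distrib_left algebra_simps)
  also have "\<dots> = V n \<omega>" unfolding e using eps_rec[OF n w] by simp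
  finally show ?thesis .
qed

text \<open>Both sides satisfy the same recursion with the same initial values; for k >= 1 it
  reaches back to - p at most. Any N >= k will do, since \<open>xpsi\<close> vanishes at negative
  times.\<close>

lemma X_repr:
  assumes w: "\<omega> \<in> space M" and k: "- int p \<le> k" "k \<le> int N"
  shows "X k \<omega> = (\<Sum>j\<le>N. U j \<omega> * xpsi (k - int j))"
  using k
proof (induction "nat (k + int p)" arbitrary: k rule: less_induct)
  case less
  have x0: "(\<Sum>j\<le>N. U j \<omega> * xpsi (k - int j)) = (if k = 0 then X 0 \<omega> else 0)" if "k \<le> 0" for k
  proof -
    have "(\<Sum>j\<le>N. U j \<omega> * xpsi (k - int j)) = (\<Sum>j\<le>N. if j = 0 then U j \<omega> * xpsi k else 0)"
      using that by (intro sum.cong) (auto simp: xpsi_def)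
    then show ?thesis using that by (auto simp: xpsi_def U_def)
  qed
  show ?case
  proof (cases "k \<le> 0")
    case True
    then show ?thesis using x0[OF True] X_neg[of "nat (- k)" \<omega>] w less.prems by auto
  next
    case False
    define n where "n = nat k"
    have n: "k = int n" "n \<ge> 1" "n \<le> N" using False less.prems by (auto simp: n_def)
    have eqn: "x k = AR x k - (\<Sum>i\<in>{1..p+1}. a i * x (k - int i))" for x :: "int \<Rightarrow> real"
    proof -
      have "{..p+1} = insert 0 {1..p+1}" by auto
      then show ?thesis by (simp add: AR_def)
    qed
    let ?R = "\<lambda>k. \<Sum>j\<le>N. U j \<omega> * xpsi (k - int j)"
    have "AR ?R k = (\<Sum>j\<le>N. U j \<omega> * AR xpsi (k - int j))"
    proof -
      have "AR ?R k = (\<Sum>i\<le>p+1. \<Sum>j\<le>N. U j \<omega> * (a i * xpsi (k - int j - int i)))"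
        unfolding AR_def sum_distrib_left by (intro sum.cong refl) (simp add: algebra_simps)
      also have "\<dots> = (\<Sum>j\<le>N. \<Sum>i\<le>p+1. U j \<omega> * (a i * xpsi (k - int j - int i)))" by (rule sum.swap)
      finally show ?thesis unfolding AR_def sum_distrib_left .
    qed
    also have "\<dots> = (\<Sum>j\<le>N. if j = n then U j \<omega> else 0)"
      unfolding AR_xpsi by (intro sum.cong) (auto simp: n)
    also have "\<dots> = V n \<omega>" using n by (simp add: U_def)
    also have "\<dots> = AR (\<lambda>k. X k \<omega>) k" using AR_X[OF n(2) w] by (simp add: n)
    finally have AReq: "AR (\<lambda>k. X k \<omega>) k = AR ?R k" by simp
    have "(\<Sum>i\<in>{1..p+1}. a i * X (k - int i) \<omega>) = (\<Sum>i\<in>{1..p+1}. a i * ?R (k - int i))"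
    proof (intro sum.cong refl arg_cong2[where f="(*)"])
      fix i assume i: "i \<in> {1..p+1}"
      show "X (k - int i) \<omega> = ?R (k - int i)"
        by (rule less.hyps) (use i n less.prems in auto)
    qed
    then show ?thesis using AReq eqn[of "\<lambda>k. X k \<omega>"] eqn[of ?R] by simp
  qed
qed

lemma X_rv [measurable]:
  assumes "k \<ge> - int p" shows "X k \<in> borel_measurable M"
proof -
  have "(\<lambda>\<omega>. \<Sum>j\<le>nat \<bar>k\<bar>. U j \<omega> * xpsi (k - int j)) \<in> borel_measurable M" by measurable
  moreover have "X k \<omega> = (\<Sum>j\<le>nat \<bar>k\<bar>. U j \<omega> * xpsi (k - int j))" if "\<omega> \<in> space M" for \<omega>
    by (rule X_repr[OF that assms]) simp
  ultimately show ?thesis by (simp cong: measurable_cong)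
qed

definition Psi :: real where "Psi = (\<Sum>n. \<bar>psi a n\<bar>)"

lemma sum_xpsi_le: "(\<Sum>j<N. \<bar>xpsi (int j - int d)\<bar>) \<le> Psi"
proof -
  have "(\<Sum>j<N. \<bar>xpsi (int j - int d)\<bar>) = (\<Sum>j\<in>{d..<N}. \<bar>xpsi (int j - int d)\<bar>)"
    by (intro sum.mono_neutral_right) (auto simp: xpsi_def)
  also have "\<dots> = (\<Sum>j<N - d. \<bar>psi a j\<bar>)"
    by (rule sum.reindex_bij_witness[of _ "\<lambda>n. n + d" "\<lambda>n. n - d"]) (auto simp: xpsi_def nat_diff_distrib)
  also have "\<dots> \<le> Psi" unfolding Psi_def by (rule sum_le_suminf[OF psi_summable]) auto
  finally show ?thesis .
qed

lemma Psi_nonneg: "Psi \<ge> 0" using sum_xpsi_le[of 0 0] by simp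

definition KX :: real where "KX = Psi * (Psi * K0)"

text \<open>Cauchy-Schwarz with the impulse response as weight reduces the bound to second moments
  of the single inputs, so that dependence between X 0 and V does no harm.\<close>

lemma X_sq:
  assumes k: "k \<ge> - int p"
  shows "integrable M (\<lambda>\<omega>. (X k \<omega>)\<^sup>2)" "expectation (\<lambda>\<omega>. (X k \<omega>)\<^sup>2) \<le> KX"
proof -
  define N where "N = nat \<bar>k\<bar>"
  define W where "W \<omega> = Psi * (\<Sum>j\<le>N. \<bar>xpsi (k - int j)\<bar> * (U j \<omega>)\<^sup>2)" for \<omega>
  have sp: "(\<Sum>j\<le>N. \<bar>xpsi (k - int j)\<bar>) \<le> Psi"
  proof (cases "k \<ge> 0")
    case True
    then have "(\<Sum>j\<le>N. \<bar>xpsi (k - int j)\<bar>) = (\<Sum>j\<le>N. \<bar>xpsi (int j)\<bar>)"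
      by (intro sum.reindex_bij_witness[of _ "\<lambda>j. N - j" "\<lambda>j. N - j"]) (auto simp: N_def)
    then show ?thesis using sum_xpsi_le[of 0 "Suc N"] by (simp add: lessThan_Suc_atMost)
  next
    case False
    then have "(\<Sum>j\<le>N. \<bar>xpsi (k - int j)\<bar>) = 0" by (intro sum.neutral) (auto simp: xpsi_def)
    then show ?thesis using Psi_nonneg by simp
  qed
  have iW: "integrable M W" unfolding W_def[abs_def] using U_sq by auto
  have le: "(X k \<omega>)\<^sup>2 \<le> W \<omega>" if w: "\<omega> \<in> space M" for \<omega>
  proof -
    \<comment> \<open>Half of each weight goes into either factor of the Cauchy-Schwarz inequality;
      the sign stays with the second.\<close>
    let ?s = "\<lambda>j. sqrt \<bar>xpsi (k - int j)\<bar>"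
    have "X k \<omega> = (\<Sum>j\<le>N. ?s j * (sgn (xpsi (k - int j)) * ?s j * U j \<omega>))"
    proof (subst X_repr[OF w k, of N])
      have "x = sqrt \<bar>x\<bar> * (sgn x * sqrt \<bar>x\<bar>)" for x :: real
        by (simp add: mult.left_commute sgn_mult_abs flip: real_sqrt_mult)
      then show "(\<Sum>j\<le>N. U j \<omega> * xpsi (k - int j)) = (\<Sum>j\<le>N. ?s j * (sgn (xpsi (k - int j)) * ?s j * U j \<omega>))"
        by (intro sum.cong refl) (metis mult.assoc mult.commute)
    qed (simp add: N_def)
    then have "(X k \<omega>)\<^sup>2 \<le> (\<Sum>j\<le>N. (?s j)\<^sup>2) * (\<Sum>j\<le>N. (sgn (xpsi (k - int j)) * ?s j * U j \<omega>)\<^sup>2)"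
      by (simp only: Cauchy_Schwarz_ineq_sum)
    also have "(\<Sum>j\<le>N. (sgn (xpsi (k - int j)) * ?s j * U j \<omega>)\<^sup>2) = (\<Sum>j\<le>N. \<bar>xpsi (k - int j)\<bar> * (U j \<omega>)\<^sup>2)"
      by (intro sum.cong) (auto simp: power_mult_distrib sgn_real_def)
    also have "(\<Sum>j\<le>N. (?s j)\<^sup>2) = (\<Sum>j\<le>N. \<bar>xpsi (k - int j)\<bar>)" by simp
    also have "(\<Sum>j\<le>N. \<bar>xpsi (k - int j)\<bar>) * (\<Sum>j\<le>N. \<bar>xpsi (k - int j)\<bar> * (U j \<omega>)\<^sup>2) \<le> W \<omega>"
      unfolding W_def by (intro mult_right_mono sp sum_nonneg) auto
    finally show ?thesis .
  qed
  show i: "integrable M (\<lambda>\<omega>. (X k \<omega>)\<^sup>2)"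
    by (rule Bochner_Integration.integrable_bound[OF iW])
       (use X_rv[OF k] le in \<open>auto intro!: AE_I2 intro: order_trans[OF _ abs_ge_self]\<close>)
  have "expectation (\<lambda>\<omega>. (X k \<omega>)\<^sup>2) \<le> expectation W"
    by (rule integral_mono[OF i iW le])
  also have "expectation W = Psi * (\<Sum>j\<le>N. \<bar>xpsi (k - int j)\<bar> * expectation (\<lambda>\<omega>. (U j \<omega>)\<^sup>2))"
    unfolding W_def[abs_def] using U_sq by simp
  also have "\<dots> \<le> Psi * (\<Sum>j\<le>N. \<bar>xpsi (k - int j)\<bar> * K0)"
    by (intro mult_left_mono sum_mono U_sq Psi_nonneg) auto
  also have "\<dots> \<le> KX"
    unfolding KX_def sum_distrib_right[symmetric]
    by (intro mult_left_mono mult_right_mono sp Psi_nonneg) (simp add: K0_def)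
  finally show "expectation (\<lambda>\<omega>. (X k \<omega>)\<^sup>2) \<le> KX" .
qed

lemma prod_L1:
  fixes Y Z :: "'w \<Rightarrow> real"
  assumes [measurable]: "Y \<in> borel_measurable M" "Z \<in> borel_measurable M"
    and i: "integrable M (\<lambda>\<omega>. (Y \<omega>)\<^sup>2)" "integrable M (\<lambda>\<omega>. (Z \<omega>)\<^sup>2)"
    and e: "expectation (\<lambda>\<omega>. (Y \<omega>)\<^sup>2) \<le> K" "expectation (\<lambda>\<omega>. (Z \<omega>)\<^sup>2) \<le> L"
  shows "integrable M (\<lambda>\<omega>. Y \<omega> * Z \<omega>)" "expectation (\<lambda>\<omega>. \<bar>Y \<omega> * Z \<omega>\<bar>) \<le> K + L"
proof -
  show yz: "integrable M (\<lambda>\<omega>. Y \<omega> * Z \<omega>)" by (rule integrable_mult_sq[OF assms(1-4)])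
  have "\<bar>Y \<omega> * Z \<omega>\<bar> \<le> (Y \<omega>)\<^sup>2 + (Z \<omega>)\<^sup>2" for \<omega>
    by (rule abs_mult_le_sum_squares)
  then have "expectation (\<lambda>\<omega>. \<bar>Y \<omega> * Z \<omega>\<bar>) \<le> expectation (\<lambda>\<omega>. (Y \<omega>)\<^sup>2 + (Z \<omega>)\<^sup>2)"
    using yz i by (intro integral_mono) auto
  also have "\<dots> \<le> K + L" using i e by simp
  finally show "expectation (\<lambda>\<omega>. \<bar>Y \<omega> * Z \<omega>\<bar>) \<le> K + L" .
qed

lemma inv_sqrt_lim: "(\<lambda>n. K / sqrt (real n)) \<longlonglongrightarrow> 0"
  by real_asymp

section \<open>Covariances of noise and process\<close>

definition ell :: "nat \<Rightarrow> nat \<Rightarrow> 'w \<Rightarrow> real" where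
  "ell d n \<omega> = (\<Sum>k=1..n. V k \<omega> * X (int k - int d) \<omega>) / real n"

text \<open>The coefficient of the product of two noise variables at time distance m in the
  w-combination of the sums at lags 1, ..., p + 1; the - 1 stems from these lags starting at
  1.\<close>

definition wg :: "(nat \<Rightarrow> real) \<Rightarrow> nat \<Rightarrow> real" where
  "wg w m = (\<Sum>i<p+1. w i * xpsi (int m - 1 - int i))"

lemma wg_Suc: "wg w (Suc j) = G (p + 1) w j"
  by (simp add: wg_def G_def)

lemma wg_sums: "(\<lambda>j. (wg w (Suc j))\<^sup>2) sums (\<Sum>i<p+1. \<Sum>j<p+1. w i * w j * l (nat \<bar>int i - int j\<bar>))"
  unfolding wg_Suc by (rule G_sums)

text \<open>The moving average representation is inserted. The terms with X 0 have L1 norms whose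
  sum is bounded by Psi times a constant, uniformly in n, so division by sqrt n removes
  them.\<close>

lemma sqn_ell_quad:
  "eqP M (\<lambda>n \<omega>. \<Sum>i<p+1. w i * sqn (ell (i + 1)) n \<omega>)
     (\<lambda>n \<omega>. noise.quad (\<lambda>k l. wg w (k - l)) n \<omega> / sqrt (real n))"
proof -
  define R where "R n \<omega> = (\<Sum>i<p+1. w i * ((\<Sum>k<n. xpsi (int k - int i) * (V (Suc k) \<omega> * X 0 \<omega>)) / sqrt (real n)))" for n \<omega>
  have VX: "integrable M (\<lambda>\<omega>. V (Suc k) \<omega> * X 0 \<omega>)" "expectation (\<lambda>\<omega>. \<bar>V (Suc k) \<omega> * X 0 \<omega>\<bar>) \<le> K0 + K0" for k
    using prod_L1[of "U (Suc k)" "U 0" K0 K0] U_sq[of "Suc k"] U_sq[of 0] by (auto simp: U_def)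
  have "oP M (\<lambda>n \<omega>. (\<Sum>k<n. xpsi (int k - int i) * (V (Suc k) \<omega> * X 0 \<omega>)) / sqrt (real n))" for i
  proof (rule oP_L1[OF _ _ inv_sqrt_lim[of "Psi * (K0 + K0)"]])
    fix n
    show "integrable M (\<lambda>\<omega>. (\<Sum>k<n. xpsi (int k - int i) * (V (Suc k) \<omega> * X 0 \<omega>)) / sqrt (real n))"
      using VX by simp
    have "expectation (\<lambda>\<omega>. \<bar>\<Sum>k<n. xpsi (int k - int i) * (V (Suc k) \<omega> * X 0 \<omega>)\<bar>)
        \<le> expectation (\<lambda>\<omega>. \<Sum>k<n. \<bar>xpsi (int k - int i)\<bar> * \<bar>V (Suc k) \<omega> * X 0 \<omega>\<bar>)"
    proof (rule integral_mono)
      show "\<bar>\<Sum>k<n. xpsi (int k - int i) * (V (Suc k) \<omega> * X 0 \<omega>)\<bar> \<le> (\<Sum>k<n. \<bar>xpsi (int k - int i)\<bar> * \<bar>V (Suc k) \<omega> * X 0 \<omega>\<bar>)" for \<omega>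
        by (rule order_trans[OF sum_abs]) (simp add: abs_mult)
    qed (use VX in auto)
    also have "\<dots> = (\<Sum>k<n. \<bar>xpsi (int k - int i)\<bar> * expectation (\<lambda>\<omega>. \<bar>V (Suc k) \<omega> * X 0 \<omega>\<bar>))"
      using VX by simp
    also have "\<dots> \<le> (\<Sum>k<n. \<bar>xpsi (int k - int i)\<bar> * (K0 + K0))"
      by (intro sum_mono mult_left_mono VX) auto
    also have "\<dots> \<le> Psi * (K0 + K0)"
      unfolding sum_distrib_right[symmetric] by (intro mult_right_mono sum_xpsi_le) (simp add: K0_def)
    finally have "expectation (\<lambda>\<omega>. \<bar>\<Sum>k<n. xpsi (int k - int i) * (V (Suc k) \<omega> * X 0 \<omega>)\<bar>) / sqrt (real n) \<le> Psi * (K0 + K0) / sqrt (real n)"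
      by (rule divide_right_mono) simp
    then show "expectation (\<lambda>\<omega>. \<bar>(\<Sum>k<n. xpsi (int k - int i) * (V (Suc k) \<omega> * X 0 \<omega>)) / sqrt (real n)\<bar>) \<le> Psi * (K0 + K0) / sqrt (real n)"
      by simp
  qed
  then have R: "oP M R" unfolding R_def[abs_def] by (intro oP_sum oP_cmult)
  show ?thesis
    unfolding eqP_def
  proof (rule oP_cong_ev[OF R])
    fix n \<omega> assume n: "n \<ge> (1::nat)" and w: "\<omega> \<in> space M"
    \<comment> \<open>The summand j = 0 of the representation is the one with X 0; the remaining
      indices are shifted to match the noise V (Suc l).\<close>
    have Xr: "X (int (Suc k) - int (i + 1)) \<omega> = xpsi (int k - int i) * X 0 \<omega> + (\<Sum>l<k. xpsi (int (k - l) - 1 - int i) * V (Suc l) \<omega>)"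
      if "i < p + 1" for i k
    proof -
      have "X (int (Suc k) - int (i + 1)) \<omega> = (\<Sum>j\<le>k. U j \<omega> * xpsi (int k - int i - int j))"
        using X_repr[OF w, of "int k - int i" k] that by simp
      also have "\<dots> = xpsi (int k - int i) * X 0 \<omega> + (\<Sum>l<k. U (Suc l) \<omega> * xpsi (int k - int i - int (Suc l)))"
        by (simp add: lessThan_Suc_atMost[symmetric] sum.lessThan_Suc_shift U_def del: sum.lessThan_Suc)
      also have "(\<Sum>l<k. U (Suc l) \<omega> * xpsi (int k - int i - int (Suc l))) = (\<Sum>l<k. xpsi (int (k - l) - 1 - int i) * V (Suc l) \<omega>)"
        by (intro sum.cong refl) (auto simp: U_def of_nat_diff algebra_simps)
      finally show ?thesis .
    qed
    have sq: "sqrt (real n) / real n = 1 / sqrt (real n)" using n by (simp add: real_div_sqrt field_simps)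
    have L: "sqn (ell (i + 1)) n \<omega> = (\<Sum>k<n. V (Suc k) \<omega> * X (int (Suc k) - int (i + 1)) \<omega>) / sqrt (real n)" for i
    proof -
      have "(\<Sum>k=1..n. V k \<omega> * X (int k - int (i + 1)) \<omega>) = (\<Sum>k<n. V (Suc k) \<omega> * X (int (Suc k) - int (i + 1)) \<omega>)"
        by (rule sum.reindex_bij_witness[of _ Suc "\<lambda>k. k - 1"]) auto
      then have "sqn (ell (i + 1)) n \<omega> = (sqrt (real n) / real n) * (\<Sum>k<n. V (Suc k) \<omega> * X (int (Suc k) - int (i + 1)) \<omega>)"
        by (simp add: sqn_def ell_def)
      then show ?thesis unfolding sq by simp
    qed
    have "(\<Sum>i<p+1. w i * sqn (ell (i + 1)) n \<omega>)
      = (\<Sum>i<p+1. w i * ((\<Sum>k<n. V (Suc k) \<omega> * (xpsi (int k - int i) * X 0 \<omega> + (\<Sum>l<k. xpsi (int (k - l) - 1 - int i) * V (Suc l) \<omega>))) / sqrt (real n)))"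
      unfolding L by (intro sum.cong refl arg_cong2[where f="(*)"] arg_cong2[where f="(/)"]) (rule Xr, simp)
    also have "\<dots> = R n \<omega> + (\<Sum>i<p+1. w i * ((\<Sum>k<n. V (Suc k) \<omega> * (\<Sum>l<k. xpsi (int (k - l) - 1 - int i) * V (Suc l) \<omega>)) / sqrt (real n)))"
      unfolding R_def sum.distrib[symmetric]
      by (intro sum.cong refl) (simp add: distrib_left sum.distrib add_divide_distrib mult_ac)
    also have "(\<Sum>i<p+1. w i * ((\<Sum>k<n. V (Suc k) \<omega> * (\<Sum>l<k. xpsi (int (k - l) - 1 - int i) * V (Suc l) \<omega>)) / sqrt (real n)))
      = (\<Sum>i<p+1. \<Sum>k<n. \<Sum>l<k. V (Suc k) \<omega> * (w i * xpsi (int (k - l) - 1 - int i) * V (Suc l) \<omega>)) / sqrt (real n)"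
      unfolding sum_distrib_left sum_divide_distrib by (intro sum.cong refl) (simp add: mult_ac)
    also have "(\<Sum>i<p+1. \<Sum>k<n. \<Sum>l<k. V (Suc k) \<omega> * (w i * xpsi (int (k - l) - 1 - int i) * V (Suc l) \<omega>))
      = (\<Sum>k<n. \<Sum>l<k. \<Sum>i<p+1. V (Suc k) \<omega> * (w i * xpsi (int (k - l) - 1 - int i) * V (Suc l) \<omega>))"
      by (subst sum.swap) (intro sum.cong refl sum.swap)
    also have "\<dots> = noise.quad (\<lambda>k l. wg w (k - l)) n \<omega>"
      unfolding noise.quad_def noise.lin_def wg_def sum_distrib_left sum_distrib_right ..
    finally show "(\<Sum>i<p+1. w i * sqn (ell (i + 1)) n \<omega>) - noise.quad (\<lambda>k l. wg w (k - l)) n \<omega> / sqrt (real n) = R n \<omega>"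
      by simp
  qed
qed

lemma wg_sq_sum: "(\<Sum>k<n. \<Sum>l<k. (wg w (k - l))\<^sup>2) \<le> real n * (\<Sum>j. (wg w (Suc j))\<^sup>2)"
proof -
  have "(\<Sum>l<k. (wg w (k - l))\<^sup>2) \<le> (\<Sum>j. (wg w (Suc j))\<^sup>2)" for k
  proof -
    have "(\<Sum>l<k. (wg w (k - l))\<^sup>2) = (\<Sum>j<k. (wg w (Suc j))\<^sup>2)"
      using noise.G2_eq[of "wg w" k] by (simp add: noise.G2_def)
    also have "\<dots> \<le> (\<Sum>j. (wg w (Suc j))\<^sup>2)"
      by (rule sum_le_suminf) (use wg_sums in \<open>auto simp: sums_iff\<close>)
    finally show ?thesis .
  qed
  then show ?thesis using sum_mono[of "{..<n}" "\<lambda>k. \<Sum>l<k. (wg w (k - l))\<^sup>2" "\<lambda>_. \<Sum>j. (wg w (Suc j))\<^sup>2"] by simp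
qed

text \<open>With w a unit vector the combination is a single sum, and the second moments of its
  quadratic form, divided by n, are bounded by the square sum of the coefficients.\<close>

lemma ell_OP: assumes d: "d \<in> {1..p+1}" shows "OP M (sqn (ell d))"
proof -
  define w where "w i = (if i = d - 1 then 1 else 0 :: real)" for i
  have e: "(\<Sum>i<p+1. w i * sqn (ell (i + 1)) n \<omega>) = sqn (ell d) n \<omega>" for n \<omega>
  proof -
    have "(\<Sum>i<p+1. w i * sqn (ell (i + 1)) n \<omega>) = (\<Sum>i<p+1. if i = d - 1 then sqn (ell (i + 1)) n \<omega> else 0)"
      by (intro sum.cong) (auto simp: w_def)
    then show ?thesis using d by auto
  qed
  let ?q = "\<lambda>n \<omega>. noise.quad (\<lambda>k l. wg w (k - l)) n \<omega> / sqrt (real n)"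
  have "OP M (\<lambda>n \<omega>. (?q n \<omega>)\<^sup>2)"
  proof (rule OP_L1)
    fix n
    show "integrable M (\<lambda>\<omega>. (?q n \<omega>)\<^sup>2)" using noise.quad_sq[of "\<lambda>k l. wg w (k - l)" n] by (simp add: power_divide)
    have "expectation (\<lambda>\<omega>. \<bar>(?q n \<omega>)\<^sup>2\<bar>) = (\<sigma>\<^sup>2)\<^sup>2 * ((\<Sum>k<n. \<Sum>l<k. (wg w (k - l))\<^sup>2) / real n)"
      using noise.quad_sq[of "\<lambda>k l. wg w (k - l)" n] by (simp add: power_divide)
    also have "\<dots> \<le> (\<sigma>\<^sup>2)\<^sup>2 * (\<Sum>j. (wg w (Suc j))\<^sup>2)"
    proof (rule mult_left_mono)
      show "(\<Sum>k<n. \<Sum>l<k. (wg w (k - l))\<^sup>2) / real n \<le> (\<Sum>j. (wg w (Suc j))\<^sup>2)"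
      proof (cases "n = 0")
        case True
        then show ?thesis using suminf_nonneg[OF sums_summable[OF wg_sums[of w]]] by simp
      next
        case False
        then show ?thesis using wg_sq_sum[of w n] by (simp add: divide_le_eq mult.commute)
      qed
    qed simp
    finally show "expectation (\<lambda>\<omega>. \<bar>(?q n \<omega>)\<^sup>2\<bar>) \<le> (\<sigma>\<^sup>2)\<^sup>2 * (\<Sum>j. (wg w (Suc j))\<^sup>2)" .
  qed
  then have "OP M ?q" by (rule OP_square)
  from eqP_OP[OF sqn_ell_quad[of w] this] show ?thesis unfolding e .
qed

text \<open>Chebyshev's inequality: the centred squares form another independent noise, with finite
  variance by the fourth moment, and \<open>lin_sq\<close> applies to it.\<close>

lemma V_sq_mean: "eqP M (\<lambda>n \<omega>. (\<Sum>k=1..n. (V k \<omega>)\<^sup>2) / real n) (\<lambda>n \<omega>. \<sigma>\<^sup>2)"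
proof -
  define W where "W n \<omega> = (V (Suc n) \<omega>)\<^sup>2 - \<sigma>\<^sup>2" for n \<omega>
  define s where "s = expectation (\<lambda>\<omega>. (W 0 \<omega>)\<^sup>2)"
  have [measurable]: "W n \<in> borel_measurable M" for n unfolding W_def[abs_def] by simp
  have id: "distr M borel (W n) = distr M borel (W 0)" for n
  proof -
    have "distr M borel (W n) = distr (distr M borel (V (Suc n))) borel (\<lambda>x. x\<^sup>2 - \<sigma>\<^sup>2)" for n
      by (subst distr_distr) (auto simp: comp_def W_def[abs_def])
    then show ?thesis using V_ident[of "Suc n"] by simp
  qed
  have isq: "integrable M (\<lambda>\<omega>. (W n \<omega>)\<^sup>2)" for n
  proof -
    have "(W n \<omega>)\<^sup>2 = (V (Suc n) \<omega>) ^ 4 - 2 * \<sigma>\<^sup>2 * (V (Suc n) \<omega>)\<^sup>2 + (\<sigma>\<^sup>2)\<^sup>2" for \<omega>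
      by (simp add: W_def power2_diff flip: power_mult)
    then show ?thesis using V_fourth[of "Suc n"] V_sq[of "Suc n"] by simp
  qed
  have "iid_noise M W s"
  proof
    show "indep_vars (\<lambda>_. borel) W UNIV"
      unfolding W_def[abs_def]
      by (rule indep_vars_compose2[where Y="\<lambda>_ x. x\<^sup>2 - \<sigma>\<^sup>2" and X="\<lambda>n. V (Suc n)", OF noise.indep]) simp
    show "expectation (W n) = 0" for n
      using V_sq[of "Suc n"] V_sq_exp[of "Suc n"] by (simp add: W_def[abs_def] prob_space)
    show "expectation (\<lambda>\<omega>. (W n \<omega>)\<^sup>2) = s" for n
    proof -
      have "integral\<^sup>L (distr M borel (W n)) (\<lambda>x. x\<^sup>2) = integral\<^sup>L (distr M borel (W 0)) (\<lambda>x. x\<^sup>2)"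
        by (simp only: id[of n])
      then show ?thesis by (simp add: integral_distr s_def)
    qed
  qed (rule id isq)+
  then interpret W: iid_noise M W s .
  have "oP M (\<lambda>n \<omega>. (W.lin (\<lambda>_. 1) n \<omega> / real n)\<^sup>2)"
  proof (rule oP_L1)
    fix n
    show "integrable M (\<lambda>\<omega>. (W.lin (\<lambda>_. 1) n \<omega> / real n)\<^sup>2)"
      using W.lin_sq[of "\<lambda>_. 1" n] by (simp add: power_divide)
    show "expectation (\<lambda>\<omega>. \<bar>(W.lin (\<lambda>_. 1) n \<omega> / real n)\<^sup>2\<bar>) \<le> s / real n"
      using W.lin_sq[of "\<lambda>_. 1" n] by (simp add: power_divide power2_eq_square)
    show "(\<lambda>n. s / real n) \<longlonglongrightarrow> 0" by real_asymp
  qed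
  then have "oP M (\<lambda>n \<omega>. W.lin (\<lambda>_. 1) n \<omega> / real n)" by (rule oP_square)
  then show ?thesis
    unfolding eqP_def
  proof (rule oP_cong_ev)
    fix n \<omega> assume "n \<ge> (1::nat)"
    have "(\<Sum>k=1..n. (V k \<omega>)\<^sup>2) = (\<Sum>k<n. (V (Suc k) \<omega>)\<^sup>2)"
      by (rule sum.reindex_bij_witness[of _ Suc "\<lambda>k. k - 1"]) auto
    then show "(\<Sum>k=1..n. (V k \<omega>)\<^sup>2) / real n - \<sigma>\<^sup>2 = W.lin (\<lambda>_. 1) n \<omega> / real n"
      using \<open>n \<ge> 1\<close> by (simp add: W.lin_def W_def sum_subtractf diff_divide_distrib)
  qed
qed

lemma ell_oP: "d \<in> {1..p+1} \<Longrightarrow> oP M (ell d)"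
  by (rule OP_sqn_imp[OF ell_OP])

lemma AR_split: "AR x k = x k + (\<Sum>i\<in>{1..p+1}. a i * x (k - int i))"
proof -
  have "{..p+1} = insert 0 {1..p+1}" by auto
  then show ?thesis by (simp add: AR_def)
qed

text \<open>Solving the recursion for X k gives V k X k as the square of V k minus terms at lags 1,
  ..., p + 1, which are negligible on average.\<close>

lemma ell_0: "eqP M (ell 0) (\<lambda>n \<omega>. \<sigma>\<^sup>2)"
proof -
  have "eqP M (\<lambda>n \<omega>. (\<Sum>k=1..n. (V k \<omega>)\<^sup>2) / real n - (\<Sum>i\<in>{1..p+1}. a i * ell i n \<omega>)) (\<lambda>n \<omega>. \<sigma>\<^sup>2 - 0)"
  proof (intro eqP_diff V_sq_mean)
    have "oP M (\<lambda>n \<omega>. \<Sum>i\<in>{1..p+1}. a i * ell i n \<omega>)" by (intro oP_sum oP_cmult ell_oP)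
    then show "eqP M (\<lambda>n \<omega>. \<Sum>i\<in>{1..p+1}. a i * ell i n \<omega>) (\<lambda>n \<omega>. 0)"
      unfolding eqP_def by (simp only: diff_zero)
  qed
  then show ?thesis
  proof (rule eqP_cong_ev)
    fix n \<omega> assume "n \<ge> (1::nat)" and w: "\<omega> \<in> space M"
    have "(\<Sum>k=1..n. V k \<omega> * X (int k - int 0) \<omega>) = (\<Sum>k=1..n. (V k \<omega>)\<^sup>2 - (\<Sum>i\<in>{1..p+1}. a i * (V k \<omega> * X (int k - int i) \<omega>)))"
    proof (rule sum.cong[OF refl])
      fix k assume "k \<in> {1..n}"
      then have "X (int k) \<omega> = V k \<omega> - (\<Sum>i\<in>{1..p+1}. a i * X (int k - int i) \<omega>)"
        using AR_X[of k \<omega>] w AR_split[of "\<lambda>k. X k \<omega>" "int k"] by simp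
      then have "V k \<omega> * X (int k - int 0) \<omega> = V k \<omega> * (V k \<omega> - (\<Sum>i\<in>{1..p+1}. a i * X (int k - int i) \<omega>))"
        by simp
      also have "\<dots> = (V k \<omega>)\<^sup>2 - (\<Sum>i\<in>{1..p+1}. a i * (V k \<omega> * X (int k - int i) \<omega>))"
        by (simp only: right_diff_distrib power2_eq_square sum_distrib_left mult.left_commute)
      finally show "V k \<omega> * X (int k - int 0) \<omega> = (V k \<omega>)\<^sup>2 - (\<Sum>i\<in>{1..p+1}. a i * (V k \<omega> * X (int k - int i) \<omega>))" .
    qed
    also have "\<dots> = (\<Sum>k=1..n. (V k \<omega>)\<^sup>2) - (\<Sum>i\<in>{1..p+1}. a i * (\<Sum>k=1..n. V k \<omega> * X (int k - int i) \<omega>))"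
      unfolding sum_subtractf sum_distrib_left by (simp only: sum.swap[of _ "{1..p+1}"])
    finally have e: "(\<Sum>k=1..n. V k \<omega> * X (int k - int 0) \<omega>)
        = (\<Sum>k=1..n. (V k \<omega>)\<^sup>2) - (\<Sum>i\<in>{1..p+1}. a i * (\<Sum>k=1..n. V k \<omega> * X (int k - int i) \<omega>))" .
    have "ell 0 n \<omega> = (\<Sum>k=1..n. (V k \<omega>)\<^sup>2) / real n
        - (\<Sum>i\<in>{1..p+1}. a i * (\<Sum>k=1..n. V k \<omega> * X (int k - int i) \<omega>)) / real n"
      unfolding ell_def e by (rule diff_divide_distrib)
    also have "(\<Sum>i\<in>{1..p+1}. a i * (\<Sum>k=1..n. V k \<omega> * X (int k - int i) \<omega>)) / real n = (\<Sum>i\<in>{1..p+1}. a i * ell i n \<omega>)"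
      by (simp only: ell_def sum_divide_distrib[where A="{1..p+1}"] times_divide_eq_right)
    finally show "ell 0 n \<omega> = (\<Sum>k=1..n. (V k \<omega>)\<^sup>2) / real n - (\<Sum>i\<in>{1..p+1}. a i * ell i n \<omega>)" .
  qed simp
qed

text \<open>Both lags are kept, since the sums in the estimators have this shape exactly; dependence
  on the difference of the lags alone holds only up to boundary terms.\<close>

definition ch :: "nat \<Rightarrow> nat \<Rightarrow> nat \<Rightarrow> 'w \<Rightarrow> real" where
  "ch i j n \<omega> = (\<Sum>k=1..n. X (int k - int i) \<omega> * X (int k - int j) \<omega>) / real n"

lemma ch_commute: "ch i j = ch j i"
  by (auto simp: ch_def fun_eq_iff mult.commute)

lemma ch_AR:
  assumes "\<omega> \<in> space M" shows "(\<Sum>i\<le>p+1. a i * ch i d n \<omega>) = ell d n \<omega>"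
proof -
  have "(\<Sum>i\<le>p+1. a i * ch i d n \<omega>) = (\<Sum>i\<le>p+1. \<Sum>k=1..n. a i * X (int k - int i) \<omega> * X (int k - int d) \<omega>) / real n"
    unfolding ch_def by (simp only: sum_divide_distrib sum_distrib_left times_divide_eq_right mult.assoc)
  also have "(\<Sum>i\<le>p+1. \<Sum>k=1..n. a i * X (int k - int i) \<omega> * X (int k - int d) \<omega>)
      = (\<Sum>k=1..n. AR (\<lambda>k. X k \<omega>) (int k) * X (int k - int d) \<omega>)"
    unfolding AR_def sum_distrib_right by (rule sum.swap)
  also have "\<dots> = (\<Sum>k=1..n. V k \<omega> * X (int k - int d) \<omega>)"
    using AR_X assms by (intro sum.cong) auto
  finally show ?thesis by (simp add: ell_def)
qed

text \<open>A common shift of both lags changes the sum by two boundary products, each bounded in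
  L1, and 1 / sqrt n is left after scaling. For i, j <= p the products at time 0 involve prescribed
  initial values only.\<close>

lemma ch_shift:
  assumes "i \<le> p" "j \<le> p"
  shows "eqP M (sqn (ch (i + 1) (j + 1))) (sqn (ch i j))"
proof -
  have P: "integrable M (\<lambda>\<omega>. X k \<omega> * X m \<omega>)" "expectation (\<lambda>\<omega>. \<bar>X k \<omega> * X m \<omega>\<bar>) \<le> KX + KX"
    if "k \<ge> - int p" "m \<ge> - int p" for k m
    by (rule prod_L1; use X_rv X_sq that in auto)+
  let ?E = "\<lambda>n \<omega>. X (- int i) \<omega> * X (- int j) \<omega> - X (int n - int i) \<omega> * X (int n - int j) \<omega>"
  have "oP M (\<lambda>n \<omega>. ?E n \<omega> / sqrt (real n))"
  proof (rule oP_L1[OF _ _ inv_sqrt_lim[of "4 * KX"]])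
    fix n
    have k: "- int i \<ge> - int p" "- int j \<ge> - int p" "int n - int i \<ge> - int p" "int n - int j \<ge> - int p"
      using assms by auto
    have iE: "integrable M (?E n)" using P k by simp
    then show "integrable M (\<lambda>\<omega>. ?E n \<omega> / sqrt (real n))" by simp
    have "expectation (\<lambda>\<omega>. \<bar>?E n \<omega>\<bar>) \<le> expectation (\<lambda>\<omega>. \<bar>X (- int i) \<omega> * X (- int j) \<omega>\<bar> + \<bar>X (int n - int i) \<omega> * X (int n - int j) \<omega>\<bar>)"
    proof (rule integral_mono)
      show "\<bar>?E n \<omega>\<bar> \<le> \<bar>X (- int i) \<omega> * X (- int j) \<omega>\<bar> + \<bar>X (int n - int i) \<omega> * X (int n - int j) \<omega>\<bar>" for \<omega>
        by (rule abs_triangle_ineq4)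
    qed (use P k iE in auto)
    also have "\<dots> = expectation (\<lambda>\<omega>. \<bar>X (- int i) \<omega> * X (- int j) \<omega>\<bar>) + expectation (\<lambda>\<omega>. \<bar>X (int n - int i) \<omega> * X (int n - int j) \<omega>\<bar>)"
      using P k by simp
    also have "\<dots> \<le> (KX + KX) + (KX + KX)" using P k by (intro add_mono) auto
    finally have "expectation (\<lambda>\<omega>. \<bar>?E n \<omega>\<bar>) / sqrt (real n) \<le> 4 * KX / sqrt (real n)"
      by (intro divide_right_mono) auto
    then show "expectation (\<lambda>\<omega>. \<bar>?E n \<omega> / sqrt (real n)\<bar>) \<le> 4 * KX / sqrt (real n)" by simp
  qed
  then show ?thesis
    unfolding eqP_def
  proof (rule oP_cong_ev)
    fix n \<omega> assume n: "n \<ge> (1::nat)"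
    define f where "f k = X (int k - int i) \<omega> * X (int k - int j) \<omega>" for k
    have "(\<Sum>k=1..n. X (int k - int (i + 1)) \<omega> * X (int k - int (j + 1)) \<omega>) = (\<Sum>k<n. f k)"
      by (rule sum.reindex_bij_witness[of _ Suc "\<lambda>k. k - 1"]) (auto simp: f_def of_nat_diff algebra_simps)
    moreover have "(\<Sum>k=1..n. f k) = (\<Sum>k<n. f (Suc k))"
      by (rule sum.reindex_bij_witness[of _ Suc "\<lambda>k. k - 1"]) auto
    moreover have "(\<Sum>k<n. f (Suc k)) - (\<Sum>k<n. f k) = f n - f 0"
      by (simp add: sum_subtractf[symmetric] sum_lessThan_telescope)
    ultimately have d: "ch (i + 1) (j + 1) n \<omega> - ch i j n \<omega> = (f 0 - f n) / real n"
      by (simp add: ch_def f_def[symmetric] diff_divide_distrib[symmetric])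
    have sq: "sqrt (real n) / real n = 1 / sqrt (real n)" using n by (simp add: field_simps)
    have "sqn (ch (i + 1) (j + 1)) n \<omega> - sqn (ch i j) n \<omega> = sqrt (real n) * (ch (i + 1) (j + 1) n \<omega> - ch i j n \<omega>)"
      by (simp only: sqn_def right_diff_distrib)
    also have "\<dots> = sqrt (real n) / real n * (f 0 - f n)" unfolding d by simp
    also have "\<dots> = ?E n \<omega> / sqrt (real n)" unfolding sq by (simp add: f_def)
    finally show "sqn (ch (i + 1) (j + 1)) n \<omega> - sqn (ch i j) n \<omega> = ?E n \<omega> / sqrt (real n)" .
  qed
qed

lemma ch_toeplitz:
  assumes "i \<le> p + 1" "j \<le> p + 1"
  shows "eqP M (sqn (ch i j)) (sqn (ch 0 (nat \<bar>int i - int j\<bar>)))"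
proof -
  have main: "j + m \<le> p + 1 \<Longrightarrow> eqP M (sqn (ch m (j + m))) (sqn (ch 0 j))" for j m
  proof (induction m)
    case 0
    show ?case by (simp add: eqP_refl)
  next
    case (Suc m)
    have "eqP M (sqn (ch (m + 1) (j + m + 1))) (sqn (ch m (j + m)))"
      using Suc.prems by (intro ch_shift) auto
    then have "eqP M (sqn (ch (m + 1) (j + m + 1))) (sqn (ch 0 j))"
      by (rule eqP_trans) (rule Suc.IH, use Suc.prems in simp)
    then show ?case by simp
  qed
  show ?thesis
  proof (cases "i \<le> j")
    case True
    then have "nat \<bar>int i - int j\<bar> = j - i" by auto
    then show ?thesis using main[of "j - i" i] True assms by simp
  next
    case False
    then have "nat \<bar>int i - int j\<bar> = i - j" by auto
    then show ?thesis using main[of "i - j" j] False assms by (simp add: ch_commute[of i j])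
  qed
qed

section \<open>Yule-Walker equations for the sample autocovariances\<close>

abbreviation cc :: "nat \<Rightarrow> nat \<Rightarrow> 'w \<Rightarrow> real" where "cc h \<equiv> ch 0 h"

text \<open>The equation \<open>ch_AR\<close> is exact for pairs of lags. Replacing each pair by the
  difference of its lags costs o(1 / sqrt n), so the equation survives the scaling.\<close>

lemma cc_AR:
  assumes "d \<le> p + 1"
  shows "eqP M (sqn (\<lambda>n \<omega>. \<Sum>i\<le>p+1. a i * cc (nat \<bar>int d - int i\<bar>) n \<omega>)) (sqn (ell d))"
proof -
  have "eqP M (\<lambda>n \<omega>. \<Sum>i\<le>p+1. a i * sqn (cc (nat \<bar>int d - int i\<bar>)) n \<omega>) (\<lambda>n \<omega>. \<Sum>i\<le>p+1. a i * sqn (ch i d) n \<omega>)"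
  proof (intro eqP_sum eqP_cmult)
    fix i assume "i \<in> {..p+1}"
    then show "eqP M (sqn (cc (nat \<bar>int d - int i\<bar>))) (sqn (ch i d))"
      using eqP_sym[OF ch_toeplitz[of i d]] assms by (simp add: abs_minus_commute)
  qed
  then show ?thesis
  proof (rule eqP_cong_ev)
    fix n \<omega> assume w: "\<omega> \<in> space M"
    show "sqn (\<lambda>n \<omega>. \<Sum>i\<le>p+1. a i * cc (nat \<bar>int d - int i\<bar>) n \<omega>) n \<omega>
        = (\<Sum>i\<le>p+1. a i * sqn (cc (nat \<bar>int d - int i\<bar>)) n \<omega>)"
      by (simp only: sqn_def sum_distrib_left mult.left_commute)
    show "sqn (ell d) n \<omega> = (\<Sum>i\<le>p+1. a i * sqn (ch i d) n \<omega>)"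
      by (simp only: sqn_def ch_AR[OF w, symmetric] sum_distrib_left mult.left_commute)
  qed
qed

lemma cc_lim:
  assumes "h \<le> p + 1" shows "eqP M (cc h) (\<lambda>n \<omega>. \<sigma>\<^sup>2 * l h)"
proof -
  obtain N where N: "\<And>f h. h \<le> p + 1 \<Longrightarrow> f h = (\<Sum>d<p+2. N h d * (\<Sum>i\<le>p+1. a i * f (nat \<bar>int d - int i\<bar>)))"
    using B_solve by blast
  have lim: "eqP M (\<lambda>n \<omega>. \<Sum>i\<le>p+1. a i * cc (nat \<bar>int d - int i\<bar>) n \<omega>) (\<lambda>n \<omega>. \<sigma>\<^sup>2 * (\<Sum>i\<le>p+1. a i * l (nat \<bar>int d - int i\<bar>)))"
    if "d \<le> p + 1" for d
  proof -
    have "eqP M (ell d) (\<lambda>n \<omega>. \<sigma>\<^sup>2 * (if d = 0 then 1 else 0))"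
      using ell_0 ell_oP[of d] that by (cases "d = 0") (auto simp: eqP_def)
    then show ?thesis unfolding l_AR by (rule eqP_trans[OF sqn_eqP_imp[OF cc_AR[OF that]]])
  qed
  have "eqP M (\<lambda>n \<omega>. \<Sum>d<p+2. N h d * (\<Sum>i\<le>p+1. a i * cc (nat \<bar>int d - int i\<bar>) n \<omega>))
      (\<lambda>n \<omega>. \<Sum>d<p+2. N h d * (\<sigma>\<^sup>2 * (\<Sum>i\<le>p+1. a i * l (nat \<bar>int d - int i\<bar>))))"
    by (intro eqP_sum eqP_cmult lim) auto
  moreover have "(\<Sum>d<p+2. N h d * (\<sigma>\<^sup>2 * (\<Sum>i\<le>p+1. a i * l (nat \<bar>int d - int i\<bar>)))) = \<sigma>\<^sup>2 * l h"
    by (simp only: N[OF assms, of l] sum_distrib_left mult.left_commute)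
  moreover have "(\<Sum>d<p+2. N h d * (\<Sum>i\<le>p+1. a i * cc (nat \<bar>int d - int i\<bar>) n \<omega>)) = cc h n \<omega>" for n \<omega>
    by (rule N[OF assms, of "\<lambda>h. cc h n \<omega>", symmetric])
  ultimately show ?thesis by (simp only:)
qed

end

section \<open>The estimators\<close>

lemma S_mat_dim: "S \<in> carrier_mat p p \<Longrightarrow> S_mat p S x n \<in> carrier_mat p p"
  by (simp add: S_mat_def)

lemma S_mat_index:
  assumes "S \<in> carrier_mat p p" "i < p" "j < p"
  shows "S_mat p S x n $$ (i, j) = (\<Sum>k=0..n. x (int k - int i) * x (int k - int j)) + S $$ (i, j)"
  using assms by (simp add: S_mat_def Phi_def)

text \<open>The form of S_n is a sum of squares plus the form of the positive definite S.
  Invertibility thus holds for every sample path, and the normal equations hold without an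
  exceptional event.\<close>

lemma S_mat_inj:
  assumes S: "sym_pos_def p S" and v: "v \<in> carrier_vec p" and z: "S_mat p S x n *\<^sub>v v = 0\<^sub>v p"
  shows "v = 0\<^sub>v p"
proof (rule ccontr)
  assume "v \<noteq> 0\<^sub>v p"
  have Sd: "S \<in> carrier_mat p p" using S by (simp add: sym_pos_def_def)
  have "0 < v \<bullet> (S *\<^sub>v v)" using S v \<open>v \<noteq> 0\<^sub>v p\<close> by (simp add: sym_pos_def_def)
  then have pos: "0 < (\<Sum>i<p. \<Sum>j<p. v $ i * v $ j * S $$ (i, j))"
    by (simp only: scalar_prod_mult_mat_vec[OF v Sd])
  have "v \<bullet> (S_mat p S x n *\<^sub>v v) = 0" unfolding z using v by simp
  then have "0 = (\<Sum>i<p. \<Sum>j<p. v $ i * v $ j * S_mat p S x n $$ (i, j))"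
    by (simp only: scalar_prod_mult_mat_vec[OF v S_mat_dim[OF Sd]])
  also have "\<dots> = (\<Sum>i<p. \<Sum>j<p. (\<Sum>k=0..n. (v $ i * x (int k - int i)) * (v $ j * x (int k - int j))) + v $ i * v $ j * S $$ (i, j))"
    by (intro sum.cong refl) (simp add: S_mat_index[OF Sd] distrib_left sum_distrib_left mult_ac)
  also have "\<dots> = (\<Sum>i<p. \<Sum>j<p. \<Sum>k=0..n. (v $ i * x (int k - int i)) * (v $ j * x (int k - int j))) + (\<Sum>i<p. \<Sum>j<p. v $ i * v $ j * S $$ (i, j))"
    by (simp only: sum.distrib)
  also have "(\<Sum>i<p. \<Sum>j<p. \<Sum>k=0..n. (v $ i * x (int k - int i)) * (v $ j * x (int k - int j)))
      = (\<Sum>i<p. \<Sum>k=0..n. \<Sum>j<p. (v $ i * x (int k - int i)) * (v $ j * x (int k - int j)))"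
    by (rule sum.cong[OF refl]) (rule sum.swap)
  also have "\<dots> = (\<Sum>k=0..n. \<Sum>i<p. \<Sum>j<p. (v $ i * x (int k - int i)) * (v $ j * x (int k - int j)))"
    by (rule sum.swap)
  also have "\<dots> = (\<Sum>k=0..n. (\<Sum>i<p. v $ i * x (int k - int i))\<^sup>2)"
    by (simp only: power2_eq_square sum_product)
  finally have "(\<Sum>k=0..n. (\<Sum>i<p. v $ i * x (int k - int i))\<^sup>2) + (\<Sum>i<p. \<Sum>j<p. v $ i * v $ j * S $$ (i, j)) = 0" ..
  moreover have "0 \<le> (\<Sum>k=0..n. (\<Sum>i<p. v $ i * x (int k - int i))\<^sup>2)" by (intro sum_nonneg) simp
  ultimately show False using pos by linarith
qed

lemma S_mat_inv:
  assumes "sym_pos_def p S"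
  shows "mat_inv (S_mat p S x n) \<in> carrier_mat p p"
    and "S_mat p S x n * mat_inv (S_mat p S x n) = 1\<^sub>m p"
    and "mat_inv (S_mat p S x n) * S_mat p S x n = 1\<^sub>m p"
    and "det (S_mat p S x n) \<noteq> 0"
proof -
  have Sd: "S \<in> carrier_mat p p" using assms by (simp add: sym_pos_def_def)
  note inv = mat_inv_inverse[OF S_mat_dim[OF Sd, of x n]]
  show "mat_inv (S_mat p S x n) \<in> carrier_mat p p" "S_mat p S x n * mat_inv (S_mat p S x n) = 1\<^sub>m p"
    "mat_inv (S_mat p S x n) * S_mat p S x n = 1\<^sub>m p" "det (S_mat p S x n) \<noteq> 0"
    by (rule inv; rule S_mat_inj[OF assms]; assumption)+
qed

lemma theta_hat_dim: "sym_pos_def p S \<Longrightarrow> theta_hat p S x n \<in> carrier_vec p"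
  unfolding theta_hat_def by (rule mult_mat_vec_carrier[OF S_mat_inv(1)]) simp_all

lemma theta_hat_normal_eq:
  assumes S: "sym_pos_def p S" and i: "i < p"
  shows "(\<Sum>j<p. S_mat p S x (n - 1) $$ (i, j) * theta_hat p S x n $ j) = (\<Sum>k=1..n. Phi p x (int k - 1) $ i * x (int k))"
proof -
  have Sd: "S \<in> carrier_mat p p" using S by (simp add: sym_pos_def_def)
  let ?v = "vec p (\<lambda>i. \<Sum>k=1..n. Phi p x (int k - 1) $ i * x (int k))"
  have v: "?v \<in> carrier_vec p" by simp
  have "S_mat p S x (n - 1) *\<^sub>v theta_hat p S x n = (S_mat p S x (n - 1) * mat_inv (S_mat p S x (n - 1))) *\<^sub>v ?v"
    unfolding theta_hat_def by (rule assoc_mult_mat_vec[OF S_mat_dim[OF Sd] S_mat_inv(1)[OF S] v, symmetric])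
  also have "\<dots> = ?v" unfolding S_mat_inv(2)[OF S] by (rule one_mult_mat_vec[OF v])
  finally have "(S_mat p S x (n - 1) *\<^sub>v theta_hat p S x n) $ i = ?v $ i" by (rule arg_cong)
  then show ?thesis using i by (simp only: mat_vec_index_sum[OF S_mat_dim[OF Sd] theta_hat_dim[OF S] i] index_vec)
qed

context ar_process
begin

lemma S_dim: "S \<in> carrier_mat p p" using S_pd by (simp add: sym_pos_def_def)

definition th :: "nat \<Rightarrow> nat \<Rightarrow> 'w \<Rightarrow> real" where
  "th j n \<omega> = theta_hat p S (\<lambda>k. X k \<omega>) n $ j"

text \<open>The matrix S_(n-1) divided by n; the lags are raised by 1 because the regressor of X k
  is Phi at time k - 1.\<close>

definition A :: "nat \<Rightarrow> nat \<Rightarrow> nat \<Rightarrow> 'w \<Rightarrow> real" where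
  "A i j n \<omega> = ch (i + 1) (j + 1) n \<omega> + S $$ (i, j) / real n"

lemma normal_eq:
  assumes n: "n \<ge> 1" and i: "i < p"
  shows "(\<Sum>j<p. A i j n \<omega> * th j n \<omega>) = ch (i + 1) 0 n \<omega>"
proof -
  let ?x = "\<lambda>k. X k \<omega>"
  have "S_mat p S ?x (n - 1) $$ (i, j) = real n * A i j n \<omega>" if "j < p" for j
  proof -
    have "(\<Sum>k=0..n - 1. X (int k - int i) \<omega> * X (int k - int j) \<omega>)
        = (\<Sum>k=1..n. X (int k - int (i + 1)) \<omega> * X (int k - int (j + 1)) \<omega>)"
      using n by (intro sum.reindex_bij_witness[of _ "\<lambda>k. k - 1" Suc]) (auto simp: of_nat_diff algebra_simps)
    then show ?thesis using n by (simp add: S_mat_index[OF S_dim i that] A_def ch_def distrib_left)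
  qed
  then have "(\<Sum>j<p. real n * A i j n \<omega> * th j n \<omega>) = (\<Sum>j<p. S_mat p S ?x (n - 1) $$ (i, j) * theta_hat p S ?x n $ j)"
    by (simp add: th_def)
  also have "\<dots> = (\<Sum>k=1..n. Phi p ?x (int k - 1) $ i * ?x (int k))" by (rule theta_hat_normal_eq[OF S_pd i])
  also have "\<dots> = real n * ch (i + 1) 0 n \<omega>"
    using i n by (simp add: ch_def Phi_def algebra_simps)
  finally have "real n * (\<Sum>j<p. A i j n \<omega> * th j n \<omega>) = real n * ch (i + 1) 0 n \<omega>"
    by (simp only: sum_distrib_left mult.assoc)
  then show ?thesis using n by simp
qed

lemma A_cc:
  assumes "i < p" "j < p"
  shows "eqP M (sqn (A i j)) (sqn (cc (nat \<bar>int i - int j\<bar>)))"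
proof -
  have "eqP M (sqn (ch (i + 1) (j + 1))) (sqn (cc (nat \<bar>int i - int j\<bar>)))"
    using ch_toeplitz[of "i + 1" "j + 1"] assms by simp
  moreover have "eqP M (\<lambda>n \<omega>. S $$ (i, j) / sqrt (real n)) (\<lambda>n \<omega>. 0)"
    unfolding eqP_def using oP_seq[OF inv_sqrt_lim] by simp
  ultimately have "eqP M (\<lambda>n \<omega>. sqn (ch (i + 1) (j + 1)) n \<omega> + S $$ (i, j) / sqrt (real n)) (\<lambda>n \<omega>. sqn (cc (nat \<bar>int i - int j\<bar>)) n \<omega> + 0)"
    by (rule eqP_add)
  then show ?thesis
  proof (rule eqP_cong_ev)
    fix n \<omega> assume n: "n \<ge> (1::nat)"
    have "sqrt (real n) / real n = 1 / sqrt (real n)" using n by (simp add: field_simps)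
    then have "sqrt (real n) * (S $$ (i, j) / real n) = S $$ (i, j) / sqrt (real n)"
      by (metis mult.commute mult_1 times_divide_eq_left times_divide_eq_right)
    then show "sqn (A i j) n \<omega> = sqn (ch (i + 1) (j + 1)) n \<omega> + S $$ (i, j) / sqrt (real n)"
      by (simp only: sqn_def A_def distrib_left)
  qed simp
qed

lemma A_lim:
  assumes "i < p" "j < p" shows "eqP M (A i j) (\<lambda>n \<omega>. \<sigma>\<^sup>2 * l (nat \<bar>int i - int j\<bar>))"
  using eqP_trans[OF sqn_eqP_imp[OF A_cc[OF assms]] cc_lim] assms by simp

definition theta_dev :: "nat \<Rightarrow> nat \<Rightarrow> 'w \<Rightarrow> real" where
  "theta_dev j = sqn (\<lambda>n \<omega>. th j n \<omega> - b j)"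

text \<open>The vector al (I - c J) (ell 1, ..., ell p), scaled: p - i is the lag that belongs to
  the mirrored index p - 1 - i.\<close>

definition rr :: "nat \<Rightarrow> nat \<Rightarrow> 'w \<Rightarrow> real" where
  "rr i n \<omega> = al * (sqn (ell (i + 1)) n \<omega> - c * sqn (ell (p - i)) n \<omega>)"

lemma rr_OP: "i < p \<Longrightarrow> OP M (rr i)"
  unfolding rr_def[abs_def] by (intro OP_cmult OP_diff ell_OP) auto

text \<open>For the sample covariances \<open>cc_AR\<close> reads (I + c J) y = (ell 1, ..., ell p)
  up to negligible terms, with y the vector of defects; \<open>flip_solve\<close> inverts this
  pathwise.\<close>

lemma yw_cc:
  assumes i: "i < p"
  shows "eqP M (sqn (\<lambda>n \<omega>. yw b (\<lambda>h. cc h n \<omega>) i)) (rr i)"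
proof -
  define q where "q i n \<omega> = yw b (\<lambda>h. cc h n \<omega>) i + c * yw b (\<lambda>h. cc h n \<omega>) (p - 1 - i)" for i n \<omega>
  have q: "eqP M (sqn (q i)) (sqn (ell (i + 1)))" if "i < p" for i
  proof -
    have "(\<Sum>k\<le>p+1. a k * cc (nat \<bar>int (i + 1) - int k\<bar>) n \<omega>) = q i n \<omega>" for n \<omega>
      unfolding q_def by (rule a_sum_yw[OF that, of "\<lambda>h. cc h n \<omega>"])
    then show ?thesis using cc_AR[of "i + 1"] that by (simp only: add_le_mono1 less_imp_le)
  qed
  have k: "p - 1 - i < p" "p - 1 - i + 1 = p - i" using i by auto
  have "eqP M (\<lambda>n \<omega>. al * (sqn (q i) n \<omega> - c * sqn (q (p - 1 - i)) n \<omega>)) (rr i)"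
    unfolding rr_def using q[OF i] q[OF k(1)] unfolding k(2) by (intro eqP_cmult eqP_diff)
  then show ?thesis
  proof (rule eqP_cong_ev)
    fix n \<omega>
    have "yw b (\<lambda>h. cc h n \<omega>) i = al * (q i n \<omega> - c * q (p - 1 - i) n \<omega>)"
      by (rule flip_solve[OF _ i]) (simp add: q_def)
    then have "sqn (\<lambda>n \<omega>. yw b (\<lambda>h. cc h n \<omega>) i) n \<omega> = sqrt (real n) * (al * (q i n \<omega> - c * q (p - 1 - i) n \<omega>))"
      by (simp only: sqn_def)
    then show "sqn (\<lambda>n \<omega>. yw b (\<lambda>h. cc h n \<omega>) i) n \<omega> = al * (sqn (q i) n \<omega> - c * sqn (q (p - 1 - i)) n \<omega>)"
      by (simp add: sqn_def algebra_simps)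
  qed simp
qed

text \<open>Subtracting A b from the normal equations leaves, on the right, the defects of
  \<open>theta_star\<close> in the sample Yule-Walker equations.\<close>

lemma theta_dev_system:
  assumes i: "i < p"
  shows "eqP M (\<lambda>n \<omega>. \<Sum>j<p. A i j n \<omega> * theta_dev j n \<omega>) (rr i)"
proof -
  have "eqP M (\<lambda>n \<omega>. sqn (ch (i + 1) 0) n \<omega> - (\<Sum>j<p. b j * sqn (A i j) n \<omega>))
     (\<lambda>n \<omega>. sqn (cc (i + 1)) n \<omega> - (\<Sum>j<p. b j * sqn (cc (nat \<bar>int i - int j\<bar>)) n \<omega>))"
    using ch_toeplitz[of "i + 1" 0] i by (intro eqP_diff eqP_sum eqP_cmult A_cc) (auto simp: nat_add_distrib)
  then have "eqP M (\<lambda>n \<omega>. \<Sum>j<p. A i j n \<omega> * theta_dev j n \<omega>) (sqn (\<lambda>n \<omega>. yw b (\<lambda>h. cc h n \<omega>) i))"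
  proof (rule eqP_cong_ev)
    fix n \<omega> assume n: "n \<ge> (1::nat)"
    have "(\<Sum>j<p. A i j n \<omega> * theta_dev j n \<omega>) = sqrt (real n) * ((\<Sum>j<p. A i j n \<omega> * th j n \<omega>) - (\<Sum>j<p. b j * A i j n \<omega>))"
      unfolding sum_subtractf[symmetric] sum_distrib_left by (intro sum.cong refl) (simp add: theta_dev_def sqn_def algebra_simps)
    then show "(\<Sum>j<p. A i j n \<omega> * theta_dev j n \<omega>) = sqn (ch (i + 1) 0) n \<omega> - (\<Sum>j<p. b j * sqn (A i j) n \<omega>)"
      unfolding normal_eq[OF n i] by (simp add: sqn_def right_diff_distrib sum_distrib_left mult.left_commute)
    show "sqn (\<lambda>n \<omega>. yw b (\<lambda>h. cc h n \<omega>) i) n \<omega> = sqn (cc (i + 1)) n \<omega> - (\<Sum>j<p. b j * sqn (cc (nat \<bar>int i - int j\<bar>)) n \<omega>)"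
      by (simp add: sqn_def yw_def right_diff_distrib sum_distrib_left mult_ac)
  qed
  then show ?thesis using yw_cc[OF i] by (rule eqP_trans)
qed

lemma theta_dev_lim0:
  assumes i: "i < p"
  shows "eqP M (theta_dev i) (\<lambda>n \<omega>. \<Sum>j<p. D i j / \<sigma>\<^sup>2 * rr j n \<omega>)" "OP M (theta_dev i)"
proof -
  have left: "(\<Sum>j<p. D i j / \<sigma>\<^sup>2 * (\<sigma>\<^sup>2 * l (nat \<bar>int j - int k\<bar>))) = (if i = k then 1 else 0)"
    if "i < p" "k < p" for i k
    using D_left[OF that] sigma_pos by simp
  show "eqP M (theta_dev i) (\<lambda>n \<omega>. \<Sum>j<p. D i j / \<sigma>\<^sup>2 * rr j n \<omega>)" "OP M (theta_dev i)"
    by (rule linear_system_eqP[where T="\<lambda>i j. \<sigma>\<^sup>2 * l (nat \<bar>int i - int j\<bar>)", OF A_lim left theta_dev_system rr_OP i], assumption+)+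
qed

lemmas theta_dev_OP = theta_dev_lim0(2)

text \<open>In P_B the factor I - c J stands to the left of the inverse Toeplitz matrix, in the
  solution of the system to its right. They commute, by persymmetry.\<close>

lemma theta_dev_lim:
  assumes i: "i < p"
  shows "eqP M (theta_dev i) (\<lambda>n \<omega>. \<Sum>d<p. PB_mat p \<theta> \<rho> $$ (i, d) / \<sigma>\<^sup>2 * sqn (ell (d + 1)) n \<omega>)"
  using theta_dev_lim0(1)[OF i]
proof (rule eqP_cong_ev)
  fix n \<omega>
  let ?L = "\<lambda>d. sqn (ell d) n \<omega>"
  have f: "(\<Sum>j<p. D i j * ?L (p - j)) = (\<Sum>j<p. D (p - 1 - i) j * ?L (j + 1))"
  proof -
    have "(\<Sum>j<p. D i j * ?L (p - j)) = (\<Sum>j<p. D i (p - 1 - j) * ?L (p - (p - 1 - j)))"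
      by (rule sum_flip[symmetric])
    also have "\<dots> = (\<Sum>j<p. D (p - 1 - i) j * ?L (j + 1))"
    proof (rule sum.cong[OF refl])
      fix j assume "j \<in> {..<p}"
      then have j: "j < p" "p - (p - 1 - j) = j + 1" by auto
      show "D i (p - 1 - j) * ?L (p - (p - 1 - j)) = D (p - 1 - i) j * ?L (j + 1)"
        unfolding j(2) D_flip[OF i j(1)] ..
    qed
    finally show ?thesis .
  qed
  have "(\<Sum>d<p. PB_mat p \<theta> \<rho> $$ (i, d) / \<sigma>\<^sup>2 * ?L (d + 1)) = (\<Sum>d<p. al / \<sigma>\<^sup>2 * (D i d * ?L (d + 1)) - al * c / \<sigma>\<^sup>2 * (D (p - 1 - i) d * ?L (d + 1)))"
    using i by (intro sum.cong refl) (simp add: PB_index diff_divide_distrib algebra_simps)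
  also have "\<dots> = al / \<sigma>\<^sup>2 * (\<Sum>d<p. D i d * ?L (d + 1)) - al * c / \<sigma>\<^sup>2 * (\<Sum>j<p. D i j * ?L (p - j))"
    unfolding f by (simp only: sum_subtractf sum_distrib_left)
  also have "\<dots> = (\<Sum>j<p. D i j / \<sigma>\<^sup>2 * rr j n \<omega>)"
    unfolding sum_distrib_left sum_subtractf[symmetric]
    by (intro sum.cong refl) (simp add: rr_def diff_divide_distrib algebra_simps)
  finally show "(\<Sum>d<p. PB_mat p \<theta> \<rho> $$ (i, d) / \<sigma>\<^sup>2 * ?L (d + 1)) = (\<Sum>j<p. D i j / \<sigma>\<^sup>2 * rr j n \<omega>)" .
qed simp

lemma th_lim: assumes "j < p" shows "eqP M (th j) (\<lambda>n \<omega>. b j)"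
  unfolding eqP_def by (rule OP_sqn_imp) (use theta_dev_OP[OF assms] in \<open>simp add: theta_dev_def\<close>)

lemma th_OP: "j < p \<Longrightarrow> OP M (th j)"
  using th_lim by (rule eqP_const_OP)

text \<open>The estimated prediction error filter, so that a residual is a single sum over the lags
  0, ..., p.\<close>

definition resid_coeff :: "nat \<Rightarrow> nat \<Rightarrow> 'w \<Rightarrow> real" where
  "resid_coeff i n \<omega> = (if i = 0 then 1 else - th (i - 1) n \<omega>)"

lemma resid_coeff_OP: assumes "i \<le> p" shows "OP M (resid_coeff i)"
proof (cases "i = 0")
  case True
  then show ?thesis by (simp add: resid_coeff_def[abs_def] OP_const)
next
  case False
  then have "OP M (\<lambda>n \<omega>. - th (i - 1) n \<omega>)" using assms by (intro OP_minus th_OP) auto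
  then show ?thesis using False by (simp add: resid_coeff_def[abs_def])
qed

lemma sum_resid_coeff: "(\<Sum>i\<le>p. resid_coeff i n \<omega> * f i) = f 0 - (\<Sum>j<p. th j n \<omega> * f (j + 1))"
proof -
  have "(\<Sum>i\<le>p. resid_coeff i n \<omega> * f i) = (\<Sum>i<Suc p. resid_coeff i n \<omega> * f i)" by (simp only: lessThan_Suc_atMost)
  also have "\<dots> = resid_coeff 0 n \<omega> * f 0 + (\<Sum>j<p. resid_coeff (Suc j) n \<omega> * f (Suc j))" by (rule sum.lessThan_Suc_shift)
  finally show ?thesis by (simp add: resid_coeff_def sum_negf)
qed

text \<open>The special residual at k = 0 fits the general formula, since X vanishes at the times
  -1, ..., -p.\<close>

lemma eps_hat_eq:
  assumes w: "\<omega> \<in> space M"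
  shows "eps_hat p S (\<lambda>k. X k \<omega>) n k = (\<Sum>i\<le>p. resid_coeff i n \<omega> * X (int k - int i) \<omega>)"
proof (cases "k = 0")
  case True
  have "(\<Sum>j<p. th j n \<omega> * X (int k - int (j + 1)) \<omega>) = 0"
  proof (rule sum.neutral, rule ballI)
    fix j assume "j \<in> {..<p}"
    then have "X (- int (j + 1)) \<omega> = 0" by (intro X_neg w) auto
    then show "th j n \<omega> * X (int k - int (j + 1)) \<omega> = 0" using True by simp
  qed
  then show ?thesis unfolding sum_resid_coeff using True by (simp add: eps_hat_def)
next
  case False
  have "theta_hat p S (\<lambda>k. X k \<omega>) n \<bullet> Phi p (\<lambda>k. X k \<omega>) (int k - 1) = (\<Sum>j<p. th j n \<omega> * X (int k - int (j + 1)) \<omega>)"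
    by (simp add: scalar_prod_def Phi_def atLeast0LessThan th_def algebra_simps)
  then show ?thesis unfolding sum_resid_coeff using False by (simp add: eps_hat_def)
qed

section \<open>The estimator of rho as a ratio of residual covariances\<close>

definition DD :: "nat \<Rightarrow> 'w \<Rightarrow> real" where
  "DD n \<omega> = (\<Sum>i\<le>p. \<Sum>j\<le>p. resid_coeff i n \<omega> * resid_coeff j n \<omega> * ch (i + 1) (j + 1) n \<omega>)"

definition NN :: "nat \<Rightarrow> 'w \<Rightarrow> real" where
  "NN n \<omega> = (\<Sum>j\<le>p. \<Sum>i\<le>p. resid_coeff j n \<omega> * resid_coeff i n \<omega> * ch i (j + 1) n \<omega>)"

lemma sum_residuals:
  "(\<Sum>k=1..n. (\<Sum>i\<in>I. u i * f i k) * (\<Sum>j\<in>J. v j * g j k)) = (\<Sum>i\<in>I. \<Sum>j\<in>J. u i * v j * (\<Sum>k=1..n. f i k * g j k))"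
  for u v :: "nat \<Rightarrow> real" and f g :: "nat \<Rightarrow> nat \<Rightarrow> real"
proof -
  have "(\<Sum>k=1..n. (\<Sum>i\<in>I. u i * f i k) * (\<Sum>j\<in>J. v j * g j k)) = (\<Sum>k=1..n. \<Sum>i\<in>I. \<Sum>j\<in>J. u i * v j * (f i k * g j k))"
    unfolding sum_product by (intro sum.cong refl) (simp only: mult_ac)
  also have "\<dots> = (\<Sum>i\<in>I. \<Sum>k=1..n. \<Sum>j\<in>J. u i * v j * (f i k * g j k))" by (rule sum.swap)
  also have "\<dots> = (\<Sum>i\<in>I. \<Sum>j\<in>J. \<Sum>k=1..n. u i * v j * (f i k * g j k))"
    by (rule sum.cong[OF refl]) (rule sum.swap)
  finally show ?thesis by (simp only: sum_distrib_left)
qed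

lemma rho_hat_eq:
  assumes n: "n \<ge> 1" and w: "\<omega> \<in> space M"
  shows "rho_hat p S (\<lambda>k. X k \<omega>) n = inverse (DD n \<omega>) * NN n \<omega>"
proof -
  let ?e = "eps_hat p S (\<lambda>k. X k \<omega>) n"
  have sh: "X (int (k - 1) - int i) \<omega> = X (int k - int (i + 1)) \<omega>" if "k \<in> {1..n}" for k i
    using that by (simp add: of_nat_diff algebra_simps)
  have e1: "?e (k - 1) = (\<Sum>i\<le>p. resid_coeff i n \<omega> * X (int k - int (i + 1)) \<omega>)" if "k \<in> {1..n}" for k
    unfolding eps_hat_eq[OF w] by (simp only: sh[OF that])
  have chn: "(\<Sum>k=1..n. X (int k - int i) \<omega> * X (int k - int j) \<omega>) = real n * ch i j n \<omega>" for i j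
    using n by (simp add: ch_def)
  have "(\<Sum>k=1..n. (?e (k - 1))\<^sup>2) = (\<Sum>k=1..n. (\<Sum>i\<le>p. resid_coeff i n \<omega> * X (int k - int (i + 1)) \<omega>) * (\<Sum>j\<le>p. resid_coeff j n \<omega> * X (int k - int (j + 1)) \<omega>))"
    by (intro sum.cong refl) (simp only: e1 power2_eq_square)
  also have "\<dots> = (\<Sum>i\<le>p. \<Sum>j\<le>p. resid_coeff i n \<omega> * resid_coeff j n \<omega> * (real n * ch (i + 1) (j + 1) n \<omega>))"
    by (rule trans[OF sum_residuals]) (simp only: chn)
  also have "\<dots> = real n * DD n \<omega>"
    unfolding DD_def sum_distrib_left by (intro sum.cong refl) (simp only: mult_ac)
  finally have d: "(\<Sum>k=1..n. (?e (k - 1))\<^sup>2) = real n * DD n \<omega>" .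
  have "(\<Sum>k=1..n. ?e k * ?e (k - 1)) = (\<Sum>k=1..n. (\<Sum>j\<le>p. resid_coeff j n \<omega> * X (int k - int (j + 1)) \<omega>) * (\<Sum>i\<le>p. resid_coeff i n \<omega> * X (int k - int i) \<omega>))"
  proof (rule sum.cong[OF refl])
    fix k assume k: "k \<in> {1..n}"
    show "?e k * ?e (k - 1) = (\<Sum>j\<le>p. resid_coeff j n \<omega> * X (int k - int (j + 1)) \<omega>) * (\<Sum>i\<le>p. resid_coeff i n \<omega> * X (int k - int i) \<omega>)"
      unfolding e1[OF k] eps_hat_eq[OF w, of n k] by (rule mult.commute)
  qed
  also have "\<dots> = (\<Sum>j\<le>p. \<Sum>i\<le>p. resid_coeff j n \<omega> * resid_coeff i n \<omega> * (real n * ch (j + 1) i n \<omega>))"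
    by (rule trans[OF sum_residuals]) (simp only: chn)
  also have "\<dots> = real n * NN n \<omega>"
    unfolding NN_def sum_distrib_left by (intro sum.cong refl) (simp only: mult_ac ch_commute[of "_ + 1"])
  finally have m: "(\<Sum>k=1..n. ?e k * ?e (k - 1)) = real n * NN n \<omega>" .
  show ?thesis unfolding rho_hat_def d m using n by (simp add: inverse_mult_distrib)
qed

text \<open>The sample covariance of the residuals with the process at lag i, in its Toeplitz
  version.\<close>

definition resid_cov :: "nat \<Rightarrow> nat \<Rightarrow> 'w \<Rightarrow> real" where
  "resid_cov i n \<omega> = (\<Sum>j\<le>p. resid_coeff j n \<omega> * cc (nat \<bar>int i - int j\<bar>) n \<omega>)"

text \<open>The normal equations state orthogonality of the residuals to the regressors, apart from
  the term with S and boundary terms, both of which are negligible even after scaling.\<close>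

lemma resid_cov_zero:
  assumes i: "i < p" shows "oP M (sqn (resid_cov (i + 1)))"
proof -
  have "eqP M (\<lambda>n \<omega>. sqn (cc (i + 1)) n \<omega> - (\<Sum>j<p. th j n \<omega> * sqn (cc (nat \<bar>int i - int j\<bar>)) n \<omega>))
      (\<lambda>n \<omega>. sqn (ch (i + 1) 0) n \<omega> - (\<Sum>j<p. th j n \<omega> * sqn (A i j) n \<omega>))"
    using eqP_sym[OF ch_toeplitz[of "i + 1" 0]] eqP_sym[OF A_cc[OF i]] i th_OP
    by (intro eqP_diff eqP_sum eqP_mult_left) (auto simp: nat_add_distrib)
  then have "eqP M (sqn (resid_cov (i + 1))) (\<lambda>n \<omega>. 0)"
  proof (rule eqP_cong_ev)
    fix n \<omega> assume n: "n \<ge> (1::nat)"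
    have "nat \<bar>int (i + 1) - int (j + 1)\<bar> = nat \<bar>int i - int j\<bar>" "nat \<bar>int (i + 1) - int 0\<bar> = i + 1" for j by auto
    then show "sqn (resid_cov (i + 1)) n \<omega> = sqn (cc (i + 1)) n \<omega> - (\<Sum>j<p. th j n \<omega> * sqn (cc (nat \<bar>int i - int j\<bar>)) n \<omega>)"
      unfolding sqn_def resid_cov_def sum_resid_coeff by (simp only: right_diff_distrib sum_distrib_left mult.left_commute)
    have "sqn (ch (i + 1) 0) n \<omega> - (\<Sum>j<p. th j n \<omega> * sqn (A i j) n \<omega>) = sqrt (real n) * (ch (i + 1) 0 n \<omega> - (\<Sum>j<p. A i j n \<omega> * th j n \<omega>))"
      by (simp add: sqn_def right_diff_distrib sum_distrib_left mult_ac)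
    then show "0 = sqn (ch (i + 1) 0) n \<omega> - (\<Sum>j<p. th j n \<omega> * sqn (A i j) n \<omega>)"
      unfolding normal_eq[OF n i] by simp
  qed
  then show ?thesis by (simp add: eqP_def)
qed

text \<open>One of the two residuals is expanded into lags 0, ..., p; by orthogonality only lag 0
  contributes.\<close>

lemma DD_yy: "eqP M (sqn DD) (sqn (resid_cov 0))"
proof -
  have "eqP M (\<lambda>n \<omega>. \<Sum>i\<le>p. \<Sum>j\<le>p. (resid_coeff i n \<omega> * resid_coeff j n \<omega>) * sqn (ch (i + 1) (j + 1)) n \<omega>)
      (\<lambda>n \<omega>. \<Sum>i\<le>p. \<Sum>j\<le>p. (resid_coeff i n \<omega> * resid_coeff j n \<omega>) * sqn (cc (nat \<bar>int i - int j\<bar>)) n \<omega>)"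
  proof (intro eqP_sum eqP_mult_left OP_mult resid_coeff_OP)
    fix i j assume "i \<in> {..p}" "j \<in> {..p}"
    then show "eqP M (sqn (ch (i + 1) (j + 1))) (sqn (cc (nat \<bar>int i - int j\<bar>)))"
      using ch_toeplitz[of "i + 1" "j + 1"] by simp
  qed auto
  then have 1: "eqP M (sqn DD) (\<lambda>n \<omega>. \<Sum>i\<le>p. resid_coeff i n \<omega> * sqn (resid_cov i) n \<omega>)"
    by (rule eqP_cong_ev) (simp_all only: sqn_def DD_def resid_cov_def sum_distrib_left mult_ac)
  have "oP M (\<lambda>n \<omega>. \<Sum>j<p. th j n \<omega> * sqn (resid_cov (j + 1)) n \<omega>)"
    by (intro oP_sum OP_mult_oP th_OP resid_cov_zero) auto
  then have "eqP M (\<lambda>n \<omega>. \<Sum>i\<le>p. resid_coeff i n \<omega> * sqn (resid_cov i) n \<omega>) (sqn (resid_cov 0))"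
    unfolding sum_resid_coeff eqP_def using oP_minus by fastforce
  with 1 show ?thesis by (rule eqP_trans)
qed

text \<open>The previous residual consists of the lags 1, ..., p + 1, of which only p + 1 escapes
  the orthogonality; its coefficient is minus the last component of the estimator of
  \<theta>.\<close>

lemma NN_yy: "eqP M (sqn NN) (\<lambda>n \<omega>. - (th (p - 1) n \<omega> * sqn (resid_cov (p + 1)) n \<omega>))"
proof -
  have "eqP M (\<lambda>n \<omega>. \<Sum>j\<le>p. \<Sum>i\<le>p. (resid_coeff j n \<omega> * resid_coeff i n \<omega>) * sqn (ch i (j + 1)) n \<omega>)
      (\<lambda>n \<omega>. \<Sum>j\<le>p. \<Sum>i\<le>p. (resid_coeff j n \<omega> * resid_coeff i n \<omega>) * sqn (cc (nat \<bar>int (j + 1) - int i\<bar>)) n \<omega>)"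
  proof (intro eqP_sum eqP_mult_left OP_mult resid_coeff_OP)
    fix i j assume "i \<in> {..p}" "j \<in> {..p}"
    then show "eqP M (sqn (ch i (j + 1))) (sqn (cc (nat \<bar>int (j + 1) - int i\<bar>)))"
      using ch_toeplitz[of "j + 1" i] by (simp add: ch_commute[of i])
  qed auto
  then have 1: "eqP M (sqn NN) (\<lambda>n \<omega>. \<Sum>j\<le>p. resid_coeff j n \<omega> * sqn (resid_cov (j + 1)) n \<omega>)"
    by (rule eqP_cong_ev) (simp_all only: sqn_def NN_def resid_cov_def sum_distrib_left mult_ac)
  have "oP M (\<lambda>n \<omega>. \<Sum>j<p. resid_coeff j n \<omega> * sqn (resid_cov (j + 1)) n \<omega>)"
    by (intro oP_sum OP_mult_oP resid_coeff_OP resid_cov_zero) auto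
  then have "eqP M (\<lambda>n \<omega>. \<Sum>j\<le>p. resid_coeff j n \<omega> * sqn (resid_cov (j + 1)) n \<omega>) (\<lambda>n \<omega>. - (th (p - 1) n \<omega> * sqn (resid_cov (p + 1)) n \<omega>))"
    unfolding eqP_def lessThan_Suc_atMost[symmetric] sum.lessThan_Suc using p1 by (simp add: resid_coeff_def)
  with 1 show ?thesis by (rule eqP_trans)
qed

text \<open>The scaled change of the right-hand side of \<open>a_sum_last\<close> when
  \<open>theta_star\<close> is replaced by its estimator, up to sign.\<close>

definition QQ :: "nat \<Rightarrow> 'w \<Rightarrow> real" where
  "QQ n \<omega> = (\<Sum>j<p. theta_dev j n \<omega> * (cc (p - j) n \<omega> + c * cc (j + 1) n \<omega>))"

text \<open>The lag p + 1 equation, split as in \<open>a_sum_last\<close> but with the estimated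
  coefficients in place of \<open>theta_star\<close>; the replacement produces QQ.\<close>

lemma resid_cov_last:
  "eqP M (sqn (resid_cov (p + 1))) (\<lambda>n \<omega>. sqn (ell (p + 1)) n \<omega> - QQ n \<omega> - c * sqn (resid_cov 0) n \<omega>)"
proof -
  have "eqP M (\<lambda>n \<omega>. sqn (\<lambda>n \<omega>. \<Sum>i\<le>p+1. a i * cc (nat \<bar>int (p + 1) - int i\<bar>) n \<omega>) n \<omega> - QQ n \<omega> - c * sqn (resid_cov 0) n \<omega>)
     (\<lambda>n \<omega>. sqn (ell (p + 1)) n \<omega> - QQ n \<omega> - c * sqn (resid_cov 0) n \<omega>)"
    by (intro eqP_diff eqP_refl cc_AR) simp
  then show ?thesis
  proof (rule eqP_cong_ev)
    fix n \<omega>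
    let ?f = "\<lambda>h. cc h n \<omega>"
    have e: "nat \<bar>int (p + 1) - int 0\<bar> = p + 1"
      "nat \<bar>int 0 - int 0\<bar> = 0" "nat \<bar>int 0 - int (j + 1)\<bar> = j + 1" for j by auto
    have e': "(\<Sum>j<p. th j n \<omega> * ?f (nat \<bar>int (p + 1) - int (j + 1)\<bar>)) = (\<Sum>j<p. th j n \<omega> * ?f (p - j))"
    proof (rule sum.cong[OF refl])
      fix j assume "j \<in> {..<p}"
      then have "nat \<bar>int (p + 1) - int (j + 1)\<bar> = p - j" by auto
      then show "th j n \<omega> * ?f (nat \<bar>int (p + 1) - int (j + 1)\<bar>) = th j n \<omega> * ?f (p - j)" by (simp only:)
    qed
    have y: "resid_cov (p + 1) n \<omega> = ?f (p + 1) - (\<Sum>j<p. th j n \<omega> * ?f (p - j))"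
      "resid_cov 0 n \<omega> = ?f 0 - (\<Sum>j<p. th j n \<omega> * ?f (j + 1))"
      unfolding resid_cov_def sum_resid_coeff by (simp_all only: e e')
    have u: "(\<Sum>j<p. theta_dev j n \<omega> * g j) = sqrt (real n) * ((\<Sum>j<p. th j n \<omega> * g j) - (\<Sum>j<p. b j * g j))" for g
      by (simp add: theta_dev_def sqn_def sum_distrib_left sum_subtractf[symmetric] algebra_simps)
    have Q: "QQ n \<omega> = (\<Sum>j<p. theta_dev j n \<omega> * ?f (p - j)) + c * (\<Sum>j<p. theta_dev j n \<omega> * ?f (j + 1))"
      by (simp add: QQ_def sum_distrib_left sum.distrib algebra_simps)
    show "sqn (resid_cov (p + 1)) n \<omega> = sqn (\<lambda>n \<omega>. \<Sum>i\<le>p+1. a i * cc (nat \<bar>int (p + 1) - int i\<bar>) n \<omega>) n \<omega> - QQ n \<omega> - c * sqn (resid_cov 0) n \<omega>"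
      unfolding sqn_def a_sum_last[of ?f] Q u y by (simp only: algebra_simps)
  qed simp
qed

lemma yy0_lim: "eqP M (resid_cov 0) (\<lambda>n \<omega>. \<sigma>\<^sup>2 * al)"
proof -
  have "eqP M (\<lambda>n \<omega>. cc 0 n \<omega> - (\<Sum>j<p. th j n \<omega> * cc (j + 1) n \<omega>)) (\<lambda>n \<omega>. \<sigma>\<^sup>2 * l 0 - (\<Sum>j<p. b j * (\<sigma>\<^sup>2 * l (j + 1))))"
    by (intro eqP_diff eqP_sum eqP_mult cc_lim th_lim OP_const) auto
  moreover have "\<sigma>\<^sup>2 * l 0 - (\<Sum>j<p. b j * (\<sigma>\<^sup>2 * l (j + 1))) = \<sigma>\<^sup>2 * al"
    unfolding prediction_error[symmetric] by (simp only: right_diff_distrib sum_distrib_left mult.left_commute)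
  moreover have "cc 0 n \<omega> - (\<Sum>j<p. th j n \<omega> * cc (j + 1) n \<omega>) = resid_cov 0 n \<omega>" for n \<omega>
  proof -
    have e: "nat \<bar>int 0 - int 0\<bar> = 0" "nat \<bar>int 0 - int (j + 1)\<bar> = j + 1" for j by auto
    show ?thesis unfolding resid_cov_def sum_resid_coeff by (simp only: e)
  qed
  ultimately show ?thesis by (simp only:)
qed

lemma DD_lim: "eqP M DD (\<lambda>n \<omega>. \<sigma>\<^sup>2 * al)"
  by (rule eqP_trans[OF sqn_eqP_imp[OF DD_yy] yy0_lim])

definition rho_dev :: "nat \<Rightarrow> 'w \<Rightarrow> real" where
  "rho_dev = sqn (\<lambda>n \<omega>. rho_hat p S (\<lambda>k. X k \<omega>) n - rho_star p \<theta> \<rho>)"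

lemma rho_star_eq: "rho_star p \<theta> \<rho> = c * b (p - 1)"
  by (simp add: rho_star_def c_def b_def)

text \<open>In NN - rho_star DD the residual covariance at lag 0 enters with the factor c (th - b)
  for the last component, because rho_star = c b_p. This cancellation of the leading part is what
  singles out rho_star; the other terms come from QQ and from the noise sum at lag p + 1.\<close>

lemma rho_dev_lim0:
  "eqP M rho_dev (\<lambda>n \<omega>. inverse (\<sigma>\<^sup>2 * al) * (c * theta_dev (p - 1) n \<omega> * (\<sigma>\<^sup>2 * al) +
     b (p - 1) * ((\<Sum>j<p. theta_dev j n \<omega> * (\<sigma>\<^sup>2 * l (p - j) + c * (\<sigma>\<^sup>2 * l (j + 1)))) - sqn (ell (p + 1)) n \<omega>)))"
proof -
  let ?R = "\<lambda>n \<omega>. c * theta_dev (p - 1) n \<omega> * (\<sigma>\<^sup>2 * al) +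
     b (p - 1) * ((\<Sum>j<p. theta_dev j n \<omega> * (\<sigma>\<^sup>2 * l (p - j) + c * (\<sigma>\<^sup>2 * l (j + 1)))) - sqn (ell (p + 1)) n \<omega>)"
  have p1': "p - 1 < p" using p1 by simp
  have Q: "eqP M QQ (\<lambda>n \<omega>. \<Sum>j<p. theta_dev j n \<omega> * (\<sigma>\<^sup>2 * l (p - j) + c * (\<sigma>\<^sup>2 * l (j + 1))))"
    unfolding QQ_def[abs_def] by (intro eqP_sum eqP_mult_left theta_dev_OP eqP_add eqP_cmult cc_lim) auto
  have QL: "OP M (\<lambda>n \<omega>. (\<Sum>j<p. theta_dev j n \<omega> * (\<sigma>\<^sup>2 * l (p - j) + c * (\<sigma>\<^sup>2 * l (j + 1)))) - sqn (ell (p + 1)) n \<omega>)"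
    by (intro OP_diff OP_sum OP_mult theta_dev_OP OP_const ell_OP) auto
  have L: "eqP M (\<lambda>n \<omega>. QQ n \<omega> - sqn (ell (p + 1)) n \<omega>)
      (\<lambda>n \<omega>. (\<Sum>j<p. theta_dev j n \<omega> * (\<sigma>\<^sup>2 * l (p - j) + c * (\<sigma>\<^sup>2 * l (j + 1)))) - sqn (ell (p + 1)) n \<omega>)"
    by (intro eqP_diff Q eqP_refl)
  have "eqP M (\<lambda>n \<omega>. sqn NN n \<omega> - c * b (p - 1) * sqn DD n \<omega>)
     (\<lambda>n \<omega>. - (th (p - 1) n \<omega> * sqn (resid_cov (p + 1)) n \<omega>) - c * b (p - 1) * sqn (resid_cov 0) n \<omega>)"
    by (intro eqP_diff NN_yy eqP_cmult DD_yy)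
  moreover have "eqP M (\<lambda>n \<omega>. - (th (p - 1) n \<omega> * sqn (resid_cov (p + 1)) n \<omega>) - c * b (p - 1) * sqn (resid_cov 0) n \<omega>)
     (\<lambda>n \<omega>. c * theta_dev (p - 1) n \<omega> * resid_cov 0 n \<omega> + th (p - 1) n \<omega> * (QQ n \<omega> - sqn (ell (p + 1)) n \<omega>))"
  proof -
    have "eqP M (\<lambda>n \<omega>. (-1) * (th (p - 1) n \<omega> * sqn (resid_cov (p + 1)) n \<omega>) - c * b (p - 1) * sqn (resid_cov 0) n \<omega>)
      (\<lambda>n \<omega>. (-1) * (th (p - 1) n \<omega> * (sqn (ell (p + 1)) n \<omega> - QQ n \<omega> - c * sqn (resid_cov 0) n \<omega>)) - c * b (p - 1) * sqn (resid_cov 0) n \<omega>)"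
      by (intro eqP_diff eqP_refl eqP_cmult eqP_mult_left th_OP p1' resid_cov_last)
    then show ?thesis
      by (rule eqP_cong_ev) (simp_all add: theta_dev_def sqn_def algebra_simps)
  qed
  moreover have "eqP M (\<lambda>n \<omega>. c * theta_dev (p - 1) n \<omega> * resid_cov 0 n \<omega> + th (p - 1) n \<omega> * (QQ n \<omega> - sqn (ell (p + 1)) n \<omega>)) ?R"
    by (intro eqP_add eqP_mult eqP_refl th_lim L QL yy0_lim OP_const OP_cmult theta_dev_OP p1')
  ultimately have N: "eqP M (\<lambda>n \<omega>. sqn NN n \<omega> - c * b (p - 1) * sqn DD n \<omega>) ?R"
    by (blast intro: eqP_trans)
  have R: "OP M ?R"
    by (intro OP_add OP_mult OP_cmult theta_dev_OP OP_const QL p1')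
  have d0: "\<sigma>\<^sup>2 * al \<noteq> 0" using sigma_pos al_pos by simp
  have main: "eqP M (\<lambda>n \<omega>. inverse (DD n \<omega>) * (sqn NN n \<omega> - c * b (p - 1) * sqn DD n \<omega>))
      (\<lambda>n \<omega>. inverse (\<sigma>\<^sup>2 * al) * ?R n \<omega>)"
    by (intro eqP_mult eqP_inverse[OF DD_lim d0] N OP_const R)
  \<comment> \<open>For a vanishing DD the quotient DD / DD is 0 instead of 1. The factor sqrt n in
    front of the defect is harmless, because with high probability the defect is exactly 0.\<close>
  have defect: "eqP M (\<lambda>n \<omega>. (sqrt (real n) * (c * b (p - 1))) * (1 - inverse (DD n \<omega>) * DD n \<omega>)) (\<lambda>n \<omega>. 0)"
    unfolding eqP_def using oP_inverse_defect[OF DD_lim d0] by simp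
  from eqP_diff[OF main defect] show ?thesis
  proof (rule eqP_cong_ev)
    fix n \<omega> assume nw: "n \<ge> (1::nat)" "\<omega> \<in> space M"
    show "rho_dev n \<omega> = inverse (DD n \<omega>) * (sqn NN n \<omega> - c * b (p - 1) * sqn DD n \<omega>)
        - (sqrt (real n) * (c * b (p - 1))) * (1 - inverse (DD n \<omega>) * DD n \<omega>)"
      unfolding rho_dev_def sqn_def rho_hat_eq[OF nw] rho_star_eq by (simp add: algebra_simps)
  qed simp
qed

text \<open>The expansion of the estimator of \<theta> is substituted. \<open>PB_sum_lambda\<close>
  collapses the double sum, so that the coefficients match \<open>PL_index\<close> and the corner
  entry \<open>phi\<close>.\<close>

lemma rho_dev_lim:
  "eqP M rho_dev (\<lambda>n \<omega>. (\<Sum>d<p. PL_vec p \<theta> \<rho> $ d / \<sigma>\<^sup>2 * sqn (ell (d + 1)) n \<omega>)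
     + - (b (p - 1) / al) / \<sigma>\<^sup>2 * sqn (ell (p + 1)) n \<omega>)"
proof -
  let ?L = "\<lambda>d n \<omega>. sqn (ell d) n \<omega>"
  let ?Z = "\<lambda>i n \<omega>. \<Sum>d<p. PB_mat p \<theta> \<rho> $$ (i, d) / \<sigma>\<^sup>2 * ?L (d + 1) n \<omega>"
  have p1': "p - 1 < p" using p1 by simp
  have Z: "OP M (?Z i)" for i by (intro OP_sum OP_cmult ell_OP) auto
  have "eqP M (\<lambda>n \<omega>. inverse (\<sigma>\<^sup>2 * al) * (c * theta_dev (p - 1) n \<omega> * (\<sigma>\<^sup>2 * al) +
       b (p - 1) * ((\<Sum>j<p. theta_dev j n \<omega> * (\<sigma>\<^sup>2 * l (p - j) + c * (\<sigma>\<^sup>2 * l (j + 1)))) - ?L (p + 1) n \<omega>)))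
     (\<lambda>n \<omega>. inverse (\<sigma>\<^sup>2 * al) * (c * ?Z (p - 1) n \<omega> * (\<sigma>\<^sup>2 * al) +
       b (p - 1) * ((\<Sum>j<p. ?Z j n \<omega> * (\<sigma>\<^sup>2 * l (p - j) + c * (\<sigma>\<^sup>2 * l (j + 1)))) - ?L (p + 1) n \<omega>)))"
    by (intro eqP_cmult eqP_add eqP_diff eqP_sum eqP_mult eqP_refl theta_dev_lim OP_const OP_cmult Z p1') auto
  from eqP_trans[OF rho_dev_lim0 this] show ?thesis
  proof (rule eqP_cong_ev)
    fix n \<omega>
    have s0: "\<sigma> \<noteq> 0" "al \<noteq> 0" using sigma_pos al_pos by auto
    have "(\<Sum>j<p. ?Z j n \<omega> * (\<sigma>\<^sup>2 * l (p - j) + c * (\<sigma>\<^sup>2 * l (j + 1))))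
        = (\<Sum>j<p. \<Sum>d<p. ((l (p - j) + c * l (j + 1)) * PB_mat p \<theta> \<rho> $$ (j, d)) * ?L (d + 1) n \<omega>)"
      unfolding sum_distrib_right by (intro sum.cong refl) (use s0 in \<open>simp add: field_simps\<close>)
    also have "\<dots> = (\<Sum>d<p. \<Sum>j<p. ((l (p - j) + c * l (j + 1)) * PB_mat p \<theta> \<rho> $$ (j, d)) * ?L (d + 1) n \<omega>)"
      by (rule sum.swap)
    also have "\<dots> = (\<Sum>d<p. b (p - 1 - d) * ?L (d + 1) n \<omega>)"
    proof (rule sum.cong[OF refl])
      fix d assume "d \<in> {..<p}"
      then show "(\<Sum>j<p. ((l (p - j) + c * l (j + 1)) * PB_mat p \<theta> \<rho> $$ (j, d)) * ?L (d + 1) n \<omega>) = b (p - 1 - d) * ?L (d + 1) n \<omega>"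
        by (simp only: sum_distrib_right[symmetric] PB_sum_lambda lessThan_iff)
    qed
    finally have e1: "(\<Sum>j<p. ?Z j n \<omega> * (\<sigma>\<^sup>2 * l (p - j) + c * (\<sigma>\<^sup>2 * l (j + 1)))) = (\<Sum>d<p. b (p - 1 - d) * ?L (d + 1) n \<omega>)" .
    have "(\<Sum>d<p. PL_vec p \<theta> \<rho> $ d / \<sigma>\<^sup>2 * ?L (d + 1) n \<omega>)
        = (\<Sum>d<p. c * (PB_mat p \<theta> \<rho> $$ (p - 1, d) / \<sigma>\<^sup>2 * ?L (d + 1) n \<omega>) + b (p - 1) / (\<sigma>\<^sup>2 * al) * (b (p - 1 - d) * ?L (d + 1) n \<omega>))"
      by (intro sum.cong refl) (use s0 in \<open>simp add: PL_index field_simps\<close>)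
    also have "\<dots> = c * ?Z (p - 1) n \<omega> + b (p - 1) / (\<sigma>\<^sup>2 * al) * (\<Sum>d<p. b (p - 1 - d) * ?L (d + 1) n \<omega>)"
      by (simp only: sum.distrib sum_distrib_left)
    finally have e2: "(\<Sum>d<p. PL_vec p \<theta> \<rho> $ d / \<sigma>\<^sup>2 * ?L (d + 1) n \<omega>)
        = c * ?Z (p - 1) n \<omega> + b (p - 1) / (\<sigma>\<^sup>2 * al) * (\<Sum>d<p. b (p - 1 - d) * ?L (d + 1) n \<omega>)" .
    have alg: "z + B / q * s + - (B / al) / \<sigma>\<^sup>2 * y = inverse q * (z * q + B * (s - y))"
      if "q = \<sigma>\<^sup>2 * al" for z B s y q
      using s0 unfolding that by (simp add: field_simps)
    show "(\<Sum>d<p. PL_vec p \<theta> \<rho> $ d / \<sigma>\<^sup>2 * ?L (d + 1) n \<omega>) + - (b (p - 1) / al) / \<sigma>\<^sup>2 * ?L (p + 1) n \<omega>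
      = inverse (\<sigma>\<^sup>2 * al) * (c * ?Z (p - 1) n \<omega> * (\<sigma>\<^sup>2 * al) +
       b (p - 1) * ((\<Sum>j<p. ?Z j n \<omega> * (\<sigma>\<^sup>2 * l (p - j) + c * (\<sigma>\<^sup>2 * l (j + 1)))) - ?L (p + 1) n \<omega>))"
      unfolding e1 e2 by (rule alg) simp
  qed simp
qed

end

section \<open>Measurability of the estimators\<close>

lemma borel_measurable_det:
  fixes F :: "'w \<Rightarrow> real mat"
  assumes dim: "\<And>\<omega>. F \<omega> \<in> carrier_mat n n"
    and m: "\<And>i j. i < n \<Longrightarrow> j < n \<Longrightarrow> (\<lambda>\<omega>. F \<omega> $$ (i, j)) \<in> borel_measurable M"
  shows "(\<lambda>\<omega>. det (F \<omega>)) \<in> borel_measurable M"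
  unfolding det_def'[OF dim]
proof (intro borel_measurable_sum borel_measurable_times borel_measurable_const borel_measurable_prod)
  fix q i assume "q \<in> {q. q permutes {0..<n}}" "i \<in> {0..<n}"
  then have "i < n" "q i < n" using permutes_in_image[of q "{0..<n}" i] by auto
  then show "(\<lambda>\<omega>. F \<omega> $$ (i, q i)) \<in> borel_measurable M" by (rule m)
qed

text \<open>Cramer's rule. It exhibits the entries of the inverse as quotients of polynomials in the
  entries of A, from which measurability can be read off; the elimination behind
  \<open>mat_inv\<close> branches on the entries.\<close>

lemma mat_inv_index:
  assumes A: "A \<in> carrier_mat n n" and inv: "mat_inv A \<in> carrier_mat n n" "A * mat_inv A = 1\<^sub>m n"
    and d: "det A \<noteq> 0" and ij: "i < n" "j < n"
  shows "mat_inv A $$ (i, j) = cofactor A j i / det A"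
proof -
  have "adj_mat A = adj_mat A * (A * mat_inv A)"
    unfolding inv(2) by (rule right_mult_one_mat[OF adj_mat(1)[OF A], symmetric])
  also have "\<dots> = adj_mat A * A * mat_inv A"
    by (rule assoc_mult_mat[OF adj_mat(1)[OF A] A inv(1), symmetric])
  also have "\<dots> = det A \<cdot>\<^sub>m mat_inv A"
    unfolding adj_mat(3)[OF A] using inv(1) by (simp add: mult_smult_assoc_mat[of _ n n _ n])
  finally have "adj_mat A $$ (i, j) = (det A \<cdot>\<^sub>m mat_inv A) $$ (i, j)" by (rule arg_cong)
  then have "cofactor A j i = det A * mat_inv A $$ (i, j)"
    using A inv(1) ij by (simp add: adj_mat_def)
  then show ?thesis using d by simp
qed

context ar_process
begin

lemma S_mat_measurable:
  assumes "i < p" "j < p"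
  shows "(\<lambda>\<omega>. S_mat p S (\<lambda>k. X k \<omega>) n $$ (i, j)) \<in> borel_measurable M"
proof -
  have "X (int k - int i) \<in> borel_measurable M" "X (int k - int j) \<in> borel_measurable M" for k
    using assms by (auto intro!: X_rv)
  then show ?thesis unfolding S_mat_index[OF S_dim assms] by simp
qed

lemma S_mat_inv_measurable:
  assumes ij: "i < p" "j < p"
  shows "(\<lambda>\<omega>. mat_inv (S_mat p S (\<lambda>k. X k \<omega>) n) $$ (i, j)) \<in> borel_measurable M"
proof -
  let ?A = "\<lambda>\<omega>. S_mat p S (\<lambda>k. X k \<omega>) n"
  have dimA: "?A \<omega> \<in> carrier_mat p p" for \<omega> by (rule S_mat_dim[OF S_dim])
  have "(\<lambda>\<omega>. det (mat_delete (?A \<omega>) j i)) \<in> borel_measurable M"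
  proof (rule borel_measurable_det)
    show "mat_delete (?A \<omega>) j i \<in> carrier_mat (p - 1) (p - 1)" for \<omega>
      using dimA[of \<omega>] by (simp add: mat_delete_def)
    fix i' j' assume "i' < p - 1" "j' < p - 1"
    then have "mat_delete (?A \<omega>) j i $$ (i', j') = ?A \<omega> $$ (if i' < j then i' else Suc i', if j' < i then j' else Suc j')" for \<omega>
      using dimA[of \<omega>] by (simp add: mat_delete_def)
    moreover have "(if i' < j then i' else Suc i') < p" "(if j' < i then j' else Suc j') < p"
      using \<open>i' < p - 1\<close> \<open>j' < p - 1\<close> by auto
    ultimately show "(\<lambda>\<omega>. mat_delete (?A \<omega>) j i $$ (i', j')) \<in> borel_measurable M"
      using S_mat_measurable by simp
  qed
  moreover have "(\<lambda>\<omega>. det (?A \<omega>)) \<in> borel_measurable M"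
    by (rule borel_measurable_det[OF dimA]) (rule S_mat_measurable)
  moreover have "mat_inv (?A \<omega>) $$ (i, j) = (-1) ^ (j + i) * det (mat_delete (?A \<omega>) j i) / det (?A \<omega>)" for \<omega>
    unfolding mat_inv_index[OF dimA S_mat_inv(1)[OF S_pd] S_mat_inv(2)[OF S_pd] S_mat_inv(4)[OF S_pd] ij] cofactor_def ..
  ultimately show ?thesis by simp
qed

lemma th_measurable:
  assumes j: "j < p" shows "th j n \<in> borel_measurable M"
proof -
  have "th j n \<omega> = (\<Sum>i<p. mat_inv (S_mat p S (\<lambda>k. X k \<omega>) (n - 1)) $$ (j, i) * (\<Sum>k=1..n. X (int k - 1 - int i) \<omega> * X (int k) \<omega>))" for \<omega>
  proof -
    let ?v = "vec p (\<lambda>i. \<Sum>k=1..n. Phi p (\<lambda>k. X k \<omega>) (int k - 1) $ i * X (int k) \<omega>)"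
    have "th j n \<omega> = (\<Sum>i<p. mat_inv (S_mat p S (\<lambda>k. X k \<omega>) (n - 1)) $$ (j, i) * ?v $ i)"
      unfolding th_def theta_hat_def by (rule mat_vec_index_sum[OF S_mat_inv(1)[OF S_pd] _ j]) simp
    then show ?thesis by (simp add: Phi_def)
  qed
  moreover have "X (int k - 1 - int i) \<in> borel_measurable M" "X (int k) \<in> borel_measurable M" if "i < p" for k i
    using that by (auto intro!: X_rv)
  ultimately show ?thesis
    unfolding fun_eq_iff[symmetric, where f="th j n"] using S_mat_inv_measurable[OF j]
    by (auto intro!: borel_measurable_sum borel_measurable_times simp: cong: measurable_cong)
qed

lemma theta_dev_measurable: "j < p \<Longrightarrow> theta_dev j n \<in> borel_measurable M"
  using th_measurable[of j n] unfolding theta_dev_def sqn_def[abs_def] by simp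

lemma rho_dev_measurable: "rho_dev n \<in> borel_measurable M"
proof -
  have e: "(\<lambda>\<omega>. eps_hat p S (\<lambda>k. X k \<omega>) n k) \<in> borel_measurable M" for k
  proof -
    have "(\<lambda>\<omega>. \<Sum>i\<le>p. resid_coeff i n \<omega> * X (int k - int i) \<omega>) \<in> borel_measurable M"
    proof (intro borel_measurable_sum borel_measurable_times)
      fix i assume i: "i \<in> {..p}"
      show "resid_coeff i n \<in> borel_measurable M"
      proof (cases "i = 0")
        case False
        then have "th (i - 1) n \<in> borel_measurable M" using i by (intro th_measurable) auto
        then show ?thesis using False by (simp add: resid_coeff_def[abs_def])
      qed (simp add: resid_coeff_def[abs_def])
      show "X (int k - int i) \<in> borel_measurable M" using i by (intro X_rv) auto
    qed
    then show ?thesis by (simp add: eps_hat_eq cong: measurable_cong)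
  qed
  have "(\<lambda>\<omega>. rho_hat p S (\<lambda>k. X k \<omega>) n) \<in> borel_measurable M"
    unfolding rho_hat_def using e by (intro borel_measurable_times borel_measurable_inverse borel_measurable_sum borel_measurable_power) auto
  then show ?thesis unfolding rho_dev_def sqn_def[abs_def] by simp
qed

section \<open>Asymptotic normality\<close>

definition scaled_error :: "nat \<Rightarrow> 'w \<Rightarrow> nat \<Rightarrow> real" where
  "scaled_error n \<omega> = coords (sqrt (real n) \<cdot>\<^sub>v
     ((theta_hat p S (\<lambda>k. X k \<omega>) n - theta_star p \<theta> \<rho>) @\<^sub>v
      vec_of_list [rho_hat p S (\<lambda>k. X k \<omega>) n - rho_star p \<theta> \<rho>]))"

lemma scaled_error_eq: "scaled_error n \<omega> i = (if i < p then theta_dev i n \<omega> else if i = p then rho_dev n \<omega> else 0)"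
  using theta_hat_dim[OF S_pd, of "\<lambda>k. X k \<omega>" n] theta_star_dim
  by (auto simp: scaled_error_def coords_def theta_dev_def rho_dev_def sqn_def th_def b_def vec_of_list_index)

lemma scaled_error_measurable [measurable]: "scaled_error n \<in> borel_measurable M"
proof (rule measurable_coordinatewise_then_product)
  fix i
  consider "i < p" | "i = p" | "i > p" by linarith
  then show "(\<lambda>\<omega>. scaled_error n \<omega> i) \<in> borel_measurable M"
    by cases (simp_all add: scaled_error_eq theta_dev_measurable[unfolded eta_contract_eq] rho_dev_measurable)
qed

text \<open>The Cramer-Wold reduction: a fixed linear combination of the errors is asymptotically
  one Toeplitz quadratic form in the noise, to which \<open>quad_clt\<close> applies. Both the joint
  law and the law for \<rho> are read off from it.\<close>

lemma char_ZZ: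
  fixes t :: "nat \<Rightarrow> real"
  shows "(\<lambda>n. char (distr M borel (\<lambda>\<omega>. \<Sum>i<p+1. t i * scaled_error n \<omega> i)) s) \<longlonglongrightarrow>
     exp (- ((\<Sum>i<p+1. \<Sum>j<p+1. t i * t j * Gamma_mat p \<theta> \<rho> $$ (i, j)) * s\<^sup>2) / 2)"
proof -
  define w where "w d = (\<Sum>i<p+1. t i * P_mat p \<theta> \<rho> $$ (i, d))" for d
  \<comment> \<open>The division by \<open>\<sigma>\<^sup>2\<close> is squared in the variance and
    cancels the factor \<open>(\<sigma>\<^sup>2)\<^sup>2\<close> of the quadratic form.\<close>
  define v where "v d = w d / \<sigma>\<^sup>2" for d
  let ?L = "\<lambda>d n \<omega>. sqn (ell (d + 1)) n \<omega>"
  have s0: "\<sigma> \<noteq> 0" using sigma_pos by auto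
  have "eqP M (\<lambda>n \<omega>. (\<Sum>i<p. t i * theta_dev i n \<omega>) + t p * rho_dev n \<omega>)
     (\<lambda>n \<omega>. (\<Sum>i<p. t i * (\<Sum>d<p. PB_mat p \<theta> \<rho> $$ (i, d) / \<sigma>\<^sup>2 * ?L d n \<omega>))
        + t p * ((\<Sum>d<p. PL_vec p \<theta> \<rho> $ d / \<sigma>\<^sup>2 * ?L d n \<omega>) + - (b (p - 1) / al) / \<sigma>\<^sup>2 * ?L p n \<omega>))"
    by (intro eqP_add eqP_sum eqP_cmult theta_dev_lim rho_dev_lim) auto
  then have "eqP M (\<lambda>n \<omega>. \<Sum>i<p+1. t i * scaled_error n \<omega> i) (\<lambda>n \<omega>. \<Sum>i<p+1. v i * ?L i n \<omega>)"
  proof (rule eqP_cong_ev)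
    fix n \<omega>
    show "(\<Sum>i<p+1. t i * scaled_error n \<omega> i) = (\<Sum>i<p. t i * theta_dev i n \<omega>) + t p * rho_dev n \<omega>"
      by (simp add: scaled_error_eq)
    have wd: "w d = (\<Sum>i<p. t i * PB_mat p \<theta> \<rho> $$ (i, d)) + t p * PL_vec p \<theta> \<rho> $ d" if "d < p" for d
      using that by (simp add: w_def P_index)
    have wp: "w p = t p * - (b (p - 1) / al)" by (simp add: w_def P_index)
    have "(\<Sum>i<p. t i * (\<Sum>d<p. PB_mat p \<theta> \<rho> $$ (i, d) / \<sigma>\<^sup>2 * ?L d n \<omega>))
        = (\<Sum>d<p. (\<Sum>i<p. t i * PB_mat p \<theta> \<rho> $$ (i, d)) / \<sigma>\<^sup>2 * ?L d n \<omega>)"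
      unfolding sum_distrib_left sum_distrib_right sum_divide_distrib by (subst sum.swap) (simp add: mult.assoc)
    moreover have "(\<Sum>d<p. v d * ?L d n \<omega>) = (\<Sum>d<p. (\<Sum>i<p. t i * PB_mat p \<theta> \<rho> $$ (i, d)) / \<sigma>\<^sup>2 * ?L d n \<omega>
        + t p * (PL_vec p \<theta> \<rho> $ d / \<sigma>\<^sup>2 * ?L d n \<omega>))"
      by (intro sum.cong refl) (simp add: v_def wd add_divide_distrib distrib_right)
    moreover have "(\<Sum>i<p+1. v i * ?L i n \<omega>) = (\<Sum>d<p. v d * ?L d n \<omega>) + t p * (- (b (p - 1) / al) / \<sigma>\<^sup>2 * ?L p n \<omega>)"
      by (simp add: v_def wp)
    ultimately show "(\<Sum>i<p+1. v i * ?L i n \<omega>) = (\<Sum>i<p. t i * (\<Sum>d<p. PB_mat p \<theta> \<rho> $$ (i, d) / \<sigma>\<^sup>2 * ?L d n \<omega>))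
        + t p * ((\<Sum>d<p. PL_vec p \<theta> \<rho> $ d / \<sigma>\<^sup>2 * ?L d n \<omega>) + - (b (p - 1) / al) / \<sigma>\<^sup>2 * ?L p n \<omega>)"
      by (simp only: sum.distrib sum_distrib_left distrib_left add.assoc)
  qed
  from eqP_trans[OF this sqn_ell_quad]
  have e: "oP M (\<lambda>n \<omega>. (\<Sum>i<p+1. t i * scaled_error n \<omega> i) - noise.quad (\<lambda>k l. wg v (k - l)) n \<omega> / sqrt (real n))"
    unfolding eqP_def .
  have scaled_errori [measurable]: "(\<lambda>\<omega>. scaled_error n \<omega> i) \<in> borel_measurable M" for n i
    using measurable_compose[OF scaled_error_measurable borel_measurable_coordinate] .
  have "(\<lambda>n. char (distr M borel (\<lambda>\<omega>. \<Sum>i<p+1. t i * scaled_error n \<omega> i)) s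
      - char (distr M borel (\<lambda>\<omega>. noise.quad (\<lambda>k l. wg v (k - l)) n \<omega> / sqrt (real n))) s) \<longlonglongrightarrow> 0"
    by (rule oP_char_diff[OF _ _ e]) measurable
  moreover have "(\<lambda>n. char (distr M borel (\<lambda>\<omega>. noise.quad (\<lambda>k l. wg v (k - l)) n \<omega> / sqrt (real n))) s)
     \<longlonglongrightarrow> exp (- ((\<sigma>\<^sup>2)\<^sup>2 * (\<Sum>j. (wg v (Suc j))\<^sup>2) * s\<^sup>2) / 2)"
    by (rule noise.quad_clt[OF sums_summable[OF wg_sums]])
  moreover have "(\<sigma>\<^sup>2)\<^sup>2 * (\<Sum>j. (wg v (Suc j))\<^sup>2) = (\<Sum>i<p+1. \<Sum>j<p+1. t i * t j * Gamma_mat p \<theta> \<rho> $$ (i, j))"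
  proof -
    have "(\<Sum>j. (wg v (Suc j))\<^sup>2) = (\<Sum>i<p+1. \<Sum>j<p+1. v i * v j * l (nat \<bar>int i - int j\<bar>))"
      by (rule sums_unique[OF wg_sums, symmetric])
    also have "(\<sigma>\<^sup>2)\<^sup>2 * \<dots> = (\<Sum>i<p+1. \<Sum>j<p+1. w i * w j * l (nat \<bar>int i - int j\<bar>))"
      unfolding sum_distrib_left by (intro sum.cong refl) (use s0 in \<open>simp add: v_def field_simps power2_eq_square\<close>)
    finally show ?thesis unfolding Gamma_quad w_def .
  qed
  ultimately show ?thesis using Lim_transform by (simp only:)
qed

theorem joint_normality:
  "\<exists>\<nu>. normal_law_vec (0\<^sub>v (p + 1)) (Gamma_mat p \<theta> \<rho>) \<nu> \<and> weak_conv_top (\<lambda>n. distr M borel (scaled_error n)) \<nu>"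
proof -
  obtain \<nu> where nu: "normal_law_vec (0\<^sub>v (p + 1)) (Gamma_mat p \<theta> \<rho>) \<nu>"
    using normal_law_vec_exists[OF Gamma_dim Gamma_sym Gamma_psd] by blast
  have scaled_errori [measurable]: "(\<lambda>\<omega>. scaled_error n \<omega> i) \<in> borel_measurable M" for n i
    using measurable_compose[OF scaled_error_measurable borel_measurable_coordinate] .
  have "weak_conv_top (\<lambda>n. distr M borel (scaled_error n)) \<nu>"
  proof (rule weak_conv_top_char[where d="p + 1"])
    show "prob_space (distr M borel (scaled_error n))" for n by (rule prob_space_distr) simp
    show "AE x in distr M borel (scaled_error n). \<forall>i\<ge>p + 1. x i = 0" for n
      by (subst AE_distr_iff) (auto simp: scaled_error_eq)
    show "prob_space \<nu>" "sets \<nu> = sets borel" "AE x in \<nu>. \<forall>i\<ge>p + 1. x i = 0"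
      using nu by (auto simp: normal_law_vec_def Let_def)
    fix t :: "nat \<Rightarrow> real"
    have "(CLINT x|distr M borel (scaled_error n). iexp (\<Sum>i<p+1. t i * x i)) = char (distr M borel (\<lambda>\<omega>. \<Sum>i<p+1. t i * scaled_error n \<omega> i)) 1" for n
      by (subst integral_distr) (simp_all add: char_distr_eq)
    moreover have "(CLINT x|\<nu>. iexp (\<Sum>i<p+1. t i * x i)) = exp (- ((\<Sum>i<p+1. \<Sum>j<p+1. t i * t j * Gamma_mat p \<theta> \<rho> $$ (i, j)) * 1\<^sup>2) / 2)"
      using normal_law_vec_char[OF nu, of t] by (simp only: power_one mult_1_right)
    ultimately show "(\<lambda>n. CLINT x|distr M borel (scaled_error n). iexp (\<Sum>i<p+1. t i * x i)) \<longlonglongrightarrow> (CLINT x|\<nu>. iexp (\<Sum>i<p+1. t i * x i))"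
      using char_ZZ[of t 1] by (simp only:)
  qed simp
  then show ?thesis using nu by blast
qed

text \<open>The last coordinate is the linear combination with a unit vector, so its characteristic
  function is already known, and Levy's theorem on the real line finishes.\<close>

theorem rho_normality:
  "\<exists>\<nu>. normal_law 0 (Gamma_mat p \<theta> \<rho> $$ (p, p)) \<nu> \<and> weak_conv_m (\<lambda>n. distr M borel (rho_dev n)) \<nu>"
proof -
  define t where "t i = (if i = p then 1 else 0 :: real)" for i
  have G: "(\<Sum>i<p+1. \<Sum>j<p+1. t i * t j * Gamma_mat p \<theta> \<rho> $$ (i, j)) = Gamma_mat p \<theta> \<rho> $$ (p, p)"
    by (simp add: t_def)
  then have "0 \<le> Gamma_mat p \<theta> \<rho> $$ (p, p)" using Gamma_psd[of t] by simp
  then obtain \<nu> where nu: "normal_law 0 (Gamma_mat p \<theta> \<rho> $$ (p, p)) \<nu>" using normal_law_exists by blast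
  have z: "(\<Sum>i<p+1. t i * scaled_error n \<omega> i) = rho_dev n \<omega>" for n \<omega>
    by (simp add: t_def scaled_error_eq)
  have "weak_conv_m (\<lambda>n. distr M borel (rho_dev n)) \<nu>"
  proof (rule levy_continuity)
    show "real_distribution (distr M borel (rho_dev n))" for n
      using rho_dev_measurable by (rule real_distribution_distr)
    show "real_distribution \<nu>" by (rule real_distribution_normal_law[OF nu])
    show "(\<lambda>n. char (distr M borel (rho_dev n)) s) \<longlonglongrightarrow> char \<nu> s" for s
      using char_ZZ[of t s] unfolding z G char_normal_law[OF nu] .
  qed
  then show ?thesis using nu by blast
qed

end

theorem theorem3p2:
  fixes M :: "'w measure" and p :: nat and \<theta> :: "real vec" and \<rho> \<sigma> :: real and S :: "real mat"
    and X :: "int \<Rightarrow> 'w \<Rightarrow> real" and \<epsilon> V :: "nat \<Rightarrow> 'w \<Rightarrow> real"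
  assumes "prob_space M"
    and "p \<ge> 1"
    and "\<theta> \<in> carrier_vec p" and "\<theta> \<noteq> 0\<^sub>v p" and "(\<Sum>i<p. \<bar>\<theta> $ i\<bar>) < 1"
    and "\<bar>\<rho>\<bar> < 1"
    and X_rec: "\<And>n \<omega>. n \<ge> 1 \<Longrightarrow> \<omega> \<in> space M \<Longrightarrow>
      X (int n) \<omega> = (\<Sum>i=1..p. \<theta> $ (i - 1) * X (int n - int i) \<omega>) + \<epsilon> n \<omega>"
    and eps_rec: "\<And>n \<omega>. n \<ge> 1 \<Longrightarrow> \<omega> \<in> space M \<Longrightarrow> \<epsilon> n \<omega> = \<rho> * \<epsilon> (n - 1) \<omega> + V n \<omega>"
    and X_init: "\<And>\<omega>. \<omega> \<in> space M \<Longrightarrow> X 0 \<omega> = \<epsilon> 0 \<omega>"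
      "X 0 \<in> borel_measurable M" "integrable M (\<lambda>\<omega>. (X 0 \<omega>)\<^sup>2)"
    and X_neg: "\<And>i \<omega>. 1 \<le> i \<Longrightarrow> i \<le> p \<Longrightarrow> \<omega> \<in> space M \<Longrightarrow> X (- int i) \<omega> = 0"
    and V_iid: "prob_space.indep_vars M (\<lambda>_. borel) V {1..}"
      "\<And>n. n \<ge> 1 \<Longrightarrow> distr M borel (V n) = distr M borel (V 1)"
    and V_moments: "\<And>n. n \<ge> 1 \<Longrightarrow> integrable M (\<lambda>\<omega>. (V n \<omega>)\<^sup>2)"
      "\<And>n. n \<ge> 1 \<Longrightarrow> prob_space.expectation M (V n) = 0"
      "\<And>n. n \<ge> 1 \<Longrightarrow> prob_space.variance M (V n) = \<sigma>\<^sup>2" "\<sigma>\<^sup>2 > 0"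
    and V_fourth: "\<And>n. n \<ge> 1 \<Longrightarrow> integrable M (\<lambda>\<omega>. (V n \<omega>) ^ 4)"
    and "sym_pos_def p S"
  shows
    "(\<exists>\<nu>. normal_law_vec (0\<^sub>v (p + 1)) (Gamma_mat p \<theta> \<rho>) \<nu> \<and>
        weak_conv_top
          (\<lambda>n. distr M borel (\<lambda>\<omega>. coords (sqrt (real n) \<cdot>\<^sub>v
             ((theta_hat p S (\<lambda>k. X k \<omega>) n - theta_star p \<theta> \<rho>) @\<^sub>v
              vec_of_list [rho_hat p S (\<lambda>k. X k \<omega>) n - rho_star p \<theta> \<rho>]))))
          \<nu>) \<and>
     (\<exists>\<nu>. normal_law 0 (Gamma_mat p \<theta> \<rho> $$ (p, p)) \<nu> \<and>
        weak_conv_m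
          (\<lambda>n. distr M borel (\<lambda>\<omega>. sqrt (real n) *
             (rho_hat p S (\<lambda>k. X k \<omega>) n - rho_star p \<theta> \<rho>)))
          \<nu>)"
proof -
  interpret prob_space M by fact
  interpret ar_process p \<theta> \<rho> M \<sigma> S X \<epsilon> V
    by unfold_locales (use assms in blast)+
  have Z: "(\<lambda>\<omega>. coords (sqrt (real n) \<cdot>\<^sub>v
      ((theta_hat p S (\<lambda>k. X k \<omega>) n - theta_star p \<theta> \<rho>) @\<^sub>v
       vec_of_list [rho_hat p S (\<lambda>k. X k \<omega>) n - rho_star p \<theta> \<rho>]))) = scaled_error n" for n
    by (rule ext) (simp only: scaled_error_def)
  have R: "(\<lambda>\<omega>. sqrt (real n) * (rho_hat p S (\<lambda>k. X k \<omega>) n - rho_star p \<theta> \<rho>)) = rho_dev n" for n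
    by (rule ext) (simp only: rho_dev_def sqn_def)
  show ?thesis unfolding Z R using joint_normality rho_normality by blast
qed

end
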